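(* Let $\mathcal{M}$ be an o-minimal expansion of an ordered group. Let $(X,d)$ be a definable metric space. The following are equivalent. (1) $(X,d)$ is definably separable. (2) $(X,d)$ is hereditarily definably separable. (3) $(X,d)$ does not contain an infinite definable discrete subspace. (4) $(X,d)$ is definably second-countable.
   Context: "Definable" means definable in the structure $\mathcal{M}=(M,0,+,<,\ldots)$, possibly with parameters. O-minimal structures are expansions of dense linear orders without endpoints. A family of sets $\{A_b : b\in B\}$ is definable if there is a formula $\varphi(x,y)$ such that $B\subseteq M^{|y|}$ is definable and $A_b=\{a\in M^{|x|} : \mathcal{M}\models\varphi(a,b)\}$ for every $b\in B$. Families are regarded as sets of sets: a family is infinite if it has infinitely many distinct members, and pairwise disjoint if any two distinct members are disjoint. $\dim$ denotes o-minimal dimension, with $\dim\emptyset=-\infty$. A definable metric space is a pair $(X,d)$ where $X$ is a definable set and $d:X\times X\to M^{\geq 0}$ is a definable map satisfying the metric axioms (identity of indiscernibles, symmetry, subadditivity). It is given the topology $\tau_d$ generated by the open balls $B_d(x,t)=\{y\in X : d(x,y)<t\}$, $x\in X$, $t\in M^{>0}$, and topological properties of $(X,d)$ refer to $(X,\tau_d)$. A definable topological space $(X,\tau)$ is a topological space, $X\subseteq M^n$, such that there exists a definable family of subsets of $X$ that is a basis for $\tau$. It is definably separable if there exists no infinite definable family of pairwise disjoint $\tau$-open sets. It is hereditarily definably separable if every definable subset of $X$, with the subspace topology, is definably separable. It is definably second-countable if there exists a definable basis $\{U_b : b\in B\}$ for $\tau$ such that, for every $x\in X$ and $b\in B$,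 if $x\in U_b$ then $\dim\{c\in B : x\in U_c\subseteq U_b\}=\dim B$. A definable discrete subspace is a definable subset $Y\subseteq X$ whose subspace topology is discrete. *)

theory Defs
  imports "HOL-Analysis.Analysis" "HOL-Library.Extended"
begin

section \<open>Ordered groups, first-order formulas, definable sets\<close>

text \<open>Commutativity is not assumed.\<close>

class linordered_group_add = group_add + linorder +
  assumes add_left_mono_group: "a \<le> b \<Longrightarrow> c + a \<le> c + b"
    and add_right_mono_group: "a \<le> b \<Longrightarrow> a + c \<le> b + c"

text \<open>
  First-order formulas, with de Bruijn indices as variables, in the language of ordered groups
  extended by arbitrary further symbols. Arities are not tracked: a name in \<open>'f\<close> or \<open>'r\<close>
  stands for one function, respectively relation, symbol of each arity.
\<close>

datatype 'f trm =
    Var nat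
  | Zero
  | Plus "'f trm" "'f trm"
  | Fn 'f "'f trm list"

datatype ('f, 'r) fm =
    Eq "'f trm" "'f trm"
  | Less "'f trm" "'f trm"
  | Rel 'r "'f trm list"
  | Neg "('f, 'r) fm"
  | Conj "('f, 'r) fm" "('f, 'r) fm"
  | Ex "('f, 'r) fm"

text \<open>
  The universe of a structure is the whole type \<open>'m\<close>; the record interprets the symbols other
  than \<open>0\<close>, \<open>+\<close> and \<open><\<close>, whose meaning is that of the ordered group \<open>'m\<close>.
\<close>

record ('f, 'r, 'm) expansion =
  fn_interp :: "'f \<Rightarrow> 'm list \<Rightarrow> 'm"
  rel_interp :: "'r \<Rightarrow> 'm list \<Rightarrow> bool"

primrec trm_val ::
  "('f, 'r, 'm::linordered_group_add) expansion \<Rightarrow> (nat \<Rightarrow> 'm) \<Rightarrow> 'f trm \<Rightarrow> 'm" where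
  "trm_val \<M> e (Var i) = e i"
| "trm_val \<M> e Zero = 0"
| "trm_val \<M> e (Plus s t) = trm_val \<M> e s + trm_val \<M> e t"
| "trm_val \<M> e (Fn f ts) = fn_interp \<M> f (map (trm_val \<M> e) ts)"

primrec sat ::
  "('f, 'r, 'm::linordered_group_add) expansion \<Rightarrow> (nat \<Rightarrow> 'm) \<Rightarrow> ('f, 'r) fm \<Rightarrow> bool" where
  "sat \<M> e (Eq s t) \<longleftrightarrow> trm_val \<M> e s = trm_val \<M> e t"
| "sat \<M> e (Less s t) \<longleftrightarrow> trm_val \<M> e s < trm_val \<M> e t"
| "sat \<M> e (Rel r ts) \<longleftrightarrow> rel_interp \<M> r (map (trm_val \<M> e) ts)"
| "sat \<M> e (Neg p) \<longleftrightarrow> \<not> sat \<M> e p"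
| "sat \<M> e (Conj p q) \<longleftrightarrow> sat \<M> e p \<and> sat \<M> e q"
| "sat \<M> e (Ex p) \<longleftrightarrow> (\<exists>a. sat \<M> (case_nat a e) p)"

text \<open>
  Points of \<open>M\<^sup>n\<close> are lists of length \<open>n\<close>. In \<open>with_params xs c\<close> the variables below
  \<open>length xs\<close> range over the tuple \<open>xs\<close> and the remaining ones are parameters; only finitely many
  of these occur in a formula.
\<close>

definition with_params :: "'m list \<Rightarrow> (nat \<Rightarrow> 'm) \<Rightarrow> nat \<Rightarrow> 'm" where
  "with_params xs c i = (if i < length xs then xs ! i else c (i - length xs))"

definition definable ::
  "('f, 'r, 'm::linordered_group_add) expansion \<Rightarrow> nat \<Rightarrow> 'm list set \<Rightarrow> bool" where
  "definable \<M> n X \<longleftrightarrow> (\<exists>p c. X = {xs. length xs = n \<and> sat \<M> (with_params xs c) p})"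

definition definable_family ::
  "('f, 'r, 'm::linordered_group_add) expansion \<Rightarrow> nat \<Rightarrow> nat \<Rightarrow> 'm list set
     \<Rightarrow> ('m list \<Rightarrow> 'm list set) \<Rightarrow> bool" where
  "definable_family \<M> n m B A \<longleftrightarrow>
     definable \<M> m B \<and>
     (\<exists>p c. \<forall>b\<in>B. A b = {a. length a = n \<and> sat \<M> (with_params (a @ b) c) p})"


section \<open>O-minimality and dimension\<close>

definition open_interval :: "'m::linorder extended \<Rightarrow> 'm extended \<Rightarrow> 'm set" where
  "open_interval a b = {x. a < Fin x \<and> Fin x < b}"

definition o_minimal ::
  "('f, 'r, 'm::{linordered_group_add, unbounded_dense_linorder}) expansion \<Rightarrow> bool" where
  "o_minimal \<M> \<longleftrightarrow>
     (\<forall>S. definable \<M> 1 ((\<lambda>x. [x]) ` S) \<longrightarrow>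
        (\<exists>F. finite F \<and> \<Union>F = S \<and> (\<forall>I\<in>F. (\<exists>a. I = {a}) \<or> (\<exists>a b. I = open_interval a b))))"

text \<open>The product topology on \<open>M\<^sup>n\<close> induced by the order topology on \<open>M\<close>.\<close>

definition order_box_topology :: "nat \<Rightarrow> 'm::linorder list topology" where
  "order_box_topology n =
     topology_generated_by
       {{xs. length xs = n \<and> (\<forall>i<n. xs ! i \<in> open_interval (a i) (b i))} | a b. True}"

text \<open>Definable continuous functions \<open>X \<rightarrow> M\<close>, and the same with the constants
  \<open>\<plusminus>\<infinity>\<close> added; only values on \<open>X\<close> matter.\<close>

definition def_cont ::
  "('f, 'r, 'm::linordered_group_add) expansion \<Rightarrow> nat \<Rightarrow> 'm list set \<Rightarrow> ('m list \<Rightarrow> 'm) \<Rightarrow> bool"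
  where
  "def_cont \<M> n X f \<longleftrightarrow>
     definable \<M> (n + 1) {x @ [f x] | x. x \<in> X} \<and>
     continuous_map (subtopology (order_box_topology n) X) (order_box_topology 1) (\<lambda>x. [f x])"

definition def_cont_inf ::
  "('f, 'r, 'm::linordered_group_add) expansion \<Rightarrow> nat \<Rightarrow> 'm list set
     \<Rightarrow> ('m list \<Rightarrow> 'm extended) \<Rightarrow> bool" where
  "def_cont_inf \<M> n X f \<longleftrightarrow>
     (\<exists>g. def_cont \<M> n X g \<and> f = Fin \<circ> g) \<or> f = (\<lambda>_. Minf) \<or> f = (\<lambda>_. Pinf)"

text \<open>\<open>cell \<M> ks C\<close>: the set \<open>C\<close> is a \<open>(k\<^sub>1, \<dots>, k\<^sub>n)\<close>-cell in the sense of van den Dries,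
  starting from the one-point space \<open>M\<^sup>0\<close>.\<close>

inductive cell ::
  "('f, 'r, 'm::linordered_group_add) expansion \<Rightarrow> nat list \<Rightarrow> 'm list set \<Rightarrow> bool"
  for \<M> where
  point: "cell \<M> [] {[]}"
| graph: "cell \<M> ks C \<Longrightarrow> def_cont \<M> (length ks) C f \<Longrightarrow>
    cell \<M> (ks @ [0]) {x @ [f x] | x. x \<in> C}"
| band: "cell \<M> ks C \<Longrightarrow> def_cont_inf \<M> (length ks) C f \<Longrightarrow> def_cont_inf \<M> (length ks) C g \<Longrightarrow>
    (\<forall>x\<in>C. f x < g x) \<Longrightarrow>
    cell \<M> (ks @ [1]) {x @ [y] | x y. x \<in> C \<and> y \<in> open_interval (f x) (g x)}"

text \<open>For nonempty \<open>X \<subseteq> M\<^sup>n\<close> the supremum is a maximum of numbers at most \<open>n\<close>; for empty \<open>X\<close> it is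
  \<open>-\<infinity>\<close>, since cells are nonempty.\<close>

definition o_dim ::
  "('f, 'r, 'm::linordered_group_add) expansion \<Rightarrow> 'm list set \<Rightarrow> ereal" where
  "o_dim \<M> X = Sup {ereal (real (sum_list ks)) | ks C. cell \<M> ks C \<and> C \<subseteq> X}"


section \<open>Definable metric spaces\<close>

definition definable_metric_space ::
  "('f, 'r, 'm::linordered_group_add) expansion \<Rightarrow> nat \<Rightarrow> 'm list set
     \<Rightarrow> ('m list \<Rightarrow> 'm list \<Rightarrow> 'm) \<Rightarrow> bool" where
  "definable_metric_space \<M> n X d \<longleftrightarrow>
     definable \<M> n X \<and>
     definable \<M> (2 * n + 1) {x @ y @ [d x y] | x y. x \<in> X \<and> y \<in> X} \<and>
     (\<forall>x\<in>X. \<forall>y\<in>X. 0 \<le> d x y) \<and>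
     (\<forall>x\<in>X. \<forall>y\<in>X. d x y = 0 \<longleftrightarrow> x = y) \<and>
     (\<forall>x\<in>X. \<forall>y\<in>X. d x y = d y x) \<and>
     (\<forall>x\<in>X. \<forall>y\<in>X. \<forall>z\<in>X. d x z \<le> d x y + d y z)"

definition metric_ball ::
  "'m list set \<Rightarrow> ('m list \<Rightarrow> 'm list \<Rightarrow> 'm::linordered_group_add) \<Rightarrow> 'm list \<Rightarrow> 'm \<Rightarrow> 'm list set"
  where
  "metric_ball X d x t = {y \<in> X. d x y < t}"

definition metric_top ::
  "'m list set \<Rightarrow> ('m list \<Rightarrow> 'm list \<Rightarrow> 'm::linordered_group_add) \<Rightarrow> 'm list topology" where
  "metric_top X d = topology_generated_by {metric_ball X d x t | x t. x \<in> X \<and> 0 < t}"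


section \<open>Definable topological properties\<close>

text \<open>Below, \<open>\<tau>\<close> is a topology on a subset \<open>topspace \<tau>\<close> of \<open>M\<^sup>n\<close>. A definable family is given by an
  indexing map \<open>U\<close> on \<open>B\<close>, and as a set of sets it is the image \<open>U ` B\<close>.\<close>

definition definably_separable ::
  "('f, 'r, 'm::linordered_group_add) expansion \<Rightarrow> nat \<Rightarrow> 'm list topology \<Rightarrow> bool" where
  "definably_separable \<M> n \<tau> \<longleftrightarrow>
     \<not> (\<exists>m B U. definable_family \<M> n m B U \<and> infinite (U ` B) \<and>
          pairwise disjnt (U ` B) \<and> (\<forall>b\<in>B. openin \<tau> (U b)))"

definition hereditarily_definably_separable ::
  "('f, 'r, 'm::linordered_group_add) expansion \<Rightarrow> nat \<Rightarrow> 'm list topology \<Rightarrow> bool" where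
  "hereditarily_definably_separable \<M> n \<tau> \<longleftrightarrow>
     (\<forall>Y. definable \<M> n Y \<and> Y \<subseteq> topspace \<tau> \<longrightarrow> definably_separable \<M> n (subtopology \<tau> Y))"

definition definable_discrete_subspace ::
  "('f, 'r, 'm::linordered_group_add) expansion \<Rightarrow> nat \<Rightarrow> 'm list topology \<Rightarrow> 'm list set \<Rightarrow> bool"
  where
  "definable_discrete_subspace \<M> n \<tau> Y \<longleftrightarrow>
     definable \<M> n Y \<and> Y \<subseteq> topspace \<tau> \<and> subtopology \<tau> Y = discrete_topology Y"

definition definable_basis ::
  "('f, 'r, 'm::linordered_group_add) expansion \<Rightarrow> nat \<Rightarrow> 'm list topology \<Rightarrow> nat \<Rightarrow> 'm list set
     \<Rightarrow> ('m list \<Rightarrow> 'm list set) \<Rightarrow> bool" where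
  "definable_basis \<M> n \<tau> m B U \<longleftrightarrow>
     definable_family \<M> n m B U \<and> openin \<tau> = arbitrary union_of (\<lambda>V. V \<in> U ` B)"

definition definably_second_countable ::
  "('f, 'r, 'm::linordered_group_add) expansion \<Rightarrow> nat \<Rightarrow> 'm list topology \<Rightarrow> bool" where
  "definably_second_countable \<M> n \<tau> \<longleftrightarrow>
     (\<exists>m B U. definable_basis \<M> n \<tau> m B U \<and>
        (\<forall>x\<in>topspace \<tau>. \<forall>b\<in>B. x \<in> U b \<longrightarrow>
           o_dim \<M> {c \<in> B. x \<in> U c \<and> U c \<subseteq> U b} = o_dim \<M> B))"

end

theory Submission
  imports Defs
begin

text \<open>
  All properties are compared with the absence of infinite definable discrete subspaces. If \<open>Y\<close> is
  discrete, the sets of points closer to \<open>y \<in> Y\<close> than half the distance from \<open>y\<close> to the rest of \<open>Y\<close>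
  violate separability, and the basis elements isolating the points of \<open>Y\<close> form infinitely many
  disjoint subsets of full dimension of the index set of a basis, which violates
  second-countability. Conversely, definable choice turns a family of disjoint open sets into a
  discrete set.

  For the converse concerning second-countability the main point is that without infinite
  definable discrete sets every definable \<open>Z\<close> of dimension \<open>k\<close> has a point all of whose balls meet
  \<open>Z\<close> in dimension \<open>k\<close>. One may take \<open>Z\<close> to be a box in \<open>M\<^sup>k\<close> with some definable metric and use
  induction on \<open>k\<close>: for \<open>k = 1\<close>, if all points had finite balls then \<open>Z\<close> would be discrete;
  for \<open>k > 1\<close> the hyperplane slices in two different directions have full-dimensional balls, and by the
  triangle inequality these combine to full-dimensional balls in \<open>Z\<close>. It follows that the points of
  local dimension \<open>k\<close> form a \<open>k\<close>-dimensional set around each of them, and balls indexed by centre,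
  radius and \<open>n - k\<close> additional free coordinates are the required basis.

  Dimension is handled through the recursive notion \<open>dge\<close>, which only looks at fibres over the last
  coordinate. Its agreement with the cell dimension needs generic continuity of definable
  functions, obtained from the monotonicity theorem, but no full cell decomposition.
\<close>

section \<open>Definable predicates on environments\<close>

text \<open>The metric topology need not be related to the order topology of \<open>M\<close>, so a
  cell inside a set says nothing about the dimension of its metric balls. The slice argument bridges
  this gap: it uses the triangle inequality, the absence of infinite discrete sets, and the fact
  that all but finitely many slices avoid a given exceptional set in full dimension. Two directions
  of slicing are used because a ball inside one hyperplane slice has dimension one too small, and
  the missing direction has to be swept out by slices transversal to it.

  Additivity of dimension enters in one form only, \<open>dge_finite_to_one\<close>: if infinitely
  many members of a one-parameter family have dimension at least k and every point lies in finitely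
  many members, then the union has dimension at least k + 1. This also permits slicing by the first
  coordinate, although \<open>dge\<close> recurses on the last one.

  Commutativity and divisibility of the group are not derived from o-minimality. Density takes the
  place of halving, and estimates keep the order of the summands.\<close>

primrec ren_trm :: "(nat \<Rightarrow> nat) \<Rightarrow> 'f trm \<Rightarrow> 'f trm" where
  "ren_trm r (Var i) = Var (r i)"
| "ren_trm r Zero = Zero"
| "ren_trm r (Plus s t) = Plus (ren_trm r s) (ren_trm r t)"
| "ren_trm r (Fn f ts) = Fn f (map (ren_trm r) ts)"

primrec ren_fm :: "(nat \<Rightarrow> nat) \<Rightarrow> ('f, 'r) fm \<Rightarrow> ('f, 'r) fm" where
  "ren_fm r (Eq s t) = Eq (ren_trm r s) (ren_trm r t)"
| "ren_fm r (Less s t) = Less (ren_trm r s) (ren_trm r t)"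
| "ren_fm r (Rel R ts) = Rel R (map (ren_trm r) ts)"
| "ren_fm r (Neg p) = Neg (ren_fm r p)"
| "ren_fm r (Conj p q) = Conj (ren_fm r p) (ren_fm r q)"
| "ren_fm r (Ex p) = Ex (ren_fm (case_nat 0 (\<lambda>i. Suc (r i))) p)"

lemma trm_val_ren: "trm_val \<M> e (ren_trm r t) = trm_val \<M> (\<lambda>i. e (r i)) t"
  by (induction t) (auto simp: comp_def cong: map_cong)

lemma sat_ren: "sat \<M> e (ren_fm r p) = sat \<M> (\<lambda>i. e (r i)) p"
proof (induction p arbitrary: e r)
  case (Ex p)
  have "(\<lambda>i. case_nat a e (case_nat 0 (\<lambda>i. Suc (r i)) i)) = case_nat a (\<lambda>i. e (r i))" for a
    by (auto split: nat.split)
  then show ?case by (simp add: Ex)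
qed (auto simp: trm_val_ren comp_def cong: map_cong)

primrec fin_trm :: "'f trm \<Rightarrow> nat" where
  "fin_trm (Var i) = Suc i"
| "fin_trm Zero = 0"
| "fin_trm (Plus s t) = max (fin_trm s) (fin_trm t)"
| "fin_trm (Fn f ts) = Max (insert 0 (set (map fin_trm ts)))"

lemma trm_val_cong:
  assumes "\<And>i. i < fin_trm t \<Longrightarrow> e i = e' i"
  shows "trm_val \<M> e t = trm_val \<M> e' t"
  using assms
proof (induction t)
  case (Fn f ts)
  have "trm_val \<M> e s = trm_val \<M> e' s" if s: "s \<in> set ts" for s
  proof (rule Fn.IH[OF s])
    fix i assume "i < fin_trm s"
    moreover have "fin_trm s \<le> fin_trm (Fn f ts)" using s by (auto intro!: Max_ge)
    ultimately show "e i = e' i" using Fn.prems by auto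
  qed
  then show ?case by (simp cong: map_cong)
qed auto

lemma ex_fin_trms: "\<exists>N. \<forall>e e'. (\<forall>i<N. e i = e' i) \<longrightarrow> map (trm_val \<M> e) ts = map (trm_val \<M> e') ts"
proof -
  let ?N = "Max (insert 0 (set (map fin_trm ts)))"
  have "map (trm_val \<M> e) ts = map (trm_val \<M> e') ts" if "\<forall>i<?N. e i = e' i" for e e'
  proof (rule map_cong[OF refl])
    fix s assume s: "s \<in> set ts"
    have "fin_trm s \<le> ?N" using s by (auto intro!: Max_ge)
    then show "trm_val \<M> e s = trm_val \<M> e' s"
      using that by (intro trm_val_cong) auto
  qed
  then show ?thesis by blast
qed

text \<open>\<open>dp_comp\<close> replaces the variables of a formula one at a time, and this bound
  is what makes that process end.\<close>

lemma ex_fin_fm: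
  fixes \<M> :: "('f, 'r, 'm::linordered_group_add) expansion"
  shows "\<exists>N. \<forall>e e'. (\<forall>i<N. e i = e' i) \<longrightarrow> sat \<M> e p = sat \<M> e' p"
proof (induction p)
  case (Eq s t)
  obtain N where "\<forall>e e'. (\<forall>i<N. e i = e' i) \<longrightarrow> map (trm_val \<M> e) [s, t] = map (trm_val \<M> e') [s, t]"
    using ex_fin_trms by blast
  then show ?case by (intro exI[of _ N] allI impI) (simp, metis)
next
  case (Less s t)
  obtain N where "\<forall>e e'. (\<forall>i<N. e i = e' i) \<longrightarrow> map (trm_val \<M> e) [s, t] = map (trm_val \<M> e') [s, t]"
    using ex_fin_trms by blast
  then show ?case by (intro exI[of _ N] allI impI) (simp, metis)
next
  case (Rel R ts)
  obtain N where "\<forall>e e'. (\<forall>i<N. e i = e' i) \<longrightarrow> map (trm_val \<M> e) ts = map (trm_val \<M> e') ts"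
    using ex_fin_trms by blast
  then show ?case by (intro exI[of _ N] allI impI) (metis sat.simps(3))
next
  case (Neg p)
  then show ?case by simp
next
  case (Conj p q)
  then obtain N N' where
    N: "\<forall>e e'. (\<forall>i<N. e i = e' i) \<longrightarrow> sat \<M> e p = sat \<M> e' p" and
    N': "\<forall>e e'. (\<forall>i<N'. e i = e' i) \<longrightarrow> sat \<M> e q = sat \<M> e' q" by blast
  show ?case
  proof (intro exI[of _ "max N N'"] allI impI)
    fix e e' :: "nat \<Rightarrow> 'm" assume *: "\<forall>i<max N N'. e i = e' i"
    have "sat \<M> e p = sat \<M> e' p" using * by (intro N[rule_format]) auto
    moreover have "sat \<M> e q = sat \<M> e' q" using * by (intro N'[rule_format]) auto
    ultimately show "sat \<M> e (Conj p q) = sat \<M> e' (Conj p q)" by simp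
  qed
next
  case (Ex p)
  then obtain N where N: "\<forall>e e'. (\<forall>i<N. e i = e' i) \<longrightarrow> sat \<M> e p = sat \<M> e' p" by blast
  show ?case
  proof (intro exI[of _ N] allI impI)
    fix e e' :: "nat \<Rightarrow> 'm" assume *: "\<forall>i<N. e i = e' i"
    have "sat \<M> (case_nat a e) p = sat \<M> (case_nat a e') p" for a
      using * by (intro N[rule_format]) (auto split: nat.split)
    then show "sat \<M> e (Ex p) = sat \<M> e' (Ex p)" by simp
  qed
qed

text \<open>Interleaving keeps variable \<open>i\<close> at position \<open>2 * i\<close> however
  many variables are in use and leaves infinitely many positions for parameters. In
  \<open>with_params\<close> the position of the parameters depends on the length of the
  tuple.\<close>

definition mix :: "(nat \<Rightarrow> 'm) \<Rightarrow> (nat \<Rightarrow> 'm) \<Rightarrow> nat \<Rightarrow> 'm" where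
  "mix e c i = (if even i then e (i div 2) else c (i div 2))"

lemma mix_simps [simp]: "mix e c (2 * i) = e i" "mix e c (Suc (2 * i)) = c i"
  by (auto simp: mix_def)

section \<open>Closure properties of definable predicates\<close>

locale expansion_structure =
  fixes \<M> :: "('f, 'r, 'm::{linordered_group_add, unbounded_dense_linorder}) expansion"
begin

text \<open>Here and below \<open>e\<close> assigns values to the free variables; parameters are hidden in the
  odd-numbered variables of a formula. Binding a variable shifts the environment by one.\<close>

definition dp :: "((nat \<Rightarrow> 'm) \<Rightarrow> bool) \<Rightarrow> bool" where
  "dp P \<longleftrightarrow> (\<exists>p c. \<forall>e. P e \<longleftrightarrow> sat \<M> (mix e c) p)"

definition df :: "((nat \<Rightarrow> 'm) \<Rightarrow> 'm) \<Rightarrow> bool" where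
  "df t \<longleftrightarrow> dp (\<lambda>e. e 0 = t (\<lambda>i. e (Suc i)))"

definition dl :: "nat \<Rightarrow> ((nat \<Rightarrow> 'm) \<Rightarrow> 'm list) \<Rightarrow> bool" where
  "dl n L \<longleftrightarrow> (\<forall>e. length (L e) = n) \<and> (\<forall>i<n. df (\<lambda>e. L e ! i))"

lemma dp_subst:
  assumes "dp P" and g: "\<And>i. (\<exists>j. \<forall>e. g e i = e j) \<or> (\<exists>a. \<forall>e. g e i = a)"
  shows "dp (\<lambda>e. P (g e))"
proof -
  obtain p c where pc: "\<And>e. P e \<longleftrightarrow> sat \<M> (mix e c) p" using assms(1) by (auto simp: dp_def)
  obtain a where a: "\<And>i. (\<exists>j. \<forall>e. g e i = e j) \<or> (\<forall>e. g e i = a i)" using g by metis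
  define v where "v i \<longleftrightarrow> (\<exists>j. \<forall>e. g e i = e j)" for i
  have "\<forall>i. \<exists>j. v i \<longrightarrow> (\<forall>e. g e i = e j)" by (auto simp: v_def)
  then obtain j where j: "\<And>i e. v i \<Longrightarrow> g e i = e (j i)" by metis
  \<comment> \<open>A coordinate of \<open>g\<close> that is not a variable is constant. Its
    position \<open>k\<close> is redirected to parameter number \<open>k\<close>: \<open>c'\<close>
    holds these constants at even numbers and the old parameters at odd ones.\<close>
  define r where "r k = (if even k then if v (k div 2) then 2 * j (k div 2) else Suc (2 * k)
                         else Suc (2 * k))" for k
  define c' where "c' k = (if even k then a (k div 2) else c (k div 2))" for k
  have "mix (g e) c k = mix e c' (r k)" for e k
  proof (cases "even k")
    case True
    then show ?thesis
      using a[of "k div 2"] j[of "k div 2" e]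
      by (cases "v (k div 2)") (auto simp: r_def c'_def mix_def v_def)
  next
    case False
    then show ?thesis by (auto simp: r_def c'_def mix_def)
  qed
  then have "mix (g e) c = (\<lambda>k. mix e c' (r k))" for e by auto
  then have "P (g e) \<longleftrightarrow> sat \<M> (mix e c') (ren_fm r p)" for e
    by (simp add: pc sat_ren)
  then show ?thesis unfolding dp_def by blast
qed

lemma dp_finite:
  assumes "dp P"
  obtains N where "\<And>e e'. (\<And>i. i < N \<Longrightarrow> e i = e' i) \<Longrightarrow> P e = P e'"
proof -
  obtain p c where pc: "\<And>e. P e \<longleftrightarrow> sat \<M> (mix e c) p" using assms(1) by (auto simp: dp_def)
  obtain N where N: "\<And>e e'. (\<And>i. i < N \<Longrightarrow> e i = e' i) \<Longrightarrow> sat \<M> e p = sat \<M> e' p"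
    using ex_fin_fm by metis
  show ?thesis
  proof (rule that[of N])
    fix e e' :: "nat \<Rightarrow> 'm" assume "\<And>i. i < N \<Longrightarrow> e i = e' i"
    then show "P e = P e'"
      unfolding pc by (intro N) (auto simp: mix_def)
  qed
qed

lemma dp_sat: "dp (\<lambda>e. sat \<M> e p)"
  unfolding dp_def by (intro exI[of _ "ren_fm (\<lambda>i. 2 * i) p"]) (simp add: sat_ren)

lemma dp_neg: "dp P \<Longrightarrow> dp (\<lambda>e. \<not> P e)"
  unfolding dp_def using sat.simps(4) by metis

lemma dp_conj:
  assumes "dp P" "dp Q" shows "dp (\<lambda>e. P e \<and> Q e)"
proof -
  obtain p c where pc: "\<And>e. P e \<longleftrightarrow> sat \<M> (mix e c) p" using assms(1) by (auto simp: dp_def)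
  obtain q d where qd: "\<And>e. Q e \<longleftrightarrow> sat \<M> (mix e d) q" using assms(2) by (auto simp: dp_def)
  \<comment> \<open>The two parameter sequences are interleaved in turn, so that neither formula
    captures a parameter of the other.\<close>
  define r where "r k = (if even k then k else Suc (2 * (2 * (k div 2))))" for k :: nat
  define s where "s k = (if even k then k else Suc (2 * Suc (2 * (k div 2))))" for k :: nat
  have r: "mix e c = (\<lambda>k. mix e (mix c d) (r k))" for e
  proof
    fix k show "mix e c k = mix e (mix c d) (r k)"
      by (cases "even k") (auto simp: r_def mix_def elim!: oddE)
  qed
  have s: "mix e d = (\<lambda>k. mix e (mix c d) (s k))" for e
  proof
    fix k show "mix e d k = mix e (mix c d) (s k)"
      by (cases "even k") (auto simp: s_def mix_def elim!: oddE)
  qed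
  have "P e \<and> Q e \<longleftrightarrow> sat \<M> (mix e (mix c d)) (Conj (ren_fm r p) (ren_fm s q))" for e
    by (simp add: sat_ren pc qd flip: r s)
  then show ?thesis unfolding dp_def by blast
qed

lemma dp_ex:
  assumes "dp (\<lambda>e. Q (\<lambda>i. e (Suc i)) (e 0))" shows "dp (\<lambda>e. \<exists>a. Q e a)"
proof -
  obtain p c where pc: "\<And>e. Q (\<lambda>i. e (Suc i)) (e 0) \<longleftrightarrow> sat \<M> (mix e c) p"
    using assms(1) by (auto simp: dp_def)
  \<comment> \<open>Prepending \<open>a\<close> inside \<open>mix\<close> moves the environment by
    two positions and the parameters by none, whereas the quantifier moves everything by one. Hence
    even positions go down by one and odd ones go up by one.\<close>
  define r where "r k = (if k = 0 then 0 else if even k then Suc (k - 2) else Suc k)" for k :: nat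
  have r: "mix (case_nat a e) c = (\<lambda>k. case_nat a (mix e c) (r k))" for a e
  proof
    fix k
    consider "k = 0" | i where "k = 2 * Suc i" | i where "k = Suc (2 * i)"
      by (metis oddE evenE not0_implies_Suc Suc_eq_plus1 mult_0_right)
    then show "mix (case_nat a e) c k = case_nat a (mix e c) (r k)"
      by cases (simp_all add: r_def, simp_all add: mix_def)
  qed
  have "(\<exists>a. Q e a) \<longleftrightarrow> sat \<M> (mix e c) (Ex (ren_fm r p))" for e
  proof -
    have "Q e a \<longleftrightarrow> sat \<M> (case_nat a (mix e c)) (ren_fm r p)" for a
      using pc[of "case_nat a e"] by (simp add: sat_ren flip: r)
    then show ?thesis by simp
  qed
  then show ?thesis unfolding dp_def by blast
qed

lemma dp_const: "dp (\<lambda>e. P)"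
proof -
  have "dp (\<lambda>e. sat \<M> e (if P then Eq Zero Zero else Neg (Eq Zero Zero)))" by (rule dp_sat)
  then show ?thesis by (cases P) auto
qed

lemma dp_disj: "dp P \<Longrightarrow> dp Q \<Longrightarrow> dp (\<lambda>e. P e \<or> Q e)"
  using dp_neg[OF dp_conj[OF dp_neg dp_neg], of P Q] by simp

lemma dp_imp: "dp P \<Longrightarrow> dp Q \<Longrightarrow> dp (\<lambda>e. P e \<longrightarrow> Q e)"
  using dp_disj[OF dp_neg, of P Q] by (simp only: imp_conv_disj)

lemma dp_iff: "dp P \<Longrightarrow> dp Q \<Longrightarrow> dp (\<lambda>e. P e = Q e)"
  using dp_conj[OF dp_imp dp_imp, of P Q Q P] by (simp only: iff_conv_conj_imp)

lemma dp_all: "dp (\<lambda>e. Q (\<lambda>i. e (Suc i)) (e 0)) \<Longrightarrow> dp (\<lambda>e. \<forall>a. Q e a)"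
  using dp_neg[OF dp_ex[of "\<lambda>e a. \<not> Q e a"]] by (simp add: dp_neg)

lemma dp_shift: "dp P \<Longrightarrow> dp (\<lambda>e. P (\<lambda>i. e (f i)))"
  by (erule dp_subst) auto

lemma df_shift: "df t \<Longrightarrow> df (\<lambda>e. t (\<lambda>i. e (f i)))"
  unfolding df_def
  by (drule dp_subst[where g = "\<lambda>e i. case i of 0 \<Rightarrow> e 0 | Suc j \<Rightarrow> e (Suc (f j))"])
    (auto split: nat.split)

lemma df_var: "df (\<lambda>e. e i)"
proof -
  have "dp (\<lambda>e. sat \<M> e (Eq (Var 0) (Var (Suc i))))" by (rule dp_sat)
  then show ?thesis by (simp add: df_def)
qed

lemma df_const: "df (\<lambda>e. a)"
proof -
  have "dp (\<lambda>e. sat \<M> (case_nat (e 0) (\<lambda>i. a)) (Eq (Var 0) (Var 1)))"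
    by (rule dp_subst[OF dp_sat, where g = "\<lambda>e. case_nat (e 0) (\<lambda>i. a)"]) (auto split: nat.split)
  then show ?thesis by (simp add: df_def)
qed

text \<open>Functions with definable graph may be substituted for one variable, hence for finitely
  many; a formula has no more than that.\<close>

lemma dp_subst1:
  assumes "dp (\<lambda>e. Q (\<lambda>i. e (Suc i)) (e 0))" and "df t"
  shows "dp (\<lambda>e. Q e (t e))"
proof -
  have "dp (\<lambda>e. \<exists>a. a = t e \<and> Q e a)"
    using assms by (intro dp_ex dp_conj) (auto simp: df_def)
  then show ?thesis by simp
qed

lemma dp_comp:
  assumes "dp P" and g: "\<And>i. df (\<lambda>e. g e i)"
  shows "dp (\<lambda>e. P (g e))"
proof -
  obtain N where N: "\<And>e e'. (\<And>i. i < N \<Longrightarrow> e i = e' i) \<Longrightarrow> P e = P e'"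
    using dp_finite[OF assms(1)] by blast
  \<comment> \<open>\<open>g\<close> reads its arguments from position \<open>N\<close> on, so
    overwriting the first \<open>N\<close> positions one after another never destroys an argument.
    The shift by \<open>i - N\<close> at the end brings the arguments back.\<close>
  define h where "h K = (\<lambda>e i. if i < K then g (\<lambda>j. e (N + j)) i else e i)" for K
  have *: "dp (\<lambda>e. P (h K e))" if "K \<le> N" for K
    using that
  proof (induction K)
    case 0
    then show ?case using assms(1) by (simp add: h_def)
  next
    case (Suc K)
    define Q where "Q e a = P ((h K e)(K := a))" for e a
    have "dp (\<lambda>e. P (h K e))" using Suc by simp
    moreover have "h K (\<lambda>i. if i = K then e 0 else e (Suc i)) = (h K (\<lambda>i. e (Suc i)))(K := e 0)" for
      e
      using Suc.prems by (auto simp: h_def fun_eq_iff)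
    ultimately have "dp (\<lambda>e. Q (\<lambda>i. e (Suc i)) (e 0))"
      using dp_subst[where P = "\<lambda>e. P (h K e)" and g = "\<lambda>e i. if i = K then e 0 else e (Suc i)"]
      by (force simp: Q_def)
    then have "dp (\<lambda>e. Q e (g (\<lambda>j. e (N + j)) K))"
      by (rule dp_subst1) (rule df_shift[OF g])
    moreover have "(h K e)(K := g (\<lambda>j. e (N + j)) K) = h (Suc K) e" for e
      by (auto simp: h_def less_Suc_eq fun_eq_iff)
    ultimately show ?case by (simp add: Q_def)
  qed
  have "dp (\<lambda>e. P (h N e))" by (rule *) simp
  moreover have "P (h N e) = P (g (\<lambda>j. e (N + j)))" for e
    by (rule N) (simp add: h_def)
  ultimately have "dp (\<lambda>e. P (g (\<lambda>j. e (N + j))))" by simp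
  from dp_shift[OF this, of "\<lambda>i. i - N"] show ?thesis by simp
qed

lemma dp_comp2:
  assumes "dp (\<lambda>e. R (e 0) (e 1))" "df s" "df t" shows "dp (\<lambda>e. R (s e) (t e))"
proof -
  define g where "g e i = (if i = 0 then s e else t e)" for e and i :: nat
  have "df (\<lambda>e. g e i)" for i using assms(2,3) by (cases "i = 0") (simp_all add: g_def)
  then have "dp (\<lambda>e. R (g e 0) (g e 1))" by (rule dp_comp[OF assms(1)])
  then show ?thesis by (simp add: g_def)
qed

lemma dp_eq: "df s \<Longrightarrow> df t \<Longrightarrow> dp (\<lambda>e. s e = t e)"
  by (rule dp_comp2) (use dp_sat[of "Eq (Var 0) (Var 1)"] in simp_all)

lemma dp_less: "df s \<Longrightarrow> df t \<Longrightarrow> dp (\<lambda>e. s e < t e)"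
  by (rule dp_comp2) (use dp_sat[of "Less (Var 0) (Var 1)"] in simp_all)

lemma dp_le: "df s \<Longrightarrow> df t \<Longrightarrow> dp (\<lambda>e. s e \<le> t e)"
  using dp_neg[OF dp_less, of t s] by (simp add: not_less)

lemma df_comp:
  assumes "df t" and g: "\<And>i. df (\<lambda>e. g e i)"
  shows "df (\<lambda>e. t (g e))"
proof -
  define h where "h e = case_nat (e 0) (g (\<lambda>i. e (Suc i)))" for e :: "nat \<Rightarrow> 'm"
  have "df (\<lambda>e. h e i)" for i
    by (cases i) (simp_all add: h_def df_var df_shift[OF g])
  then have "dp (\<lambda>e. h e 0 = t (\<lambda>i. h e (Suc i)))"
    by (rule dp_comp[OF assms(1)[unfolded df_def]])
  then show ?thesis by (simp add: df_def h_def)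
qed

lemma df_if:
  assumes "dp P" "df s" "df t" shows "df (\<lambda>e. if P e then s e else t e)"
proof -
  have "dp (\<lambda>e. P (\<lambda>i. e (Suc i)) \<and> e 0 = s (\<lambda>i. e (Suc i))
             \<or> \<not> P (\<lambda>i. e (Suc i)) \<and> e 0 = t (\<lambda>i. e (Suc i)))"
    using assms(2,3) dp_shift[OF assms(1), of Suc]
    by (intro dp_disj dp_conj dp_neg) (auto simp: df_def)
  moreover have "(e 0 = (if P (\<lambda>i. e (Suc i)) then s (\<lambda>i. e (Suc i)) else t (\<lambda>i. e (Suc i)))) \<longleftrightarrow>
      P (\<lambda>i. e (Suc i)) \<and> e 0 = s (\<lambda>i. e (Suc i))
             \<or> \<not> P (\<lambda>i. e (Suc i)) \<and> e 0 = t (\<lambda>i. e (Suc i))" for e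
    by auto
  ultimately show ?thesis by (simp only: df_def)
qed

lemma df_if_const: "(P \<Longrightarrow> df s) \<Longrightarrow> (\<not> P \<Longrightarrow> df t) \<Longrightarrow> df (\<lambda>e. if P then s e else t e)"
  by (cases P) simp_all

lemma df_rel:
  assumes "dp (\<lambda>e. Q (\<lambda>i. e (Suc i)) (e 0))" and "\<And>e a. Q e a \<longleftrightarrow> a = t e"
  shows "df t"
  using assms by (simp add: df_def)

lemma df_plus: "df s \<Longrightarrow> df t \<Longrightarrow> df (\<lambda>e. s e + t e)"
proof -
  assume st: "df s" "df t"
  have "dp (\<lambda>e. sat \<M> e (Eq (Var 0) (Plus (Var 1) (Var 2))))" by (rule dp_sat)
  then have "df (\<lambda>e. e 0 + e 1)" by (simp add: df_def numeral_2_eq_2)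
  moreover define g where "g e i = (if i = 0 then s e else t e)" for e and i :: nat
  have "df (\<lambda>e. g e i)" for i using st by (cases "i = 0") (simp_all add: g_def)
  ultimately have "df (\<lambda>e. g e 0 + g e 1)" by (rule df_comp)
  then show ?thesis by (simp add: g_def)
qed

lemma df_uminus: "df t \<Longrightarrow> df (\<lambda>e. - t e)"
proof -
  assume "df t"
  then have "dp (\<lambda>e. e 0 + t (\<lambda>i. e (Suc i)) = 0)"
    by (intro dp_eq df_plus df_var df_const) (rule df_shift)
  then show ?thesis
    by (rule df_rel[where Q = "\<lambda>e a. a + t e = 0"]) (simp add: eq_neg_iff_add_eq_0)
qed

lemma df_minus: "df s \<Longrightarrow> df t \<Longrightarrow> df (\<lambda>e. s e - t e)"
  using df_plus[OF _ df_uminus, of s t] by simp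

section \<open>Tuples of definable functions\<close>

lemma dl_map: "(\<And>i. df (t i)) \<Longrightarrow> dl n (\<lambda>e. map (\<lambda>i. t i e) [0..<n])"
  by (auto simp: dl_def)

lemma dl_const: "length x = n \<Longrightarrow> dl n (\<lambda>e. x)"
  by (auto simp: dl_def df_const)

lemma dl_Cons: "df t \<Longrightarrow> dl n L \<Longrightarrow> dl (Suc n) (\<lambda>e. t e # L e)"
  by (auto simp: dl_def nth_Cons' intro!: df_if_const)

lemma dl_append: "dl n L \<Longrightarrow> dl m K \<Longrightarrow> dl (n + m) (\<lambda>e. L e @ K e)"
  by (auto simp: dl_def nth_append intro!: df_if_const)

lemma dl_snoc: "dl n L \<Longrightarrow> df t \<Longrightarrow> dl (Suc n) (\<lambda>e. L e @ [t e])"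
  using dl_append[of n L 1 "\<lambda>e. [t e]"] dl_Cons[OF _ dl_const[of "[]"], of t] by simp

lemma dl_nth: "dl n L \<Longrightarrow> i < n \<Longrightarrow> df (\<lambda>e. L e ! i)"
  by (auto simp: dl_def)

lemma dl_eq_map: "dl n L \<Longrightarrow> L e = map (\<lambda>i. L e ! i) [0..<n]"
  by (auto simp: dl_def intro: nth_equalityI)

lemma dp_list_comp:
  assumes "dp (\<lambda>e. P (map e [0..<n]) (\<lambda>i. e (n + i)))" and L: "dl n L" and g: "\<And>i. df (\<lambda>e. g e i)"
  shows "dp (\<lambda>e. P (L e) (g e))"
proof -
  have "dp (\<lambda>e. P (map (\<lambda>i. if i < n then L e ! i else g e (i - n)) [0..<n])
       (\<lambda>i. if n + i < n then L e ! (n + i) else g e (n + i - n)))"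
    by (rule dp_comp[OF assms(1), of "\<lambda>e i. if i < n then L e ! i else g e (i - n)"])
      (rule df_if_const, use dl_nth[OF L] g in simp_all)
  moreover have "map (\<lambda>i. if i < n then L e ! i else g e (i - n)) [0..<n] = L e" for e
    by (subst (2) dl_eq_map[OF L]) auto
  ultimately show ?thesis by simp
qed

lemma dp_exl:
  assumes "dp (\<lambda>e. Q (\<lambda>i. e (n + i)) (map e [0..<n]))"
  shows "dp (\<lambda>e. \<exists>x. length x = n \<and> Q e x)"
  using assms
proof (induction n arbitrary: Q)
  case 0
  then show ?case by simp
next
  case (Suc n)
  have "dp (\<lambda>e. \<exists>x. length x = n \<and> (\<exists>a. Q e (a # x)))"
  proof (rule Suc.IH, rule dp_ex)
    have "[0..<Suc n] = 0 # map Suc [0..<n]" by (simp add: upt_conv_Cons map_Suc_upt)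
    then show "dp (\<lambda>e. Q (\<lambda>i. e (Suc (n + i))) (e 0 # map (\<lambda>i. e (Suc i)) [0..<n]))"
      using Suc.prems by (simp del: upt_Suc add: comp_def)
  qed
  moreover have "(\<exists>x. length x = Suc n \<and> Q e x) \<longleftrightarrow> (\<exists>x. length x = n \<and> (\<exists>a. Q e (a # x)))" for e
    by (metis length_Suc_conv)
  ultimately show ?case by simp
qed

lemma dp_alll:
  "dp (\<lambda>e. Q (\<lambda>i. e (n + i)) (map e [0..<n])) \<Longrightarrow> dp (\<lambda>e. \<forall>x. length x = n \<longrightarrow> Q e x)"
  using dp_neg[OF dp_exl[of "\<lambda>e a. \<not> Q e a" n]] by (simp add: dp_neg)

lemma dp_ball_less: "(\<And>i. i < n \<Longrightarrow> dp (P i)) \<Longrightarrow> dp (\<lambda>e. \<forall>i<n. P i e)" for n :: nat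
proof (induction n)
  case (Suc n)
  then have "dp (\<lambda>e. (\<forall>i<n. P i e) \<and> P n e)" by (intro dp_conj) auto
  moreover have "(\<forall>i<Suc n. P i e) \<longleftrightarrow> (\<forall>i<n. P i e) \<and> P n e" for e
    by (auto simp: less_Suc_eq)
  ultimately show ?case by simp
qed (simp add: dp_const)

lemma dp_eql:
  assumes "dl n L" "dl n K" shows "dp (\<lambda>e. L e = K e)"
proof -
  have "dp (\<lambda>e. \<forall>i<n. L e ! i = K e ! i)"
    using assms by (intro dp_ball_less dp_eq) (auto simp: dl_def)
  moreover have "L e = K e \<longleftrightarrow> (\<forall>i<n. L e ! i = K e ! i)" for e
    using assms by (auto simp: dl_def list_eq_iff_nth_eq)
  ultimately show ?thesis by simp
qed

text \<open>Only lists of length \<open>n\<close> are tested, so lists of other lengths may belong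
  to \<open>X\<close> without any effect; \<open>definable_iff\<close> adds their absence.\<close>

definition dset :: "nat \<Rightarrow> 'm list set \<Rightarrow> bool" where
  "dset n X \<longleftrightarrow> dp (\<lambda>e. map e [0..<n] \<in> X)"

definition dfl :: "nat \<Rightarrow> ('m list \<Rightarrow> 'm) \<Rightarrow> bool" where
  "dfl n f \<longleftrightarrow> df (\<lambda>e. f (map e [0..<n]))"

definition dfam :: "nat \<Rightarrow> ('m \<Rightarrow> 'm list set) \<Rightarrow> bool" where
  "dfam n C \<longleftrightarrow> dp (\<lambda>e. map (\<lambda>i. e (Suc i)) [0..<n] \<in> C (e 0))"

definition dfaml :: "nat \<Rightarrow> nat \<Rightarrow> ('m list \<Rightarrow> 'm list set) \<Rightarrow> bool" where
  "dfaml m n C \<longleftrightarrow> dp (\<lambda>e. map (\<lambda>i. e (m + i)) [0..<n] \<in> C (map e [0..<m]))"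

lemma dp_mem: "dset n X \<Longrightarrow> dl n L \<Longrightarrow> dp (\<lambda>e. L e \<in> X)"
  unfolding dset_def by (rule dp_list_comp[where P = "\<lambda>x e. x \<in> X" and g = "\<lambda>e. e"]) (simp_all add:
    df_var)

lemma df_app: "dfl n f \<Longrightarrow> dl n L \<Longrightarrow> df (\<lambda>e. f (L e))"
  unfolding dfl_def df_def
proof -
  assume "dp (\<lambda>e. e 0 = f (map (\<lambda>i. e (Suc i)) [0..<n]))" and L: "dl n L"
  then have "dp (\<lambda>e. e n = f (map e [0..<n]))"
    by (drule_tac dp_subst[where g = "\<lambda>e i. case i of 0 \<Rightarrow> e n | Suc j \<Rightarrow> e j"])
      (auto split: nat.split)
  then have "dp (\<lambda>e. (\<lambda>x e. e 0 = f x) (L (\<lambda>i. e (Suc i))) e)"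
    using L by (rule_tac dp_list_comp[where n = n and P = "\<lambda>x e. e 0 = f x" and g = "\<lambda>e. e"])
      (auto simp: df_var dl_def intro: df_shift[where f = Suc and t = "\<lambda>e. L e ! i" for i])
  then show "dp (\<lambda>e. e 0 = f (L (\<lambda>i. e (Suc i))))" by simp
qed

lemma dp_fam:
  assumes "dfam n C" "df t" "dl n L" shows "dp (\<lambda>e. L e \<in> C (t e))"
proof -
  have "dp (\<lambda>e. map e [0..<n] \<in> C (e n))"
    using assms(1) unfolding dfam_def
    by (drule_tac dp_subst[where g = "\<lambda>e i. case i of 0 \<Rightarrow> e n | Suc j \<Rightarrow> e j"])
      (auto split: nat.split)
  then show ?thesis using assms
    by (rule_tac dp_list_comp[where n = n and P = "\<lambda>x e. x \<in> C (e 0)" and g = "\<lambda>e i. t e"]) auto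
qed

lemma dp_faml:
  assumes "dfaml m n C" "dl m K" "dl n L" shows "dp (\<lambda>e. L e \<in> C (K e))"
proof -
  have "dp (\<lambda>e. (\<lambda>x e'. map e' [0..<n] \<in> C x) (K e) (\<lambda>i. if i < n then L e ! i else 0))"
    using assms
    by (rule_tac dp_list_comp[where n = m and P = "\<lambda>x e'. map e' [0..<n] \<in> C x"
          and g = "\<lambda>e i. if i < n then L e ! i else 0"])
      (auto simp: dfaml_def dl_nth df_const df_if_const)
  moreover have "map (\<lambda>i. if i < n then L e ! i else 0) [0..<n] = L e" for e
    by (subst (2) dl_eq_map[OF assms(3)]) auto
  ultimately show ?thesis by simp
qed

lemmas dintros = dp_conj dp_disj dp_imp dp_iff dp_neg dp_const dp_eq dp_less dp_le
  df_var df_const df_plus df_minus df_uminus df_if dl_map dl_Cons dl_snoc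

lemma definable_iff: "definable \<M> n X \<longleftrightarrow> X \<subseteq> {xs. length xs = n} \<and> dset n X"
proof safe
  assume "definable \<M> n X"
  then obtain p c where X: "X = {xs. length xs = n \<and> sat \<M> (with_params xs c) p}"
    by (auto simp: definable_def)
  show "length x = n" if "x \<in> X" for x using that X by simp
  have "dp (\<lambda>e. sat \<M> (\<lambda>i. if i < n then e i else c (i - n)) p)"
    by (rule dp_subst[OF dp_sat]) (auto simp: not_less)
  moreover have "with_params (map e [0..<n]) c = (\<lambda>i. if i < n then e i else c (i - n))" for e
    by (auto simp: with_params_def)
  ultimately show "dset n X" by (simp add: X dset_def)
next
  assume X: "X \<subseteq> {xs. length xs = n}" and "dset n X"
  then obtain p c where pc: "\<And>e. map e [0..<n] \<in> X \<longleftrightarrow> sat \<M> (mix e c) p"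
    by (auto simp: dset_def dp_def)
  \<comment> \<open>Variables from \<open>n\<close> on do not affect membership but must be sent
    somewhere. They all go to the extra parameter 0 that \<open>c'\<close> puts in front, which
    agrees with padding \<open>xs\<close> by zeros.\<close>
  define r where "r k = (if even k then if k div 2 < n then k div 2 else n
                         else n + Suc (k div 2))" for k
  define c' where "c' = case_nat 0 c"
  have "xs \<in> X \<longleftrightarrow> sat \<M> (with_params xs c') (ren_fm r p)" if "length xs = n" for xs
  proof -
    have "map (\<lambda>i. if i < n then xs ! i else 0) [0..<n] = xs"
      using that by (auto intro: nth_equalityI)
    moreover have "mix (\<lambda>i. if i < n then xs ! i else 0) c = (\<lambda>k. with_params xs c' (r k))"
      using that by (auto simp: mix_def with_params_def r_def c'_def)
    ultimately show ?thesis using pc[of "\<lambda>i. if i < n then xs ! i else 0"] by (simp add: sat_ren)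
  qed
  then have "X = {xs. length xs = n \<and> sat \<M> (with_params xs c') (ren_fm r p)}"
    using X by auto
  then show "definable \<M> n X" unfolding definable_def by blast
qed

text \<open>A \<open>definable_family\<close> is controlled over \<open>B\<close> only. Extending it
  by \<open>{}\<close> gives a family over all \<open>m\<close>-tuples, so that definability goals
  carry no side condition on the index.\<close>

lemma definable_family_dfaml:
  assumes "definable_family \<M> n m B A"
  shows "dfaml m n (\<lambda>b. if b \<in> B then A b else {})" "dset m B" "B \<subseteq> {b. length b = m}"
    "\<And>b. b \<in> B \<Longrightarrow> A b \<subseteq> {a. length a = n}"
proof -
  obtain p c where A: "\<And>b. b \<in> B \<Longrightarrow> A b = {a. length a = n \<and> sat \<M> (with_params (a @ b) c) p}"
    and B: "definable \<M> m B" using assms by (auto simp: definable_family_def)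
  show dB: "dset m B" and "B \<subseteq> {b. length b = m}" using B by (auto simp: definable_iff)
  show "\<And>b. b \<in> B \<Longrightarrow> A b \<subseteq> {a. length a = n}" using A by auto
  define R where "R = {x. length x = n + m \<and> sat \<M> (with_params x c) p}"
  have "definable \<M> (n + m) R" unfolding R_def definable_def by blast
  then have R: "dset (n + m) R" by (simp add: definable_iff)
  have "dp (\<lambda>e. map e [0..<m] \<in> B \<and> map (\<lambda>i. e (m + i)) [0..<n] @ map e [0..<m] \<in> R)"
    by (intro dp_conj dp_mem[OF dB] dp_mem[OF R] dl_append dl_map df_var)
  then show "dfaml m n (\<lambda>b. if b \<in> B then A b else {})"
    unfolding dfaml_def by (rule back_subst[of dp]) (auto simp: A R_def fun_eq_iff)
qed

lemma definable_familyI: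
  assumes A: "dfaml m n A" and B: "definable \<M> m B" and len: "\<And>b. b \<in> B \<Longrightarrow> A b \<subseteq> {a. length a = n}"
  shows "definable_family \<M> n m B A"
proof -
  define R where "R = {a @ b | a b. length b = m \<and> length a = n \<and> a \<in> A b}"
  have "dset (n + m) R"
  proof -
    have "dp (\<lambda>e. map e [0..<n] \<in> A (map (\<lambda>i. e (n + i)) [0..<m]))"
      by (intro dp_faml[OF A] dl_map df_var)
    moreover have "map e [0..<n + m] \<in> R \<longleftrightarrow> map e [0..<n] \<in> A (map (\<lambda>i. e (n + i)) [0..<m])" for e
    proof -
      have "map e [0..<n + m] = map e [0..<n] @ map (\<lambda>i. e (n + i)) [0..<m]"
        by (rule nth_equalityI) (auto simp: nth_append)
      then show ?thesis unfolding R_def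
        by (auto simp: append_eq_append_conv) (metis length_map length_upt minus_nat.diff_0)
    qed
    ultimately show ?thesis by (simp add: dset_def)
  qed
  then have "definable \<M> (n + m) R" by (auto simp: definable_iff R_def)
  then obtain p c where pc: "R = {xs. length xs = n + m \<and> sat \<M> (with_params xs c) p}"
    by (auto simp: definable_def)
  have "A b = {a. length a = n \<and> sat \<M> (with_params (a @ b) c) p}" if "b \<in> B" for b
  proof -
    have "length b = m" using that B by (auto simp: definable_iff)
    then have "a \<in> A b \<longleftrightarrow> a @ b \<in> R" if "length a = n" for a
      using that by (auto simp: R_def)
    then show ?thesis using len[OF that] \<open>length b = m\<close> by (auto simp: pc)
  qed
  then show ?thesis unfolding definable_family_def using B by blast
qed

end

section \<open>Ordered groups\<close>

context linordered_group_add
begin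

lemma group_add_less_left [simp]: "c + a < c + b \<longleftrightarrow> a < b"
proof -
  have *: "c + a < c + b" if "a < b" for a b c
    using add_left_mono_group[of a b c] that by (simp add: less_le)
  show ?thesis using *[of a b c] *[of "c + a" "c + b" "- c"] by (auto simp flip: add.assoc)
qed

lemma group_add_less_right [simp]: "a + c < b + c \<longleftrightarrow> a < b"
proof -
  have *: "a + c < b + c" if "a < b" for a b c
    using add_right_mono_group[of a b c] that by (simp add: less_le)
  show ?thesis using *[of a b c] *[of "a + c" "b + c" "- c"] by (auto simp: add.assoc)
qed

lemma group_neg_less_iff [simp]: "- a < - b \<longleftrightarrow> b < a"
proof -
  have "- a < - b \<longleftrightarrow> - a + b < - b + b" by (rule group_add_less_right[symmetric])
  also have "\<dots> \<longleftrightarrow> a + (- a + b) < a + 0" by (simp only: group_add_less_left left_minus)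
  also have "\<dots> \<longleftrightarrow> b < a" by (simp flip: add.assoc)
  finally show ?thesis .
qed

lemma group_neg_le_iff [simp]: "- a \<le> - b \<longleftrightarrow> b \<le> a"
  by (simp flip: not_less)

lemma group_neg_less_swap: "- a < b \<longleftrightarrow> - b < a" "a < - b \<longleftrightarrow> b < - a"
  using group_neg_less_iff[of a "- b"] group_neg_less_iff[of "- a" b] by simp_all

lemma group_neg_less_0 [simp]: "- a < 0 \<longleftrightarrow> 0 < a" "0 < - a \<longleftrightarrow> a < 0"
  using group_neg_less_iff[of a 0] group_neg_less_iff[of 0 a] by simp_all

lemma group_diff_pos [simp]: "0 < - a + b \<longleftrightarrow> a < b"
  using group_add_less_left[of "- a" a b] by simp

lemma group_less_add_pos [simp]: "a < a + b \<longleftrightarrow> 0 < b"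
  using group_add_less_left[of a 0 b] by simp

lemma group_add_less_mono: "a < b \<Longrightarrow> c < d \<Longrightarrow> a + c < b + d"
  by (rule less_trans[of _ "b + c"]) simp_all

end

text \<open>Density stands in for division by two: \<open>\<delta>\<close> is split as
  \<open>y + z\<close> with positive summands, and any positive \<open>w\<close> below both of them
  works.\<close>

lemma ex_double_less:
  fixes \<delta> :: "'m::{linordered_group_add, dense_linorder}"
  assumes "0 < \<delta>" obtains w where "0 < w" "w + w < \<delta>"
proof -
  obtain y where y: "0 < y" "y < \<delta>" using dense[OF assms] by blast
  define z where "z = - y + \<delta>"
  have z: "0 < z" "y + z = \<delta>" using y by (auto simp: z_def simp flip: add.assoc)
  obtain w where w: "0 < w" "w < min y z" using dense[of 0 "min y z"] y z by auto
  show ?thesis using that[OF w(1)] group_add_less_mono[of w y w z] w z by simp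
qed

section \<open>Definable subsets of the line\<close>

text \<open>The default 0 makes the description total, so a definable relation yields a definable
  function with no domain to carry along (\<open>df_the0\<close>).\<close>

definition the0 :: "('a::zero \<Rightarrow> bool) \<Rightarrow> 'a" where
  "the0 P = (if \<exists>!a. P a then THE a. P a else 0)"

lemma the0_eq: "P a \<Longrightarrow> (\<And>b. P b \<Longrightarrow> b = a) \<Longrightarrow> the0 P = a"
proof -
  assume a: "P a" "\<And>b. P b \<Longrightarrow> b = a"
  then have "\<exists>!a. P a" by (rule ex1I)
  then show ?thesis using the1_equality a(1) by (simp add: the0_def)
qed

definition is_lub :: "'a::order set \<Rightarrow> 'a \<Rightarrow> bool" where
  "is_lub S s \<longleftrightarrow> (\<forall>x. x \<in> S \<longrightarrow> x \<le> s) \<and> (\<forall>u. (\<forall>x. x \<in> S \<longrightarrow> x \<le> u) \<longrightarrow> s \<le> u)"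

definition lub :: "'a::{order, zero} set \<Rightarrow> 'a" where
  "lub S = the0 (is_lub S)"

lemma lub_eq: "is_lub S s \<Longrightarrow> lub S = s"
  unfolding lub_def by (rule the0_eq) (auto simp: is_lub_def intro: order_antisym)

definition germ_right :: "'a::linorder set \<Rightarrow> 'a \<Rightarrow> bool" where
  "germ_right S l \<longleftrightarrow> (\<exists>b>l. (\<forall>x. l < x \<and> x < b \<longrightarrow> x \<in> S) \<or> (\<forall>x. l < x \<and> x < b \<longrightarrow> x \<notin> S))"

lemma germ_right_Un:
  assumes "germ_right S l" "germ_right T l" shows "germ_right (S \<union> T) l"
proof -
  obtain b where b: "b > l" "(\<forall>x. l < x \<and> x < b \<longrightarrow> x \<in> S) \<or> (\<forall>x. l < x \<and> x < b \<longrightarrow> x \<notin> S)"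
    using assms(1) by (auto simp: germ_right_def)
  obtain c where c: "c > l" "(\<forall>x. l < x \<and> x < c \<longrightarrow> x \<in> T) \<or> (\<forall>x. l < x \<and> x < c \<longrightarrow> x \<notin> T)"
    using assms(2) by (auto simp: germ_right_def)
  show ?thesis unfolding germ_right_def
    using b c by (intro exI[of _ "min b c"]) auto
qed

lemma germ_right_interval: "germ_right (open_interval a b) l" for l ::
  "'a::unbounded_dense_linorder"
proof -
  obtain m where m: "l < m" using gt_ex by blast
  show ?thesis
  proof (cases a)
    case (Fin \<alpha>)
    show ?thesis
    proof (cases b)
      fix \<beta> assume "b = Fin \<beta>"
      then show ?thesis unfolding germ_right_def using m Fin
        by (intro exI[of _ "if l < \<alpha> then \<alpha> else if l < \<beta> then \<beta> else m"]) (auto simp: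
          open_interval_def)
    next
      assume "b = Pinf"
      then show ?thesis unfolding germ_right_def using m Fin
        by (intro exI[of _ "if l < \<alpha> then \<alpha> else m"]) (auto simp: open_interval_def)
    next
      assume "b = Minf"
      then show ?thesis unfolding germ_right_def using m by (auto simp: open_interval_def)
    qed
  next
    case Pinf
    then show ?thesis unfolding germ_right_def using m by (auto simp: open_interval_def)
  next
    case Minf
    show ?thesis
    proof (cases b)
      fix \<beta> assume "b = Fin \<beta>"
      then show ?thesis unfolding germ_right_def using m Minf
        by (intro exI[of _ "if l < \<beta> then \<beta> else m"]) (auto simp: open_interval_def)
    next
      assume "b = Pinf"
      then show ?thesis unfolding germ_right_def using m Minf by (auto simp: open_interval_def)
    next
      assume "b = Minf"
      then show ?thesis unfolding germ_right_def using m by (auto simp: open_interval_def)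
    qed
  qed
qed

lemma germ_right_point: "germ_right {a} l" for l :: "'a::unbounded_dense_linorder"
proof -
  obtain m where m: "l < m" using gt_ex by blast
  then show ?thesis unfolding germ_right_def
    by (intro exI[of _ "if l < a then a else m"]) auto
qed

lemma open_interval_contains:
  fixes x :: "'a::unbounded_dense_linorder"
  assumes "x \<in> open_interval a b"
  obtains p q where "p < x" "x < q" "\<And>y. p < y \<Longrightarrow> y < q \<Longrightarrow> y \<in> open_interval a b"
proof -
  obtain p where p: "p < x" "a \<le> Fin p"
    using assms lt_ex[of x] by (cases a) (auto simp: open_interval_def)
  obtain q where q: "x < q" "Fin q \<le> b"
    using assms gt_ex[of x] by (cases b) (auto simp: open_interval_def)
  show ?thesis
    by (rule that[OF p(1) q(1)])
      (use p q less_le_trans[of _ "Fin q" b] le_less_trans[of a "Fin p"] in \<open>auto simp: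
        open_interval_def\<close>)
qed

lemma lub_interval:
  fixes x :: "'a::unbounded_dense_linorder"
  assumes "x \<in> open_interval a b" "\<And>y. y \<in> open_interval a b \<Longrightarrow> y \<le> u"
  shows "\<exists>s. is_lub (open_interval a b) s"
proof (cases b)
  case (Fin \<beta>)
  have "\<beta> \<le> v" if v: "\<forall>y. y \<in> open_interval a b \<longrightarrow> y \<le> v" for v
  proof (rule ccontr)
    assume "\<not> \<beta> \<le> v"
    then have "max v x < \<beta>" using assms(1) Fin by (auto simp: open_interval_def)
    then obtain z where z: "max v x < z" "z < \<beta>" using dense by blast
    then have "z \<in> open_interval a b" using assms(1) Fin
      by (auto simp: open_interval_def intro: less_trans)
    then show False using v z by (metis max.strict_boundedE leD)
  qed
  then show ?thesis unfolding is_lub_def using Fin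
    by (intro exI[of _ \<beta>]) (auto simp: open_interval_def)
next
  case Pinf
  obtain z where z: "max u x < z" using gt_ex by blast
  then have "z \<in> open_interval a b"
    using assms(1) Pinf by (auto simp: open_interval_def intro: less_trans)
  then show ?thesis using assms(2)[of z] z by auto
next
  case Minf
  then show ?thesis using assms(1) by (auto simp: open_interval_def)
qed

lemma lub_Un:
  fixes S T :: "'a::linorder set"
  assumes "S = {} \<or> (\<exists>s. is_lub S s)" "T = {} \<or> (\<exists>s. is_lub T s)"
  shows "S \<union> T = {} \<or> (\<exists>s. is_lub (S \<union> T) s)"
proof (cases "S = {} \<or> T = {}")
  case True
  then show ?thesis using assms by auto
next
  case False
  then obtain s t where "is_lub S s" "is_lub T t" using assms by auto
  then have "is_lub (S \<union> T) (max s t)" unfolding is_lub_def by (auto simp: le_max_iff_disj)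
  then show ?thesis by blast
qed

context expansion_structure
begin

lemma dp_rel:
  assumes h: "dp (\<lambda>e. Q (\<lambda>i. e (Suc i)) (e 0))" and t: "df t" and g: "\<And>i. df (\<lambda>e. g e i)"
  shows "dp (\<lambda>e. Q (g e) (t e))"
proof -
  have "df (\<lambda>e. case_nat (t e) (g e) i)" for i using t g by (cases i) auto
  then have "dp (\<lambda>e. Q (\<lambda>i. case_nat (t e) (g e) (Suc i)) (case_nat (t e) (g e) 0))"
    by (rule dp_comp[OF h])
  then show ?thesis by simp
qed

definition dp1 :: "'m set \<Rightarrow> bool" where "dp1 S \<longleftrightarrow> dp (\<lambda>e. e 0 \<in> S)"

definition df1 :: "('m \<Rightarrow> 'm) \<Rightarrow> bool" where "df1 f \<longleftrightarrow> df (\<lambda>e. f (e 0))"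

lemma dp_mem1: "dp1 S \<Longrightarrow> df t \<Longrightarrow> dp (\<lambda>e. t e \<in> S)"
  unfolding dp1_def by (rule dp_subst1)

lemma df_app1:
  assumes f: "df1 f" and t: "df t" shows "df (\<lambda>e. f (t e))"
  using f[unfolded df1_def] by (rule df_comp[where g = "\<lambda>e i. t e"]) (rule t)

lemmas qintros = dintros dp_ex dp_all dp_exl dp_alll

lemma df_the0:
  assumes h: "dp (\<lambda>e. Q (\<lambda>i. e (Suc i)) (e 0))"
  shows "df (\<lambda>e. the0 (Q e))"
proof -
  define U where "U e \<longleftrightarrow> (\<exists>a. Q e a \<and> (\<forall>b. Q e b \<longrightarrow> b = a))" for e
  define R where "R e a \<longleftrightarrow> (Q e a \<and> (\<forall>b. Q e b \<longrightarrow> b = a)) \<or> (\<not> U e \<and> a = 0)" for e a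
  have "dp (\<lambda>e. R (\<lambda>i. e (Suc i)) (e 0))"
    unfolding R_def U_def by (intro qintros dp_rel[OF h])
  then show ?thesis
  proof (rule df_rel)
    fix e a show "R e a \<longleftrightarrow> a = the0 (Q e)"
    proof (cases "U e")
      case True
      then obtain b where b: "Q e b" "\<And>c. Q e c \<Longrightarrow> c = b" unfolding U_def by metis
      then have "the0 (Q e) = b" by (rule the0_eq)
      then show ?thesis using b True unfolding R_def by metis
    next
      case False
      then have "\<not> (\<exists>!a. Q e a)" unfolding U_def by metis
      then show ?thesis using False by (auto simp: R_def the0_def)
    qed
  qed
qed

lemma df_lub:
  assumes h: "dp (\<lambda>e. Q (\<lambda>i. e (Suc i)) (e 0))"
  shows "df (\<lambda>e. lub {a. Q e a})"
proof -
  have "dp (\<lambda>e. is_lub {a. Q (\<lambda>i. e (Suc i)) a} (e 0))"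
    unfolding is_lub_def mem_Collect_eq by (intro qintros dp_rel[OF h])
  then show ?thesis unfolding lub_def by (rule df_the0)
qed

end

section \<open>O-minimality in one variable\<close>

locale o_minimal_structure = expansion_structure \<M>
  for \<M> :: "('f, 'r, 'm::{linordered_group_add, unbounded_dense_linorder}) expansion" +
  assumes o_min: "o_minimal \<M>"
begin

lemma dp1_cases:
  assumes "dp1 S"
  shows "\<exists>F. finite F \<and> \<Union>F = S \<and> (\<forall>I\<in>F. (\<exists>a. I = {a}) \<or> (\<exists>a b. I = open_interval a b))"
proof -
  have "definable \<M> 1 ((\<lambda>x. [x]) ` S)"
    using assms by (auto simp: definable_iff dset_def dp1_def image_iff)
  then show ?thesis using o_min unfolding o_minimal_def by blast
qed

lemma germ_right_dp1: "dp1 S \<Longrightarrow> germ_right S l"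
proof -
  assume "dp1 S"
  then obtain F where F: "finite F" "\<Union>F = S"
    "\<And>I. I \<in> F \<Longrightarrow> (\<exists>a. I = {a}) \<or> (\<exists>a b. I = open_interval a b)" using dp1_cases[of S] by metis
  have "germ_right (\<Union>F) l"
    using F(1,3)
  proof (induction F)
    case empty
    then show ?case using gt_ex by (auto simp: germ_right_def)
  next
    case (insert I F)
    have "germ_right I l" using insert.prems[of I] germ_right_point germ_right_interval by auto
    then show ?case using insert germ_right_Un by auto
  qed
  then show ?thesis using F by simp
qed

lemma right_cases:
  assumes "dp1 S"
  obtains b where "l < b" "\<And>x. l < x \<Longrightarrow> x < b \<Longrightarrow> x \<in> S"
  | b where "l < b" "\<And>x. l < x \<Longrightarrow> x < b \<Longrightarrow> x \<notin> S"
  using germ_right_dp1[OF assms, of l] unfolding germ_right_def by blast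

lemma dp1_reflect: "dp1 S \<Longrightarrow> dp1 {x. - x \<in> S}"
  unfolding dp1_def[of "{x. _ x}"] by (simp, intro dp_mem1 qintros)

lemma left_cases:
  assumes "dp1 S"
  obtains b where "b < l" "\<And>x. b < x \<Longrightarrow> x < l \<Longrightarrow> x \<in> S"
  | b where "b < l" "\<And>x. b < x \<Longrightarrow> x < l \<Longrightarrow> x \<notin> S"
proof (rule right_cases[OF dp1_reflect[OF assms], of "- l"])
  fix b assume "- l < b" and b: "\<And>x. - l < x \<Longrightarrow> x < b \<Longrightarrow> x \<in> {x. - x \<in> S}"
  then have "- b < l" using group_neg_less_swap by blast
  moreover have "x \<in> S" if "- b < x" "x < l" for x
    using b[of "- x"] that by (simp add: group_neg_less_swap)
  ultimately show ?thesis using that(1) by blast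
next
  fix b assume "- l < b" and b: "\<And>x. - l < x \<Longrightarrow> x < b \<Longrightarrow> x \<notin> {x. - x \<in> S}"
  then have "- b < l" using group_neg_less_swap by blast
  moreover have "x \<notin> S" if "- b < x" "x < l" for x
    using b[of "- x"] that by (simp add: group_neg_less_swap)
  ultimately show ?thesis using that(2) by blast
qed

lemma infinite_dp1:
  assumes "dp1 S" "infinite S"
  obtains a b where "a < b" "\<And>x. a < x \<Longrightarrow> x < b \<Longrightarrow> x \<in> S"
proof -
  obtain F where F: "finite F" "\<Union>F = S"
    "\<And>I. I \<in> F \<Longrightarrow> (\<exists>a. I = {a}) \<or> (\<exists>a b. I = open_interval a b)"
      using dp1_cases[OF assms(1)] by metis
  then obtain I where I: "I \<in> F" "infinite I" using assms(2) by blast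
  then obtain a b where ab: "I = open_interval a b" using F(3) by fastforce
  obtain x where "x \<in> I" using I(2) by (metis ex_in_conv finite.emptyI)
  then obtain p q where "p < x" "x < q" "\<And>y. p < y \<Longrightarrow> y < q \<Longrightarrow> y \<in> I"
    using open_interval_contains ab by metis
  moreover from this have "p < q" by (simp add: less_trans)
  ultimately show ?thesis using that[of p q] I(1) F(2) by auto
qed

text \<open>Replaces infinity, which is not a first-order condition as it stands, by the existence
  of an interval. This is why conditions on \<open>dge\<close> are definable.\<close>

lemma infinite_iff_dp1:
  assumes "dp1 S"
  shows "infinite S \<longleftrightarrow> (\<exists>a b. a < b \<and> (\<forall>x. a < x \<and> x < b \<longrightarrow> x \<in> S))"
proof
  assume "infinite S"
  then show "\<exists>a b. a < b \<and> (\<forall>x. a < x \<and> x < b \<longrightarrow> x \<in> S)" using infinite_dp1[OF assms] by metis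
next
  assume "\<exists>a b. a < b \<and> (\<forall>x. a < x \<and> x < b \<longrightarrow> x \<in> S)"
  then obtain a b where ab: "a < b" and "\<forall>x. a < x \<and> x < b \<longrightarrow> x \<in> S" by blast
  then have "{a<..<b} \<subseteq> S" by auto
  then show "infinite S" using infinite_Ioo[OF ab] by (meson finite_subset)
qed

text \<open>The order is not assumed complete, but o-minimality puts the end points of the intervals
  in \<open>M\<close> or at infinity, and a bounded nonempty finite union of such pieces has a
  supremum.\<close>

lemma is_lub_dp1:
  assumes "dp1 S" "x \<in> S" "\<And>y. y \<in> S \<Longrightarrow> y \<le> u"
  shows "is_lub S (lub S)"
proof -
  obtain F where F: "finite F" "\<Union>F = S"
    "\<And>I. I \<in> F \<Longrightarrow> (\<exists>a. I = {a}) \<or> (\<exists>a b. I = open_interval a b)"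
      using dp1_cases[OF assms(1)] by metis
  have "\<Union>F = {} \<or> (\<exists>s. is_lub (\<Union>F) s)"
    using F(1,3) assms(3)[folded F(2)]
  proof (induction F)
    case (insert I F)
    have "I = {} \<or> (\<exists>s. is_lub I s)"
    proof (cases "\<exists>a. I = {a}")
      case True
      then show ?thesis by (auto simp: is_lub_def)
    next
      case False
      then show ?thesis using insert.prems(1)[of I] lub_interval[of _ _ _ u] insert.prems(2)
        by fastforce
    qed
    moreover have "\<Union>F = {} \<or> (\<exists>s. is_lub (\<Union>F) s)" using insert by auto
    ultimately have "I \<union> \<Union>F = {} \<or> (\<exists>s. is_lub (I \<union> \<Union>F) s)" by (rule lub_Un)
    then show ?case by (simp only: Union_insert)
  qed auto
  then obtain s where "is_lub S s" using assms(2) F(2) by blast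
  then show ?thesis using lub_eq by metis
qed

subsection \<open>Definable choice\<close>

definition half :: "'m \<Rightarrow> 'm" where "half \<delta> = lub {x. x + x < \<delta>}"

text \<open>With \<open>w + w < \<delta>\<close> the supremum is caught between \<open>w\<close> and
  \<open>- w + \<delta>\<close>: a larger \<open>x\<close> would also exceed \<open>w\<close>, and
  \<open>x + x\<close> would exceed \<open>w + (- w + \<delta>) = \<delta>\<close>.\<close>

lemma half:
  assumes "0 < \<delta>" shows "0 < half \<delta>" "half \<delta> < \<delta>"
proof -
  obtain w where w: "0 < w" "w + w < \<delta>" using ex_double_less[OF assms] by blast
  have wd: "w < - w + \<delta>"
    using group_add_less_left[of "- w" "w + w" \<delta>] w(2) by (simp flip: add.assoc)
  have "- w + \<delta> < \<delta>"
    using group_add_less_right[of "- w" \<delta> 0] w(1) by simp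
  have ub: "x \<le> - w + \<delta>" if "x + x < \<delta>" for x
  proof (rule ccontr)
    assume "\<not> x \<le> - w + \<delta>"
    then have x: "- w + \<delta> < x" by simp
    then have "w + (- w + \<delta>) < x + x" using wd by (intro group_add_less_mono) simp_all
    then show False using that by (simp flip: add.assoc)
  qed
  have "dp1 {x. x + x < \<delta>}" unfolding dp1_def mem_Collect_eq by (intro qintros)
  then have "is_lub {x. x + x < \<delta>} (half \<delta>)"
    unfolding half_def by (rule is_lub_dp1) (use w ub in auto)
  then have "w \<le> half \<delta>" "half \<delta> \<le> - w + \<delta>" using w ub by (auto simp: is_lub_def)
  then show "0 < half \<delta>" "half \<delta> < \<delta>" using w \<open>- w + \<delta> < \<delta>\<close> by auto
qed

text \<open>An arbitrary positive element. In \<open>pos_choice\<close> it caps the right end points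
  under consideration, so that their supremum exists even if \<open>S\<close> contains everything
  beyond \<open>l\<close>.\<close>

definition unit :: 'm where "unit = (SOME x. 0 < x)"

lemma unit_pos: "0 < unit"
  unfolding unit_def by (rule someI_ex) (rule gt_ex)

text \<open>An element of \<open>S \<inter> (0, \<infinity>)\<close>: the least one or else a point of the interval of \<open>S\<close> that
  starts at the infimum.\<close>

definition pos_choice :: "'m set \<Rightarrow> 'm" where
  "pos_choice S = (let l = - lub {y. - y \<in> S \<and> y < 0} in
     if l \<in> S \<and> 0 < l then l
     else l + half (- l + lub {b. b \<le> l + unit \<and> (\<forall>x. l < x \<and> x < b \<longrightarrow> x \<in> S)}))"

lemma pos_choice:
  assumes S: "dp1 S" and "x0 \<in> S" "0 < x0"
  shows "pos_choice S \<in> S"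
proof -
  let ?P = "{y. - y \<in> S \<and> y < 0}"
  define l where "l = - lub ?P"
  have "dp1 ?P" unfolding dp1_def mem_Collect_eq by (intro qintros dp_mem1[OF S])
  then have lub: "is_lub ?P (- l)"
    unfolding l_def minus_minus by (rule is_lub_dp1[of _ "- x0" 0]) (use assms in auto)
  have l: "l \<le> x" if "x \<in> S" "0 < x" for x
    using that lub by (auto simp: is_lub_def dest: spec[of _ "- x"])
  show ?thesis
  proof (cases "l \<in> S \<and> 0 < l")
    case True
    then show ?thesis unfolding pos_choice_def Let_def l_def[symmetric] by simp
  next
    case False
    let ?T = "{b. b \<le> l + unit \<and> (\<forall>x. l < x \<and> x < b \<longrightarrow> x \<in> S)}"
    have *: "pos_choice S = l + half (- l + lub ?T)"
      unfolding pos_choice_def Let_def l_def[symmetric] using False by (rule if_not_P)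
    have T: "dp1 ?T" unfolding dp1_def mem_Collect_eq by (intro qintros dp_mem1[OF S])
    \<comment> \<open>If \<open>S\<close> missed an interval \<open>(l, b)\<close>, then
      \<open>b\<close> would be a larger lower bound of the positive part of \<open>S\<close>,
      because in this case \<open>l\<close> is not itself a positive element of
      \<open>S\<close>.\<close>
    obtain b where b: "l < b" "\<And>x. l < x \<Longrightarrow> x < b \<Longrightarrow> x \<in> S"
    proof (rule right_cases[OF S, of l])
      fix b assume b: "l < b" "\<And>x. l < x \<Longrightarrow> x < b \<Longrightarrow> x \<notin> S"
      have "b \<le> x" if "x \<in> S" "0 < x" for x
        using l[OF that] b(2)[of x] that False by (metis le_less not_less)
      then have "y \<le> - b" if "y \<in> ?P" for y
        using that by (metis (mono_tags, lifting) group_neg_le_iff group_neg_less_0(2)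
          mem_Collect_eq minus_minus)
      then have "- l \<le> - b" using lub unfolding is_lub_def by blast
      then show thesis using b(1) by simp
    qed (rule that)
    define b' where "b' = min b (l + unit)"
    have b': "l < b'" "b' \<in> ?T" using b unit_pos by (auto simp: b'_def)
    have u: "is_lub ?T (lub ?T)" by (rule is_lub_dp1[OF T b'(2), of "l + unit"]) simp
    then have "l < lub ?T" using b' by (auto simp: is_lub_def intro: less_le_trans)
    then have h: "0 < - l + lub ?T" by simp
    have "l + half (- l + lub ?T) < l + (- l + lub ?T)"
      using half(2)[OF h] by (simp only: group_add_less_left)
    then have "pos_choice S < lub ?T" by (simp add: * flip: add.assoc)
    then have "\<not> (\<forall>x. x \<in> ?T \<longrightarrow> x \<le> pos_choice S)"
      using u unfolding is_lub_def by (blast dest: leD)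
    then obtain c where "c \<in> ?T" "pos_choice S < c" by (auto simp only: not_all not_imp not_le)
    moreover have "l < pos_choice S" using half(1)[OF h] by (simp add: *)
    ultimately show ?thesis by simp
  qed
qed

text \<open>The chosen point depends on the set alone and not on its description, so indices of the
  same set receive the same point.\<close>

definition ch :: "'m set \<Rightarrow> 'm" where
  "ch S = (if 0 \<in> S then 0 else if \<exists>x. 0 < x \<and> x \<in> S then pos_choice S else - pos_choice {x. - x \<in>
    S})"

lemma ch_mem:
  assumes "dp1 S" "x \<in> S" shows "ch S \<in> S"
proof -
  consider "0 \<in> S" | "0 \<notin> S" "\<exists>x. 0 < x \<and> x \<in> S" | "0 \<notin> S" "\<not> (\<exists>x. 0 < x \<and> x \<in> S)" by blast
  then show ?thesis
  proof cases
    case 1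
    then show ?thesis by (simp add: ch_def)
  next
    case 2
    then show ?thesis using pos_choice[OF assms(1)] by (auto simp: ch_def)
  next
    case 3
    then have "0 < - x" using assms(2) by (metis group_neg_less_0(2) linorder_cases)
    then have "pos_choice {x. - x \<in> S} \<in> {x. - x \<in> S}"
      by (intro pos_choice[of _ "- x"] dp1_reflect assms(1)) (use assms in auto)
    then show ?thesis using 3 unfolding ch_def by (simp only: if_False mem_Collect_eq)
  qed
qed

lemma df_pos_choice:
  assumes h: "dp (\<lambda>e. Q (\<lambda>i. e (Suc i)) (e 0))"
  shows "df (\<lambda>e. pos_choice {a. Q e a})"
proof -
  define l where "l e = - lub {y. Q e (- y) \<and> y < 0}" for e
  have l: "df l" unfolding l_def by (intro df_uminus df_lub qintros dp_rel[OF h])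
  have l': "df (\<lambda>e. l (\<lambda>i. e (f i)))" for f by (rule df_shift[OF l])
  show ?thesis
    unfolding pos_choice_def Let_def mem_Collect_eq l_def[symmetric] half_def
    by (intro qintros df_lub dp_rel[OF h] l')
qed

lemma df_ch:
  assumes h: "dp (\<lambda>e. Q (\<lambda>i. e (Suc i)) (e 0))"
  shows "df (\<lambda>e. ch {a. Q e a})"
  unfolding ch_def mem_Collect_eq
  by (intro qintros df_pos_choice dp_rel[OF h])

end

section \<open>Monotonicity\<close>

definition less_left :: "('m::linorder \<Rightarrow> 'm) \<Rightarrow> 'm \<Rightarrow> bool" where
  "less_left f x \<longleftrightarrow> (\<exists>u<x. \<forall>y. u < y \<and> y < x \<longrightarrow> f y < f x)"

definition greater_left :: "('m::linorder \<Rightarrow> 'm) \<Rightarrow> 'm \<Rightarrow> bool" where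
  "greater_left f x \<longleftrightarrow> (\<exists>u<x. \<forall>y. u < y \<and> y < x \<longrightarrow> f x < f y)"

definition less_right :: "('m::linorder \<Rightarrow> 'm) \<Rightarrow> 'm \<Rightarrow> bool" where
  "less_right f x \<longleftrightarrow> (\<exists>v>x. \<forall>y. x < y \<and> y < v \<longrightarrow> f y < f x)"

definition greater_right :: "('m::linorder \<Rightarrow> 'm) \<Rightarrow> 'm \<Rightarrow> bool" where
  "greater_right f x \<longleftrightarrow> (\<exists>v>x. \<forall>y. x < y \<and> y < v \<longrightarrow> f x < f y)"

definition loc_const :: "('m::linorder \<Rightarrow> 'm) \<Rightarrow> 'm \<Rightarrow> bool" where
  "loc_const f x \<longleftrightarrow> (\<exists>u v. u < x \<and> x < v \<and> (\<forall>y. u < y \<and> y < v \<longrightarrow> f y = f x))"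

definition cont1 :: "('m::linorder \<Rightarrow> 'm) \<Rightarrow> 'm \<Rightarrow> bool" where
  "cont1 f r \<longleftrightarrow> (\<forall>c d. c < f r \<and> f r < d \<longrightarrow>
     (\<exists>u v. u < r \<and> r < v \<and> (\<forall>y. u < y \<and> y < v \<longrightarrow> c < f y \<and> f y < d)))"

definition jump_down :: "('m::linorder \<Rightarrow> 'm) \<Rightarrow> 'm \<Rightarrow> bool" where
  "jump_down f c \<longleftrightarrow> (\<exists>v u w. u < c \<and> c < w \<and> (\<forall>y. u < y \<and> y < c \<longrightarrow> v < f y) \<and>
     (\<forall>y. c < y \<and> y < w \<longrightarrow> f y < v))"

lemma less_left_neg: "less_left (\<lambda>x. - f x) x \<longleftrightarrow> greater_left f x" for f :: "'m::linordered_group_add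
  \<Rightarrow> 'm"
  by (simp add: less_left_def greater_left_def)

lemma greater_left_neg: "greater_left (\<lambda>x. - f x) x \<longleftrightarrow> less_left f x" for f ::
  "'m::linordered_group_add \<Rightarrow> 'm"
  by (simp add: less_left_def greater_left_def)

lemma greater_right_neg: "greater_right (\<lambda>x. - f x) x \<longleftrightarrow> less_right f x" for f ::
  "'m::linordered_group_add \<Rightarrow> 'm"
  by (simp add: less_right_def greater_right_def)

lemma cont1_neg:
  fixes f :: "'m::linordered_group_add \<Rightarrow> 'm"
  assumes "cont1 (\<lambda>x. - f x) r" shows "cont1 f r"
  unfolding cont1_def
proof (intro allI impI)
  fix c d assume cd: "c < f r \<and> f r < d"
  obtain u v where uv: "u < r" "r < v" "\<And>y. u < y \<Longrightarrow> y < v \<Longrightarrow> - d < - f y \<and> - f y < - c"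
    using assms[unfolded cont1_def, rule_format, of "- d" "- c"] cd by auto
  then show "\<exists>u v. u < r \<and> r < v \<and> (\<forall>y. u < y \<and> y < v \<longrightarrow> c < f y \<and> f y < d)"
    by (intro exI[of _ u] exI[of _ v]) auto
qed

lemma greater_left_reflect:
  fixes f :: "'m::linordered_group_add \<Rightarrow> 'm"
  assumes "greater_right f x" shows "greater_left (\<lambda>y. f (- y)) (- x)"
proof -
  obtain v where v: "v > x" "\<And>y. x < y \<Longrightarrow> y < v \<Longrightarrow> f x < f y"
    using assms by (auto simp: greater_right_def)
  then show ?thesis unfolding greater_left_def
    by (intro exI[of _ "- v"]) (auto simp: group_neg_less_swap)
qed

lemma greater_right_reflect:
  fixes f :: "'m::linordered_group_add \<Rightarrow> 'm"
  assumes "greater_left f x" shows "greater_right (\<lambda>y. f (- y)) (- x)"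
proof -
  obtain v where v: "v < x" "\<And>y. v < y \<Longrightarrow> y < x \<Longrightarrow> f x < f y"
    using assms by (auto simp: greater_left_def)
  then show ?thesis unfolding greater_right_def
    by (intro exI[of _ "- v"]) (auto simp: group_neg_less_swap)
qed

text \<open>Reflection exchanges the two sides of \<open>c\<close>. Values on the right would lie
  between \<open>v'\<close> and \<open>v\<close>, values on the left between \<open>v\<close> and
  \<open>v'\<close>.\<close>

lemma jump_down_not_both:
  fixes f :: "'m::{linordered_group_add, dense_linorder} \<Rightarrow> 'm"
  assumes "jump_down f c" "jump_down (\<lambda>y. f (- y)) (- c)" shows False
proof -
  obtain v u w where 1: "u < c" "c < w" "\<And>y. u < y \<Longrightarrow> y < c \<Longrightarrow> v < f y"
    "\<And>y. c < y \<Longrightarrow> y < w \<Longrightarrow> f y < v"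
    using assms(1) unfolding jump_down_def by blast
  obtain v' u' w' where 2: "u' < - c" "- c < w'" "\<And>y. u' < y \<Longrightarrow> y < - c \<Longrightarrow> v' < f (- y)"
    "\<And>y. - c < y \<Longrightarrow> y < w' \<Longrightarrow> f (- y) < v'"
    using assms(2) unfolding jump_down_def by blast
  obtain y where y: "c < y" "y < min w (- u')" using dense[of c "min w (- u')"] 1 2
    by (auto simp: group_neg_less_swap)
  have "v' < v" using 2(3)[of "- y"] 1(4)[of y] y by (auto simp: group_neg_less_swap)
  obtain z where z: "z < c" "max u (- w') < z" using dense[of "max u (- w')" c] 1 2
    by (auto simp: group_neg_less_swap)
  have "v < v'" using 2(4)[of "- z"] 1(3)[of z] z by (auto simp: group_neg_less_swap)
  then show False using \<open>v' < v\<close> by simp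
qed

section \<open>Jumps and the monotonicity theorem\<close>

context o_minimal_structure
begin

lemma cofinite_interval:
  assumes "finite B" "(a::'m) < b"
  obtains a' where "a \<le> a'" "a' < b" "\<And>x. a' < x \<Longrightarrow> x < b \<Longrightarrow> x \<notin> B"
proof -
  define a' where "a' = Max (insert a {x \<in> B. x < b})"
  have fin: "finite (insert a {x \<in> B. x < b})" using assms by simp
  have "a' \<in> insert a {x \<in> B. x < b}" unfolding a'_def by (rule Max_in[OF fin]) simp
  moreover have "x \<le> a'" if "x \<in> insert a {x \<in> B. x < b}" for x
    unfolding a'_def using fin that by (rule Max_ge)
  ultimately show ?thesis using that[of a'] assms(2) by force
qed

text \<open>For a function with a strict local minimum everywhere, the last point before \<open>b\<close> at which
  \<open>f\<close> exceeds \<open>f x\<close> is a downward jump, for all \<open>x\<close> close to \<open>b\<close>.\<close>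

lemma jump_down_interval:
  assumes f: "df1 f" and ab: "a < b" and inj: "\<And>x y. a < x \<Longrightarrow> x < b \<Longrightarrow> a < y \<Longrightarrow> y < b \<Longrightarrow> f x = f y \<Longrightarrow> x =
    y"
    and gl: "\<And>x. a < x \<Longrightarrow> x < b \<Longrightarrow> greater_left f x"
    and gr: "\<And>x. a < x \<Longrightarrow> x < b \<Longrightarrow> greater_right f x"
  obtains p q where "a < p" "p < q" "q < b" "\<And>c. p < c \<Longrightarrow> c < q \<Longrightarrow> jump_down f c"
proof -
  \<comment> \<open>Points whose value lies below all later values. An interval of them would make
    \<open>f\<close> increasing there, against \<open>greater_left\<close>; so beyond finitely many
    exceptions every \<open>x\<close> has a smaller value further right.\<close>
  define B where "B = {x. a < x \<and> x < b \<and> (\<forall>y. x < y \<and> y < b \<longrightarrow> f x < f y)}"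
  have dB: "dp1 B" unfolding B_def dp1_def mem_Collect_eq by (intro qintros df_app1[OF f])
  have "finite B"
  proof (rule ccontr)
    assume "infinite B"
    then obtain p q where pq: "p < q" "\<And>x. p < x \<Longrightarrow> x < q \<Longrightarrow> x \<in> B" using infinite_dp1[OF dB] by blast
    obtain x where x: "p < x" "x < q" using dense[OF pq(1)] by blast
    then have "greater_left f x" using gl pq(2) by (auto simp: B_def)
    then obtain u where u: "u < x" "\<And>y. u < y \<Longrightarrow> y < x \<Longrightarrow> f x < f y"
      by (auto simp: greater_left_def)
    obtain y where y: "max u p < y" "y < x" using dense[of "max u p" x] u x by auto
    then have "y \<in> B" "x \<in> B" using pq(2) x by auto
    then have "f y < f x" using y by (auto simp: B_def)
    then show False using u(2)[of y] y by auto
  qed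
  then obtain a' where a': "a \<le> a'" "a' < b" "\<And>x. a' < x \<Longrightarrow> x < b \<Longrightarrow> x \<notin> B"
    using cofinite_interval ab by blast
  define J where "J = {c. a < c \<and> c < b \<and> jump_down f c}"
  have dJ: "dp1 J" unfolding J_def dp1_def mem_Collect_eq jump_down_def
    by (intro qintros df_app1[OF f])
  have ex: "\<exists>c. x < c \<and> c \<in> J" if x: "a' < x" "x < b" for x
  proof -
    have ax: "a < x" using a' x by simp
    have S: "dp1 {y. f y < f x}" unfolding dp1_def mem_Collect_eq by (intro qintros df_app1[OF f])
    \<comment> \<open>\<open>f\<close> falls below \<open>f x\<close> for good before
      \<open>b\<close>. Otherwise let \<open>s\<close> be the supremum of the points with smaller
      values: if \<open>f s < f x\<close>, then \<open>s\<close> lies in \<open>B\<close>; if not,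
      \<open>greater_left\<close> at \<open>s\<close> keeps the smaller values away from
      \<open>s\<close>.\<close>
    obtain c where c: "c < b" "\<And>y. c < y \<Longrightarrow> y < b \<Longrightarrow> f y < f x"
    proof (rule left_cases[OF S, of b])
      fix c assume "c < b" "\<And>y. c < y \<Longrightarrow> y < b \<Longrightarrow> y \<in> {y. f y < f x}"
      then show ?thesis using that[of c] by simp
    next
      fix c assume c: "c < b" "\<And>y. c < y \<Longrightarrow> y < b \<Longrightarrow> y \<notin> {y. f y < f x}"
      have "x \<notin> B" using a'(3) x by simp
      then obtain y where y: "x < y" "y < b" "f y \<le> f x" using x ax by (auto simp: B_def not_less)
      then have "f y < f x" using inj[of y x] ax x by (metis le_less less_trans less_irrefl)
      let ?T = "{y. x < y \<and> y < b \<and> f y < f x}"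
      have T: "dp1 ?T" unfolding dp1_def mem_Collect_eq by (intro qintros df_app1[OF f])
      define s where "s = lub ?T"
      have c': "z \<le> c" if "z \<in> ?T" for z using c(2)[of z] that by force
      have s: "is_lub ?T s" unfolding s_def
        by (rule is_lub_dp1[OF T, of y c]) (use y \<open>f y < f x\<close> c' in auto)
      then have "y \<le> s" using y \<open>f y < f x\<close> by (auto simp: is_lub_def)
      have "s \<le> c" using s c' by (auto simp: is_lub_def)
      then have sx: "x < s" "s < b" using y \<open>y \<le> s\<close> c by auto
      have after: "f x \<le> f z" if "s < z" "z < b" for z
      proof (rule ccontr)
        assume "\<not> f x \<le> f z"
        then have "z \<in> ?T" using that sx by auto
        then show False using s that by (auto simp: is_lub_def)
      qed
      show ?thesis
      proof (cases "f s < f x")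
        case True
        then have "s \<in> B" using after sx ax by (force simp: B_def)
        then show ?thesis using a'(3) sx x by (meson less_trans)
      next
        case False
        have "a < s" using ax sx(1) by (rule less_trans)
        then obtain u where u: "u < s" "\<And>y. u < y \<Longrightarrow> y < s \<Longrightarrow> f s < f y"
          using gl[of s] sx by (auto simp: greater_left_def)
        have "z \<le> u" if z: "z \<in> ?T" for z
        proof (rule ccontr)
          assume "\<not> z \<le> u"
          moreover have "z \<le> s" using s z by (auto simp: is_lub_def)
          moreover have "z \<noteq> s" using z False by auto
          ultimately have "f s < f z" by (intro u(2)) auto
          moreover have "f z < f x" using z by simp
          ultimately show False using False less_trans by blast
        qed
        then have "s \<le> u" using s unfolding is_lub_def by blast
        then show ?thesis using u by simp
      qed
    qed
    let ?T = "{y. x < y \<and> y < b \<and> f x \<le> f y}"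
    have T: "dp1 ?T" unfolding dp1_def mem_Collect_eq by (intro qintros df_app1[OF f])
    obtain v where v: "x < v" "\<And>y. x < y \<Longrightarrow> y < v \<Longrightarrow> f x < f y"
      using gr[of x] x ax by (auto simp: greater_right_def)
    obtain y where y: "x < y" "y < min v b" using dense[of x "min v b"] v x by auto
    then have yT: "y \<in> ?T" using v(2)[of y] by auto
    define s where "s = lub ?T"
    have cT: "z \<le> c" if "z \<in> ?T" for z
    proof (rule ccontr)
      assume "\<not> z \<le> c"
      then have "f z < f x" using c(2)[of z] that by auto
      then show False using that by auto
    qed
    have s: "is_lub ?T s" unfolding s_def by (rule is_lub_dp1[OF T yT cT])
    have "y \<le> s" "s \<le> c" using s yT cT unfolding is_lub_def by blast+
    then have sb: "x < s" "s < b" using y c by auto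
    have after: "f z < f x" if "s < z" "z < b" for z
    proof (rule ccontr)
      assume "\<not> f z < f x"
      then have "z \<in> ?T" using that sb by auto
      then show False using s that unfolding is_lub_def by force
    qed
    \<comment> \<open>Just left of \<open>s\<close> the values are at least \<open>f x\<close>: if
      the points there missed \<open>?T\<close>, then \<open>greater_left\<close> would exclude
      \<open>s\<close> from \<open>?T\<close> as well, and \<open>s\<close> could not be its
      supremum.\<close>
    obtain u where u: "u < s" "\<And>y. u < y \<Longrightarrow> y < s \<Longrightarrow> f x \<le> f y"
    proof (rule left_cases[OF T, of s])
      fix u assume "u < s" "\<And>y. u < y \<Longrightarrow> y < s \<Longrightarrow> y \<in> ?T"
      then show ?thesis using that[of u] by auto
    next
      fix u assume u: "u < s" "\<And>y. u < y \<Longrightarrow> y < s \<Longrightarrow> y \<notin> ?T"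
      have "a < s" using ax sb(1) by (rule less_trans)
      then obtain w where w: "w < s" "\<And>y. w < y \<Longrightarrow> y < s \<Longrightarrow> f s < f y"
        using gl[of s] sb by (auto simp: greater_left_def)
      have "s \<notin> ?T"
      proof
        assume "s \<in> ?T"
        obtain z where z: "max (max u w) x < z" "z < s"
          using dense[of "max (max u w) x" s] u w sb by auto
        then have "f x \<le> f z" using w(2)[of z] \<open>s \<in> ?T\<close> by auto
        then show False using u(2)[of z] z sb by auto
      qed
      have "z \<le> u" if z: "z \<in> ?T" for z
      proof (rule ccontr)
        assume "\<not> z \<le> u"
        moreover have "z \<le> s" using s z unfolding is_lub_def by blast
        moreover have "z \<noteq> s" using z \<open>s \<notin> ?T\<close> by blast
        ultimately have "u < z" "z < s" by auto
        then show False using u(2) z by blast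
      qed
      then have "s \<le> u" using s unfolding is_lub_def by blast
      then show ?thesis using u by simp
    qed
    have "f x < f z" if z: "max u x < z" "z < s" for z
      using u(2)[of z] inj[of x z] z ax x sb
        by (metis le_less less_trans max_less_iff_conj less_irrefl)
    then have "jump_down f s" unfolding jump_down_def
      using after u sb by (intro exI[of _ "f x"] exI[of _ "max u x"] exI[of _ b]) auto
    then show ?thesis using sb ax by (auto simp: J_def)
  qed
  have "infinite J"
  proof
    assume fin: "finite J"
    obtain x where x: "a' < x" "x < b" using dense[OF a'(2)] by blast
    then obtain c where c: "x < c" "c \<in> J" using ex by blast
    then have m: "Max J \<in> J" using fin by (intro Max_in) auto
    then have "x < Max J" using c fin by (meson Max_ge less_le_trans)
    moreover have "Max J < b" using m by (simp add: J_def)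
    ultimately obtain d where "Max J < d" "d \<in> J" using ex[of "Max J"] x by (meson less_trans)
    then show False using fin by (meson Max_ge leD)
  qed
  then obtain p q where pq: "p < q" "\<And>x. p < x \<Longrightarrow> x < q \<Longrightarrow> x \<in> J" using infinite_dp1[OF dJ] by blast
  obtain p' where p': "p < p'" "p' < q" using dense[OF pq(1)] by blast
  obtain q' where q': "p' < q'" "q' < q" using dense[OF p'(2)] by blast
  have "p' \<in> J" "q' \<in> J" using pq(2) p' q' by auto
  then show ?thesis using that[of p' q'] pq(2) p' q' by (auto simp: J_def)
qed

text \<open>The hypotheses are invariant under reflection. Applying
  \<open>jump_down_interval\<close> to \<open>f\<close>, and then to its mirror image over the
  interval found, gives a point with jumps in opposite directions.\<close>

lemma no_local_min_everywhere:
  assumes f: "df1 f" and ab: "a < b" and inj: "\<And>x y. a < x \<Longrightarrow> x < b \<Longrightarrow> a < y \<Longrightarrow> y < b \<Longrightarrow> f x = f y \<Longrightarrow> x =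
    y"
    and gl: "\<And>x. a < x \<Longrightarrow> x < b \<Longrightarrow> greater_left f x"
    and gr: "\<And>x. a < x \<Longrightarrow> x < b \<Longrightarrow> greater_right f x"
  shows False
proof -
  obtain p q where pq: "a < p" "p < q" "q < b" and jd: "\<And>c. p < c \<Longrightarrow> c < q \<Longrightarrow> jump_down f c"
    using jump_down_interval[OF assms] by blast
  have mid: "a < - x \<and> - x < b \<and> p < - x \<and> - x < q" if "- q < x" "x < - p" for x
    using that pq by (meson group_neg_less_swap less_trans)
  have f': "df1 (\<lambda>x. f (- x))" unfolding df1_def by (intro df_app1[OF f] qintros)
  obtain p' q' where pq': "- q < p'" "p' < q'" "q' < - p"
    and jd': "\<And>c. p' < c \<Longrightarrow> c < q' \<Longrightarrow> jump_down (\<lambda>x. f (- x)) c"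
  proof (rule jump_down_interval[OF f', of "- q" "- p"])
    show "- q < - p" using pq by simp
    fix x assume x: "- q < x" "x < - p"
    show "greater_left (\<lambda>x. f (- x)) x"
      using greater_left_reflect[of f "- x"] gr[of "- x"] mid[OF x] by simp
    show "greater_right (\<lambda>x. f (- x)) x"
      using greater_right_reflect[of f "- x"] gl[of "- x"] mid[OF x] by simp
    fix y assume y: "- q < y" "y < - p" "f (- x) = f (- y)"
    then have "- x = - y" using inj[of "- x" "- y"] mid[OF x] mid[OF y(1,2)] by simp
    then show "x = y" by simp
  qed blast
  obtain c where c: "p' < c" "c < q'" using dense[OF pq'(2)] by blast
  then have "- q < c" "c < - p" using pq' by auto
  then have "jump_down f (- c)" using jd mid by blast
  moreover have "jump_down (\<lambda>x. f (- x)) (- (- c))" using jd'[OF c] by simp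
  ultimately show False by (rule jump_down_not_both)
qed

text \<open>Consider the supremum of the \<open>z\<close> up to which \<open>f\<close> stays above
  \<open>f x\<close>. The local condition on its left carries the inequality to the supremum, the
  one on its right carries it beyond, so the supremum is \<open>y\<close>.\<close>

lemma strict_mono_of_local:
  assumes f: "df1 f"
    and ll: "\<And>x. a < x \<Longrightarrow> x < b \<Longrightarrow> less_left f x"
    and gr: "\<And>x. a < x \<Longrightarrow> x < b \<Longrightarrow> greater_right f x"
    and xy: "a < x" "x < y" "y < b"
  shows "f x < f y"
proof -
  let ?S = "{z. x < z \<and> z \<le> y \<and> (\<forall>w. x < w \<and> w \<le> z \<longrightarrow> f x < f w)}"
  have S: "dp1 ?S" unfolding dp1_def mem_Collect_eq by (intro qintros df_app1[OF f])
  define s where "s = lub ?S"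
  have step: "\<exists>z'. z < z' \<and> z' \<in> ?S" if "x \<le> z" "z < y" "\<And>w. x < w \<Longrightarrow> w \<le> z \<Longrightarrow> f x < f w" for z
  proof -
    have "greater_right f z" using gr that xy by simp
    then obtain v where v: "z < v" "\<And>w. z < w \<Longrightarrow> w < v \<Longrightarrow> f z < f w" by (auto simp: greater_right_def)
    obtain z' where z': "z < z'" "z' < min v y" using dense[of z "min v y"] v \<open>z < y\<close> by auto
    have "f x \<le> f z" using that by (cases "x = z") (auto simp: less_imp_le)
    then have "f x < f w" if "z < w" "w \<le> z'" for w using v(2)[of w] that z' by force
    then have "f x < f w" if "x < w" "w \<le> z'" for w
      using that \<open>\<And>w. x < w \<Longrightarrow> w \<le> z \<Longrightarrow> f x < f w\<close> by (cases "w \<le> z") auto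
    then show ?thesis using z' that by (intro exI[of _ z']) auto
  qed
  have "\<exists>z'. x < z' \<and> z' \<in> ?S" by (rule step) (use xy in auto)
  then obtain z where z: "x < z" "z \<in> ?S" by blast
  have s: "is_lub ?S s" unfolding s_def by (rule is_lub_dp1[OF S z(2), of y]) simp
  have "z \<le> s" using s z unfolding is_lub_def by blast
  have "s \<le> y" using s unfolding is_lub_def by auto
  have xs: "x < s" using z \<open>z \<le> s\<close> by simp
  have below: "f x < f w" if w: "x < w" "w < s" for w
  proof -
    have "\<not> (\<forall>z. z \<in> ?S \<longrightarrow> z \<le> w)" using s w unfolding is_lub_def by (blast dest: leD)
    then show ?thesis using w by auto
  qed
  have "less_left f s" using ll xs xy \<open>s \<le> y\<close> by auto
  then obtain u where u: "u < s" "\<And>w. u < w \<Longrightarrow> w < s \<Longrightarrow> f w < f s" by (auto simp: less_left_def)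
  obtain w where w: "max u x < w" "w < s" using dense[of "max u x" s] u xs by auto
  then have fs: "f x < f s" using u(2)[of w] below[of w] by auto
  have "\<not> s < y"
  proof
    assume "s < y"
    then obtain z' where "s < z'" "z' \<in> ?S" using step[of s] xs below fs by (auto simp: le_less)
    then show False using s unfolding is_lub_def by (blast dest: leD)
  qed
  then have "s = y" using \<open>s \<le> y\<close> by simp
  then show ?thesis using fs by simp
qed

text \<open>The image is infinite and so contains an interval. At the preimage of a point of that
  interval, values slightly below and above are attained, and monotonicity traps \<open>f\<close>
  between them.\<close>

lemma strict_mono_cont:
  assumes f: "df1 f" and ab: "a < b"
    and mono: "\<And>x y. a < x \<Longrightarrow> x < y \<Longrightarrow> y < b \<Longrightarrow> f x < f y"
  obtains r where "a < r" "r < b" "cont1 f r"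
proof -
  let ?I = "{y. \<exists>x. a < x \<and> x < b \<and> f x = y}"
  have I: "dp1 ?I" unfolding dp1_def mem_Collect_eq by (intro qintros df_app1[OF f])
  have "inj_on f {a<..<b}"
    by (rule inj_onI) (metis greaterThanLessThan_iff linorder_neqE mono less_irrefl)
  moreover have "?I = f ` {a<..<b}" by auto
  ultimately have "infinite ?I" using infinite_Ioo[OF ab] by (simp add: finite_image_iff)
  then obtain p q where pq: "p < q" "\<And>y. p < y \<Longrightarrow> y < q \<Longrightarrow> y \<in> ?I" using infinite_dp1[OF I] by blast
  have less: "x < x'" if "f x < f x'" "a < x" "x < b" "a < x'" "x' < b" for x x'
    using mono[of x' x] that by (metis linorder_neqE less_asym less_irrefl)
  obtain y where y: "p < y" "y < q" using dense[OF pq(1)] by blast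
  then obtain r where r: "a < r" "r < b" "f r = y" using pq(2) by blast
  have "cont1 f r"
    unfolding cont1_def
  proof (intro allI impI)
    fix c d assume cd: "c < f r \<and> f r < d"
    obtain c' where c': "max c p < c'" "c' < y" using dense[of "max c p" y] cd r y by auto
    obtain d' where d': "y < d'" "d' < min d q" using dense[of y "min d q"] cd r y by auto
    obtain u where u: "a < u" "u < b" "f u = c'" using pq(2)[of c'] c' y by fastforce
    obtain v where v: "a < v" "v < b" "f v = d'" using pq(2)[of d'] d' y by fastforce
    have "u < r" "r < v" using less u v r c' d' by auto
    moreover have "c < f z \<and> f z < d" if "u < z" "z < v" for z
    proof -
      have "f u < f z" "f z < f v" using mono[of u z] mono[of z v] that u v by auto
      then show ?thesis using u v c' d' by auto
    qed
    ultimately show "\<exists>u v. u < r \<and> r < v \<and> (\<forall>y. u < y \<and> y < v \<longrightarrow> c < f y \<and> f y < d)" by blast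
  qed
  then show ?thesis using that r by blast
qed

text \<open>An infinite fibre contains an interval. If all fibres are finite, the image contains an
  interval, on which choice gives a section \<open>g\<close> of \<open>f\<close>; then
  \<open>f\<close> is injective on the image of \<open>g\<close>, which again contains an
  interval.\<close>

lemma injective_or_constant:
  assumes f: "df1 f" and ab: "a < b"
  obtains (const) p q where "a < p" "p < q" "q < b" "\<And>x y. p < x \<Longrightarrow> x < q \<Longrightarrow> p < y \<Longrightarrow> y < q \<Longrightarrow> f x = f
    y"
  | (inj) p q where "a < p" "p < q" "q < b" "\<And>x y. p < x \<Longrightarrow> x < q \<Longrightarrow> p < y \<Longrightarrow> y < q \<Longrightarrow> f x = f y \<Longrightarrow> x =
    y"
proof -
  have sub: "\<exists>p' q'. a < p' \<and> p' < q' \<and> q' < b \<and> p < p' \<and> q' < q"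
    if pq: "p < q" "\<And>x. p < x \<Longrightarrow> x < q \<Longrightarrow> a < x \<and> x < b" for p q :: 'm
  proof -
    obtain p' where p': "p < p'" "p' < q" using dense[OF pq(1)] by blast
    obtain q' where q': "p' < q'" "q' < q" using dense[OF p'(2)] by blast
    have "a < p'" "q' < b" using pq(2)[of p'] pq(2)[of q'] p' q' by auto
    then show ?thesis using p' q' by blast
  qed
  show ?thesis
  proof (cases "\<exists>y. infinite {x. a < x \<and> x < b \<and> f x = y}")
    case True
    then obtain y where y: "infinite {x. a < x \<and> x < b \<and> f x = y}" by blast
    have "dp1 {x. a < x \<and> x < b \<and> f x = y}"
      unfolding dp1_def mem_Collect_eq by (intro qintros df_app1[OF f])
    then obtain p q where pq: "p < q" "\<And>x. p < x \<Longrightarrow> x < q \<Longrightarrow> x \<in> {x. a < x \<and> x < b \<and> f x = y}"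
      using infinite_dp1 y by blast
    then obtain p' q' where "a < p'" "p' < q'" "q' < b" "p < p'" "q' < q" using sub[of p q] by auto
    then show ?thesis using const[of p' q'] pq(2) by (smt (verit) less_trans mem_Collect_eq)
  next
    case False
    then have fin: "finite {x. a < x \<and> x < b \<and> f x = y}" for y by blast
    let ?I = "{y. \<exists>x. a < x \<and> x < b \<and> f x = y}"
    have I: "dp1 ?I" unfolding dp1_def mem_Collect_eq by (intro qintros df_app1[OF f])
    have "infinite ?I"
    proof
      assume "finite ?I"
      then have "finite (f ` {a<..<b})" by (rule rev_finite_subset) auto
      then obtain z where "infinite {x \<in> {a<..<b}. f x = f z}"
        using pigeonhole_infinite[OF infinite_Ioo[OF ab], of f] by blast
      then show False using fin[of "f z"] by (simp add: conj_assoc)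
    qed
    then obtain c d where cd: "c < d" "\<And>y. c < y \<Longrightarrow> y < d \<Longrightarrow> y \<in> ?I" using infinite_dp1[OF I] by blast
    define g where "g y = ch {x. a < x \<and> x < b \<and> f x = y}" for y
    have g: "a < g y \<and> g y < b \<and> f (g y) = y" if "c < y" "y < d" for y
    proof -
      have "dp1 {x. a < x \<and> x < b \<and> f x = y}"
        unfolding dp1_def mem_Collect_eq by (intro qintros df_app1[OF f])
      moreover obtain x where "a < x \<and> x < b \<and> f x = y" using cd(2)[OF \<open>c < y\<close> \<open>y < d\<close>] by blast
      ultimately have "g y \<in> {x. a < x \<and> x < b \<and> f x = y}" unfolding g_def by (intro ch_mem) auto
      then show ?thesis by simp
    qed
    have dg: "df1 g" unfolding df1_def g_def by (intro df_ch qintros df_app1[OF f])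
    let ?J = "{x. \<exists>y. c < y \<and> y < d \<and> g y = x}"
    have J: "dp1 ?J" unfolding dp1_def mem_Collect_eq by (intro qintros df_app1[OF dg])
    have "inj_on g {c<..<d}" by (rule inj_onI) (metis g greaterThanLessThan_iff)
    moreover have "?J = g ` {c<..<d}" by auto
    ultimately have "infinite ?J" using infinite_Ioo[OF cd(1)] by (simp add: finite_image_iff)
    then obtain p q where pq: "p < q" "\<And>x. p < x \<Longrightarrow> x < q \<Longrightarrow> x \<in> ?J" using infinite_dp1[OF J] by blast
    have in_ab: "a < x \<and> x < b" if "p < x" "x < q" for x using pq(2)[OF that] g by blast
    have inj': "x = x'" if "p < x" "x < q" "p < x'" "x' < q" "f x = f x'" for x x'
      using pq(2)[OF that(1,2)] pq(2)[OF that(3,4)] that(5) g by auto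
    obtain p' q' where "a < p'" "p' < q'" "q' < b" "p < p'" "q' < q"
      using sub[OF pq(1) in_ab] by blast
    then show ?thesis using inj[of p' q'] inj' by (meson less_trans)
  qed
qed

text \<open>The monotonicity theorem in pointwise form: instead of a partition into intervals, only
  the finiteness of the set of exceptional points is recorded.\<close>

definition nice :: "('m \<Rightarrow> 'm) \<Rightarrow> 'm \<Rightarrow> bool" where
  "nice f r \<longleftrightarrow> cont1 f r \<and> (loc_const f r \<or> (less_left f r \<and> greater_right f r)
                              \<or> (greater_left f r \<and> less_right f r))"

text \<open>Where \<open>f\<close> is injective every point has one of four local types, and one
  type holds on a subinterval. The two monotone types yield a point of continuity. Strict local
  minima are excluded by \<open>no_local_min_everywhere\<close>, maxima by its application to
  \<open>- f\<close>.\<close>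

lemma ex_nice:
  assumes f: "df1 f" and ab: "a < b"
  shows "\<exists>r. a < r \<and> r < b \<and> nice f r"
proof (rule injective_or_constant[OF assms])
  fix p q assume pq: "a < p" "p < q" "q < b" "\<And>x y. p < x \<Longrightarrow> x < q \<Longrightarrow> p < y \<Longrightarrow> y < q \<Longrightarrow> f x = f y"
  obtain r where r: "p < r" "r < q" using dense[OF pq(2)] by blast
  have c: "\<forall>y. p < y \<and> y < q \<longrightarrow> f y = f r" using pq(4) r by blast
  have "cont1 f r" unfolding cont1_def
    using r by (intro allI impI exI[of _ p] exI[of _ q] conjI) (simp_all, (metis c)+)
  moreover have "loc_const f r" unfolding loc_const_def using r c by blast
  ultimately show ?thesis using r pq unfolding nice_def by (meson less_trans)
next
  fix p q assume pq: "a < p" "p < q" "q < b"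
    and inj: "\<And>x y. p < x \<Longrightarrow> x < q \<Longrightarrow> p < y \<Longrightarrow> y < q \<Longrightarrow> f x = f y \<Longrightarrow> x = y"
  have right: "less_right f x \<or> greater_right f x" if x: "p < x" "x < q" for x
  proof -
    have S: "dp1 {y. f y < f x}" unfolding dp1_def mem_Collect_eq by (intro qintros df_app1[OF f])
    show ?thesis
    proof (rule right_cases[OF S, of x])
      fix b assume "x < b" "\<And>y. x < y \<Longrightarrow> y < b \<Longrightarrow> y \<in> {y. f y < f x}"
      then show ?thesis unfolding less_right_def by blast
    next
      fix b assume b: "x < b" "\<And>y. x < y \<Longrightarrow> y < b \<Longrightarrow> y \<notin> {y. f y < f x}"
      have "f x < f y" if "x < y" "y < min b q" for y
        using b(2)[of y] inj[of x y] that x by (force simp: not_less le_less)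
      then show ?thesis unfolding greater_right_def using b x
        by (intro disjI2 exI[of _ "min b q"]) auto
    qed
  qed
  have left: "less_left f x \<or> greater_left f x" if x: "p < x" "x < q" for x
  proof -
    have S: "dp1 {y. f y < f x}" unfolding dp1_def mem_Collect_eq by (intro qintros df_app1[OF f])
    show ?thesis
    proof (rule left_cases[OF S, of x])
      fix b assume "b < x" "\<And>y. b < y \<Longrightarrow> y < x \<Longrightarrow> y \<in> {y. f y < f x}"
      then show ?thesis unfolding less_left_def by blast
    next
      fix b assume b: "b < x" "\<And>y. b < y \<Longrightarrow> y < x \<Longrightarrow> y \<notin> {y. f y < f x}"
      have "f x < f y" if "max b p < y" "y < x" for y
        using b(2)[of y] inj[of x y] that x by (force simp: not_less le_less)
      then show ?thesis unfolding greater_left_def using b x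
        by (intro disjI2 exI[of _ "max b p"]) auto
    qed
  qed
  define A1 where "A1 = {x. p < x \<and> x < q \<and> less_left f x \<and> greater_right f x}"
  define A2 where "A2 = {x. p < x \<and> x < q \<and> greater_left f x \<and> less_right f x}"
  define A3 where "A3 = {x. p < x \<and> x < q \<and> greater_left f x \<and> greater_right f x}"
  define A4 where "A4 = {x. p < x \<and> x < q \<and> less_left f x \<and> less_right f x}"
  have d: "dp1 A1" "dp1 A2" "dp1 A3" "dp1 A4"
    unfolding A1_def A2_def A3_def A4_def dp1_def mem_Collect_eq
      less_left_def greater_left_def less_right_def greater_right_def
    by (intro qintros df_app1[OF f])+
  have "{p<..<q} \<subseteq> A1 \<union> A2 \<union> A3 \<union> A4"
  proof
    fix x assume "x \<in> {p<..<q}"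
    then show "x \<in> A1 \<union> A2 \<union> A3 \<union> A4"
      using left[of x] right[of x] by (auto simp: A1_def A2_def A3_def A4_def)
  qed
  then have "infinite (A1 \<union> A2 \<union> A3 \<union> A4)" using infinite_Ioo[OF pq(2)] by (meson finite_subset)
  then consider "infinite A1" | "infinite A2" | "infinite A3" | "infinite A4" by auto
  then show ?thesis
  proof cases
    case 1
    then obtain p' q' where pq': "p' < q'" "\<And>x. p' < x \<Longrightarrow> x < q' \<Longrightarrow> x \<in> A1"
      using infinite_dp1[OF d(1)] by blast
    then have A: "\<And>x. p' < x \<Longrightarrow> x < q' \<Longrightarrow> p < x \<and> x < q \<and> less_left f x \<and> greater_right f x"
      by (auto simp: A1_def)
    obtain r where r: "p' < r" "r < q'" "cont1 f r"
    proof (rule strict_mono_cont[OF f pq'(1)])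
      fix x y assume "p' < x" "x < y" "y < q'"
      then show "f x < f y" by (intro strict_mono_of_local[OF f]) (use A in auto)
    qed blast
    then show ?thesis using A[OF r(1,2)] pq unfolding nice_def by (meson less_trans)
  next
    case 2
    then obtain p' q' where pq': "p' < q'" "\<And>x. p' < x \<Longrightarrow> x < q' \<Longrightarrow> x \<in> A2"
      using infinite_dp1[OF d(2)] by blast
    then have A: "\<And>x. p' < x \<Longrightarrow> x < q' \<Longrightarrow> p < x \<and> x < q \<and> greater_left f x \<and> less_right f x"
      by (auto simp: A2_def)
    have f': "df1 (\<lambda>x. - f x)" unfolding df1_def by (intro qintros df_app1[OF f])
    obtain r where r: "p' < r" "r < q'" "cont1 (\<lambda>x. - f x) r"
    proof (rule strict_mono_cont[OF f' pq'(1)])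
      fix x y assume "p' < x" "x < y" "y < q'"
      then show "- f x < - f y"
        by (intro strict_mono_of_local[OF f']) (use A in \<open>auto simp: less_left_neg
          greater_right_neg\<close>)
    qed blast
    then have "cont1 f r" "greater_left f r" "less_right f r" "a < r" "r < b"
      using cont1_neg A[OF r(1,2)] pq by (auto intro: less_trans)
    then show ?thesis unfolding nice_def by blast
  next
    case 3
    then obtain p' q' where pq': "p' < q'" "\<And>x. p' < x \<Longrightarrow> x < q' \<Longrightarrow> x \<in> A3"
      using infinite_dp1[OF d(3)] by blast
    then have A: "\<And>x. p' < x \<Longrightarrow> x < q' \<Longrightarrow> p < x \<and> x < q \<and> greater_left f x \<and> greater_right f x"
      by (auto simp: A3_def)
    have False by (rule no_local_min_everywhere[OF f pq'(1)]) (use A inj in blast)+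
    then show ?thesis ..
  next
    case 4
    then obtain p' q' where pq': "p' < q'" "\<And>x. p' < x \<Longrightarrow> x < q' \<Longrightarrow> x \<in> A4"
      using infinite_dp1[OF d(4)] by blast
    then have A: "\<And>x. p' < x \<Longrightarrow> x < q' \<Longrightarrow> p < x \<and> x < q \<and> less_left f x \<and> less_right f x"
      by (auto simp: A4_def)
    have f': "df1 (\<lambda>x. - f x)" unfolding df1_def by (intro qintros df_app1[OF f])
    have False
      by (rule no_local_min_everywhere[OF f' pq'(1)])
        (use A inj in \<open>auto simp: greater_left_neg greater_right_neg\<close>)
    then show ?thesis ..
  qed
qed

lemma dp1_nice:
  assumes f: "df1 f" shows "dp1 {r. nice f r}"
  unfolding dp1_def mem_Collect_eq nice_def cont1_def loc_const_def
      less_left_def greater_left_def less_right_def greater_right_def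
  by (intro qintros df_app1[OF f])

lemma finite_not_nice: "df1 f \<Longrightarrow> finite {r. \<not> nice f r}"
proof (rule ccontr)
  assume f: "df1 f" and inf: "infinite {r. \<not> nice f r}"
  have "dp1 {r. \<not> nice f r}"
    using dp_neg[OF dp1_nice[OF f, unfolded dp1_def]] by (simp add: dp1_def)
  then obtain a b where "a < b" "\<And>x. a < x \<Longrightarrow> x < b \<Longrightarrow> x \<in> {r. \<not> nice f r}"
    using infinite_dp1 inf by blast
  then show False using ex_nice[OF f] by blast
qed

text \<open>Otherwise an interval \<open>(f t, g t)\<close> can be chosen definably in the fibre
  over each \<open>t\<close> of an interval. At a common continuity point \<open>r\<close> of
  \<open>f\<close> and \<open>g\<close>, a single \<open>s\<close> lies in these intervals for all
  \<open>t\<close> near \<open>r\<close>, so infinitely many \<open>t\<close> are related to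
  \<open>s\<close>.\<close>

lemma finite_to_one_plane:
  assumes R: "dp (\<lambda>e. R (e 0) (e 1))" and fin: "\<And>s. finite {t. R t s}"
  shows "finite {t. infinite {s. R t s}}"
proof (rule ccontr)
  have R': "df t \<Longrightarrow> df s \<Longrightarrow> dp (\<lambda>e. R (t e) (s e))" for t s using dp_comp2[OF R] .
  define Q where "Q t a b \<longleftrightarrow> a < b \<and> (\<forall>s. a < s \<and> s < b \<longrightarrow> R t s)" for t a b
  have Q': "df t \<Longrightarrow> df a \<Longrightarrow> df b \<Longrightarrow> dp (\<lambda>e. Q (t e) (a e) (b e))" for t a b
  proof -
    have h: "dp (\<lambda>e. Q (e 0) (e 1) (e 2))" unfolding Q_def by (intro qintros R')
    assume "df t" "df a" "df b"
    moreover define G where "G e i = (if i = 0 then t e else if i = 1 then a e else b e)" for e and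
      i :: nat
    ultimately have "df (\<lambda>e. G e i)" for i unfolding G_def by (intro df_if_const)
    then have "dp (\<lambda>e. Q (G e 0) (G e 1) (G e 2))" by (rule dp_comp[OF h])
    then show ?thesis by (simp add: G_def)
  qed
  have dR: "dp1 {s. R t s}" for t unfolding dp1_def mem_Collect_eq by (intro R' qintros)
  have iff: "infinite {s. R t s} \<longleftrightarrow> (\<exists>a b. Q t a b)" for t
    unfolding infinite_iff_dp1[OF dR] by (simp add: Q_def)
  assume "infinite {t. infinite {s. R t s}}"
  moreover have "dp1 {t. infinite {s. R t s}}"
    unfolding dp1_def mem_Collect_eq iff by (intro qintros Q')
  ultimately obtain p q where pq: "p < q" "\<And>t. p < t \<Longrightarrow> t < q \<Longrightarrow> \<exists>a b. Q t a b"
    using infinite_dp1 iff by (metis (no_types, lifting) mem_Collect_eq)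
  define f where "f t = ch {a. \<exists>b. Q t a b}" for t
  define g where "g t = ch {b. Q t (f t) b}" for t
  have df: "df1 f" unfolding df1_def f_def by (intro df_ch qintros Q')
  have dg: "df1 g" unfolding df1_def g_def by (intro df_ch qintros Q' df_app1[OF df])
  have fg: "Q t (f t) (g t)" if "p < t" "t < q" for t
  proof -
    obtain a b where ab: "Q t a b" using pq(2)[OF \<open>p < t\<close> \<open>t < q\<close>] by blast
    have "dp1 {a. \<exists>b. Q t a b}" unfolding dp1_def mem_Collect_eq by (intro qintros Q')
    then have "f t \<in> {a. \<exists>b. Q t a b}" unfolding f_def by (rule ch_mem[of _ a]) (use ab in blast)
    then obtain b where "Q t (f t) b" by blast
    moreover have "dp1 {b. Q t (f t) b}" unfolding dp1_def mem_Collect_eq by (intro qintros Q')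
    ultimately have "g t \<in> {b. Q t (f t) b}" unfolding g_def by (intro ch_mem) auto
    then show ?thesis by simp
  qed
  have "infinite ({p<..<q} - ({r. \<not> nice f r} \<union> {r. \<not> nice g r}))"
    using finite_not_nice[OF df] finite_not_nice[OF dg] infinite_Ioo[OF pq(1)] by simp
  then obtain r where r: "p < r" "r < q" "nice f r" "nice g r"
    by (force dest: infinite_imp_nonempty)
  then have "f r < g r" using fg by (auto simp: Q_def)
  then obtain s where s: "f r < s" "s < g r" using dense by blast
  obtain m where m: "m < f r" using lt_ex by blast
  obtain M where M: "g r < M" using gt_ex by blast
  obtain u v where uv: "u < r" "r < v" "\<And>y. u < y \<Longrightarrow> y < v \<Longrightarrow> f y < s"
    using r(3) m s unfolding nice_def cont1_def by blast
  obtain u' v' where uv': "u' < r" "r < v'" "\<And>y. u' < y \<Longrightarrow> y < v' \<Longrightarrow> s < g y"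
    using r(4) M s unfolding nice_def cont1_def by blast
  have "R y s" if "r < y" "y < min (min v v') q" for y
    using fg[of y] uv(3)[of y] uv'(3)[of y] uv uv' that r by (auto simp: Q_def)
  then have "{r<..<min (min v v') q} \<subseteq> {t. R t s}" by auto
  then have "finite {r<..<min (min v v') q}" using fin finite_subset by blast
  then show False using infinite_Ioo[of r "min (min v v') q"] uv uv' r by simp
qed

end

section \<open>Dimension\<close>

definition proj_last :: "'a list set \<Rightarrow> 'a list set" where
  "proj_last S = {x. \<exists>y. x @ [y] \<in> S}"

definition inf_last :: "'a list set \<Rightarrow> 'a list set" where
  "inf_last S = {x. infinite {y. x @ [y] \<in> S}}"

text \<open>\<open>dge m k S\<close>: the part of \<open>S\<close> in \<open>M\<^sup>m\<close> has dimension at least \<open>k\<close>.\<close>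

primrec dge :: "nat \<Rightarrow> nat \<Rightarrow> 'a list set \<Rightarrow> bool" where
  "dge 0 k S \<longleftrightarrow> k = 0 \<and> [] \<in> S"
| "dge (Suc m) k S \<longleftrightarrow> dge m k (proj_last S) \<or> (\<exists>k'. k = Suc k' \<and> dge m k' (inf_last S))"

lemma dge_mono: "dge m k A \<Longrightarrow> (\<And>x. length x = m \<Longrightarrow> x \<in> A \<Longrightarrow> x \<in> B) \<Longrightarrow> dge m k B"
proof (induction m arbitrary: k A B)
  case (Suc m)
  from Suc.prems(1) consider "dge m k (proj_last A)" | k' where "k = Suc k'" "dge m k' (inf_last A)"
    by auto
  then show ?case
  proof cases
    case 1
    have "dge m k (proj_last B)"
      by (rule Suc.IH[OF 1]) (use Suc.prems(2) in \<open>force simp: proj_last_def\<close>)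
    then show ?thesis by simp
  next
    case 2
    have "dge m k' (inf_last B)"
    proof (rule Suc.IH[OF 2(2)])
      fix x assume "length x = m" "x \<in> inf_last A"
      moreover from this have "{y. x @ [y] \<in> A} \<subseteq> {y. x @ [y] \<in> B}" using Suc.prems(2) by auto
      ultimately show "x \<in> inf_last B" unfolding inf_last_def using finite_subset by blast
    qed
    then show ?thesis using 2 by simp
  qed
qed auto

lemma dge_empty [simp]: "\<not> dge m k {}"
  by (induction m arbitrary: k) (auto simp: proj_last_def inf_last_def)

lemma dge_nonempty: "dge m k S \<Longrightarrow> \<exists>x\<in>S. length x = m"
  using dge_mono[of m k S "{}"] by auto

lemma dge_le: "dge m k S \<Longrightarrow> k \<le> m"
  by (induction m arbitrary: k S) (auto intro: le_SucI)

lemma dge_Suc_imp: "dge m (Suc k) S \<Longrightarrow> dge m k S"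
proof (induction m arbitrary: k S)
  case (Suc m)
  from Suc.prems consider "dge m (Suc k) (proj_last S)" | "dge m k (inf_last S)" by auto
  then show ?case
  proof cases
    case 1
    then show ?thesis using Suc.IH by auto
  next
    case 2
    then have "dge m k (proj_last S)"
      by (rule dge_mono) (auto simp: proj_last_def inf_last_def dest: infinite_imp_nonempty)
    then show ?thesis by simp
  qed
qed auto

lemma dge_antimono: "dge m k S \<Longrightarrow> j \<le> k \<Longrightarrow> dge m j S"
  by (induction k) (auto simp: le_Suc_eq dest: dge_Suc_imp)

lemma dge_0: "dge m 0 S \<longleftrightarrow> (\<exists>x\<in>S. length x = m)"
proof
  assume "\<exists>x\<in>S. length x = m"
  then show "dge m 0 S"
  proof (induction m arbitrary: S)
    case (Suc m)
    then obtain x where x: "x \<in> S" "length x = Suc m" by blast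
    then have "butlast x \<in> proj_last S"
      by (auto simp: proj_last_def intro!: exI[of _ "last x"])
       (metis append_butlast_last_id length_0_conv nat.distinct(1))
    then show ?case using Suc.IH[of "proj_last S"] x by fastforce
  qed auto
qed (rule dge_nonempty)

lemma dge_Un: "dge m k (A \<union> B) \<longleftrightarrow> dge m k A \<or> dge m k B"
proof (induction m arbitrary: k A B)
  case (Suc m)
  have "proj_last (A \<union> B) = proj_last A \<union> proj_last B" by (auto simp: proj_last_def)
  moreover have "inf_last (A \<union> B) = inf_last A \<union> inf_last B"
    by (auto simp: inf_last_def Collect_disj_eq)
  ultimately show ?case using Suc.IH by auto
qed auto

lemma dge_UN: "finite I \<Longrightarrow> dge m k (\<Union>i\<in>I. A i) \<Longrightarrow> \<exists>i\<in>I. dge m k (A i)"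
  by (induction I rule: finite_induct) (auto simp: dge_Un)

lemma dge_Diff: "dge m k A \<Longrightarrow> \<not> dge m k (A - B) \<Longrightarrow> dge m k B"
proof -
  assume "dge m k A" "\<not> dge m k (A - B)"
  moreover from this(1) have "dge m k ((A - B) \<union> B)" by (rule dge_mono) blast
  ultimately show ?thesis using dge_Un by blast
qed

text \<open>Carries a set from a slice in the first coordinate back into the ambient space without
  loss of dimension. Since \<open>dge\<close> peels coordinates off at the other end, this takes an
  induction.\<close>

lemma dge_Cons_image:
  assumes "dge m k V" shows "dge (Suc m) k ((#) s ` (V \<inter> {y. length y = m}))"
  using assms
proof (induction m arbitrary: k V)
  case 0
  then show ?case by (auto simp: proj_last_def)
next
  case (Suc m)
  let ?V = "V \<inter> {y. length y = Suc m}"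
  from Suc.prems consider "dge m k (proj_last V)" | k' where "k = Suc k'" "dge m k' (inf_last V)"
    by auto
  then show ?case
  proof cases
    case 1
    from Suc.IH[OF 1] have "dge (Suc m) k (proj_last ((#) s ` ?V))"
      by (rule dge_mono) (auto simp: proj_last_def image_iff)
    then show ?thesis by (subst dge.simps) blast
  next
    case 2
    from Suc.IH[OF 2(2)] have "dge (Suc m) k' (inf_last ((#) s ` ?V))"
    proof (rule dge_mono)
      fix x assume "x \<in> (#) s ` (inf_last V \<inter> {y. length y = m})"
      then obtain y where y: "x = s # y" "length y = m" "infinite {z. y @ [z] \<in> V}"
        by (auto simp: inf_last_def)
      then have "{z. x @ [z] \<in> (#) s ` ?V} = {z. y @ [z] \<in> V}" by auto
      then show "x \<in> inf_last ((#) s ` ?V)" using y by (simp add: inf_last_def)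
    qed
    then show ?thesis using 2(1) by (subst dge.simps) blast
  qed
qed

section \<open>Dimension in definable families\<close>

context o_minimal_structure
begin

text \<open>Dimension is definable in families because every \<open>infinite\<close> in the
  recursion becomes "contains an interval", uniformly in the parameters.\<close>

lemma dp_dge:
  assumes "dp (\<lambda>e. map e [0..<m] \<in> S (\<lambda>i. e (m + i)))"
  shows "dp (\<lambda>e. dge m k (S e))"
  using assms
proof (induction m arbitrary: k S)
  case 0
  then show ?case by (auto intro: dp_conj dp_const)
next
  case (Suc m)
  have S: "dl (Suc m) L \<Longrightarrow> (\<And>i. df (\<lambda>e. g e i)) \<Longrightarrow> dp (\<lambda>e. L e \<in> S (g e))" for L g
    using Suc.prems by (rule dp_list_comp[where P = "\<lambda>x e. x \<in> S e"])
  have sec: "dp1 {y. x @ [y] \<in> S e}" if "length x = m" for x e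
    unfolding dp1_def mem_Collect_eq by (intro S dl_snoc dl_const that dintros)
  have inf: "x \<in> inf_last (S e) \<longleftrightarrow> (\<exists>a b. a < b \<and> (\<forall>y. a < y \<and> y < b \<longrightarrow> x @ [y] \<in> S e))"
    if "length x = m" for x e
    unfolding inf_last_def mem_Collect_eq infinite_iff_dp1[OF sec[OF that]] ..
  have "dp (\<lambda>e. dge m k (proj_last (S e)))" for k
    by (rule Suc.IH) (unfold proj_last_def mem_Collect_eq, intro S qintros)
  moreover have "dp (\<lambda>e. dge m k (inf_last (S e)))" for k
  proof (rule Suc.IH)
    have "dp (\<lambda>e. \<exists>a b. a < b \<and> (\<forall>y. a < y \<and> y < b \<longrightarrow>
        map e [0..<m] @ [y] \<in> S (\<lambda>i. e (m + i))))"
      by (intro S qintros)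
    then show "dp (\<lambda>e. map e [0..<m] \<in> inf_last (S (\<lambda>i. e (m + i))))" by (simp add: inf)
  qed
  ultimately show ?case by (cases k) (simp_all add: dp_disj)
qed

lemma dset_proj_last:
  assumes S: "dset (Suc m) S" shows "dset m (proj_last S)"
  unfolding dset_def proj_last_def mem_Collect_eq by (intro qintros dp_mem[OF S])

lemma inf_last_iff:
  assumes S: "dset (Suc m) S" and "length x = m"
  shows "x \<in> inf_last S \<longleftrightarrow> (\<exists>a b. a < b \<and> (\<forall>y. a < y \<and> y < b \<longrightarrow> x @ [y] \<in> S))"
proof -
  have "dp1 {y. x @ [y] \<in> S}"
    unfolding dp1_def mem_Collect_eq by (intro dp_mem[OF S] dl_snoc dl_const assms dintros)
  from infinite_iff_dp1[OF this] show ?thesis by (simp add: inf_last_def)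
qed

lemma dset_inf_last:
  assumes S: "dset (Suc m) S" shows "dset m (inf_last S)"
proof -
  have "dp (\<lambda>e. \<exists>a b. a < b \<and> (\<forall>y. a < y \<and> y < b \<longrightarrow> map e [0..<m] @ [y] \<in> S))"
    by (intro qintros dp_mem[OF S])
  then show ?thesis by (simp add: dset_def inf_last_iff[OF S])
qed

text \<open>The substitute for additivity of dimension. Projecting away a coordinate can make the
  multiplicity of a point infinite, and the proof turns on what happens at such points.\<close>

lemma dge_finite_to_one:
  assumes "dfam m C" and "\<And>x. length x = m \<Longrightarrow> finite {t. x \<in> C t}"
    and "infinite {t. dge m k (C t)}"
  shows "dge m (Suc k) (\<Union>t. C t)"
  using assms
proof (induction m arbitrary: k C)
  case 0
  have "{t. dge 0 k (C t)} \<subseteq> {t. [] \<in> C t}" by auto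
  then show ?case using 0 finite_subset by fastforce
next
  case (Suc m)
  note C = Suc.prems(1) and fin = Suc.prems(2)
  have sec: "dp (\<lambda>e. x @ [e 1] \<in> C (e 0))" if "length x = m" for x
    by (intro dp_fam[OF C] dl_snoc dl_const that dintros)
  have "{t. dge (Suc m) k (C t)} = {t. dge m k (proj_last (C t))} \<union>
      {t. \<exists>k'. k = Suc k' \<and> dge m k' (inf_last (C t))}" by auto
  then have "infinite {t. dge m k (proj_last (C t))} \<or>
      infinite {t. \<exists>k'. k = Suc k' \<and> dge m k' (inf_last (C t))}"
    using Suc.prems(3) by simp
  then show ?case
  proof
    assume 1: "infinite {t. dge m k (proj_last (C t))}"
    \<comment> \<open>Points covered infinitely often after projection. Away from \<open>B\<close>
      the induction hypothesis applies; over a point of \<open>B\<close> the fibre of the union is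
      infinite, since each point of that fibre lies in only finitely many
      \<open>C t\<close>.\<close>
    define B where "B = {x. infinite {t. x \<in> proj_last (C t)}}"
    define E where "E t = proj_last (C t) - B" for t
    have dproj: "dp1 {t. x \<in> proj_last (C t)}" if "length x = m" for x
      unfolding dp1_def proj_last_def mem_Collect_eq
      by (intro dp_fam[OF C] dl_snoc dl_const that qintros)
    have B: "x \<in> B \<longleftrightarrow> (\<exists>a b. a < b \<and> (\<forall>t. a < t \<and> t < b \<longrightarrow> (\<exists>y. x @ [y] \<in> C t)))"
      if "length x = m" for x
      unfolding B_def mem_Collect_eq infinite_iff_dp1[OF dproj[OF that]]
        by (simp add: proj_last_def)
    have dE: "dfam m E"
    proof -
      have "dp (\<lambda>e. (\<exists>y. map (\<lambda>i. e (Suc i)) [0..<m] @ [y] \<in> C (e 0)) \<and>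
        \<not> (\<exists>a b. a < b \<and> (\<forall>t. a < t \<and> t < b \<longrightarrow> (\<exists>y. map (\<lambda>i. e (Suc i)) [0..<m] @ [y] \<in> C t))))"
        by (intro dp_fam[OF C] qintros)
      then show ?thesis by (simp add: dfam_def E_def B) (simp add: proj_last_def)
    qed
    show ?thesis
    proof (cases "infinite {t. dge m k (E t)}")
      case True
      have "dge m (Suc k) (\<Union>t. E t)"
      proof (rule Suc.IH[OF dE _ True])
        fix x show "finite {t. x \<in> E t}" by (cases "x \<in> B") (auto simp: E_def B_def)
      qed
      then have "dge m (Suc k) (proj_last (\<Union>t. C t))"
        by (rule dge_mono) (auto simp: E_def proj_last_def)
      then show ?thesis by simp
    next
      case False
      then have "infinite ({t. dge m k (proj_last (C t))} - {t. dge m k (E t)})" using 1 by simp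
      then obtain t where t: "dge m k (proj_last (C t))" "\<not> dge m k (E t)"
        by (force dest: infinite_imp_nonempty)
      then have "dge m k B" unfolding E_def by (rule dge_Diff)
      then have "dge m k (inf_last (\<Union>t. C t))"
      proof (rule dge_mono)
        fix x assume x: "length x = m" "x \<in> B"
        show "x \<in> inf_last (\<Union>t. C t)"
        proof (rule ccontr)
          assume "x \<notin> inf_last (\<Union>t. C t)"
          then have "finite {y. x @ [y] \<in> (\<Union>t. C t)}" by (simp add: inf_last_def)
          then have "finite (\<Union>y\<in>{y. x @ [y] \<in> (\<Union>t. C t)}. {t. x @ [y] \<in> C t})"
            using fin x by simp
          moreover have "{t. x \<in> proj_last (C t)} \<subseteq> (\<Union>y\<in>{y. x @ [y] \<in> (\<Union>t. C t)}. {t. x @ [y] \<in> C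
            t})"
            by (auto simp: proj_last_def)
          ultimately show False using x finite_subset by (auto simp: B_def)
        qed
      qed
      then show ?thesis by simp
    qed
  next
    assume "infinite {t. \<exists>k'. k = Suc k' \<and> dge m k' (inf_last (C t))}"
    then obtain k' where k': "k = Suc k'" and inf: "infinite {t. dge m k' (inf_last (C t))}"
      by (cases k) auto
    \<comment> \<open>The sets \<open>inf_last (C t)\<close> again have finite multiplicity: for
      fixed \<open>x\<close> this is \<open>finite_to_one_plane\<close> for the relation
      \<open>x @ [s] \<in> C t\<close>.\<close>
    have "dge m (Suc k') (\<Union>t. inf_last (C t))"
    proof (rule Suc.IH[OF _ _ inf])
      have dsec: "dp1 {y. x @ [y] \<in> C t}" if "length x = m" for x t
        unfolding dp1_def mem_Collect_eq by (intro dp_fam[OF C] dl_snoc dl_const that qintros)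
      have iff: "x \<in> inf_last (C t) \<longleftrightarrow> (\<exists>a b. a < b \<and> (\<forall>y. a < y \<and> y < b \<longrightarrow> x @ [y] \<in> C t))"
        if "length x = m" for x t
        unfolding inf_last_def mem_Collect_eq infinite_iff_dp1[OF dsec[OF that]] ..
      have "dp (\<lambda>e. \<exists>a b. a < b \<and> (\<forall>y. a < y \<and> y < b \<longrightarrow>
           map (\<lambda>i. e (Suc i)) [0..<m] @ [y] \<in> C (e 0)))"
        by (intro dp_fam[OF C] qintros)
      then show "dfam m (\<lambda>t. inf_last (C t))" by (simp add: dfam_def iff)
      fix x :: "'m list" assume x: "length x = m"
      then show "finite {t. x \<in> inf_last (C t)}"
        unfolding inf_last_def mem_Collect_eq
        by (intro finite_to_one_plane sec fin) simp_all
    qed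
    then have "dge m (Suc k') (inf_last (\<Union>t. C t))"
    proof (rule dge_mono)
      fix x assume "x \<in> (\<Union>t. inf_last (C t))"
      then obtain t where "infinite {y. x @ [y] \<in> C t}" by (auto simp: inf_last_def)
      moreover have "{y. x @ [y] \<in> C t} \<subseteq> {y. x @ [y] \<in> (\<Union>t. C t)}" by auto
      ultimately show "x \<in> inf_last (\<Union>t. C t)" unfolding inf_last_def using finite_subset by blast
    qed
    then show ?thesis using k' by simp
  qed
qed

end

section \<open>Boxes and generic continuity\<close>

lemma list_all2_snoc [simp]: "list_all2 P (a @ [c]) (x @ [y]) \<longleftrightarrow> list_all2 P a x \<and> P c y"
  using list_all2_rev[of P "a @ [c]" "x @ [y]"] by auto

definition obox :: "'a::linorder list \<Rightarrow> 'a list \<Rightarrow> 'a list set" where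
  "obox a b = {x. list_all2 (<) a x \<and> list_all2 (<) x b}"

lemma box_Nil [simp]: "obox [] [] = {[]}"
  by (auto simp: obox_def)

lemma box_Cons [simp]: "y # x \<in> obox (c # a) (d # b) \<longleftrightarrow> c < y \<and> y < d \<and> x \<in> obox a b"
  by (auto simp: obox_def)

lemma box_snoc [simp]: "x @ [y] \<in> obox (a @ [c]) (b @ [d]) \<longleftrightarrow> x \<in> obox a b \<and> c < y \<and> y < d"
  by (auto simp: obox_def)

lemma length_box: "x \<in> obox a b \<Longrightarrow> length x = length a"
  by (auto simp: obox_def dest: list_all2_lengthD)

lemma box_snocE:
  assumes "z \<in> obox (a @ [c]) (b @ [d])"
  obtains x y where "z = x @ [y]" "x \<in> obox a b" "c < y" "y < d"
proof -
  have "z \<noteq> []" using length_box[OF assms] by auto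
  then have "z = butlast z @ [last z]" by simp
  then show ?thesis using that box_snoc assms by metis
qed

lemma mem_box_less: "x \<in> obox a b \<Longrightarrow> list_all2 (<) a b"
  unfolding obox_def by (auto intro: list_all2_trans[of "(<)" "(<)" "(<)" a x b])

lemma box_nonempty:
  fixes a :: "'a::dense_linorder list"
  assumes "list_all2 (<) a b" shows "\<exists>x. x \<in> obox a b"
  using assms
proof (induction rule: list_all2_induct)
  case (Cons a as b bs)
  then show ?case using dense[of a b] box_Cons by blast
qed auto

lemma box_inter:
  fixes x :: "'a::linorder list"
  assumes "x \<in> obox a b" "x \<in> obox a' b'"
  obtains a'' b'' where "x \<in> obox a'' b''" "obox a'' b'' \<subseteq> obox a b" "obox a'' b'' \<subseteq> obox a' b'"
proof
  have len: "length a = length x" "length b = length x" "length a' = length x" "length b' = length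
    x"
    using assms by (auto simp: obox_def dest: list_all2_lengthD)
  have max: "list_all2 (<) (map2 max a a') y \<longleftrightarrow> list_all2 (<) a y \<and> list_all2 (<) a' y"
    if "length a = length a'" for a a' y :: "'a list"
    using that
  proof (induction a a' arbitrary: y rule: list_induct2)
    case (Cons a as a' as')
    then show ?case by (cases y) auto
  qed auto
  have min: "list_all2 (<) y (map2 min b b') \<longleftrightarrow> list_all2 (<) y b \<and> list_all2 (<) y b'"
    if "length b = length b'" for b b' y :: "'a list"
    using that
  proof (induction b b' arbitrary: y rule: list_induct2)
    case (Cons b bs b' bs')
    then show ?case by (cases y) auto
  qed auto
  have *: "y \<in> obox (map2 max a a') (map2 min b b') \<longleftrightarrow> y \<in> obox a b \<and> y \<in> obox a' b'" for y
    using len max[of a a' y] min[of b b' y] unfolding obox_def by auto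
  show "x \<in> obox (map2 max a a') (map2 min b b')" using * assms by blast
  show "obox (map2 max a a') (map2 min b b') \<subseteq> obox a b" "obox (map2 max a a') (map2 min b b') \<subseteq>
    obox a' b'"
    using * by blast+
qed

lemma list_all2_snocE:
  assumes "list_all2 P a b" "length a = Suc m"
  obtains a' c b' d where "a = a' @ [c]" "b = b' @ [d]" "length a' = m" "length b' = m"
    "list_all2 P a' b'" "P c d"
proof -
  have "length b = Suc m" using assms list_all2_lengthD by metis
  then obtain b' d where b: "b = b' @ [d]" "length b' = m" by (auto simp: length_Suc_conv_rev)
  obtain a' c where a: "a = a' @ [c]" "length a' = m"
    using assms(2) by (auto simp: length_Suc_conv_rev)
  show ?thesis using that[OF a(1) b(1) a(2) b(2)] assms(1) unfolding a b by simp
qed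

lemma dge_box:
  fixes a :: "'a::unbounded_dense_linorder list"
  shows "length a = m \<Longrightarrow> list_all2 (<) a b \<Longrightarrow> dge m m (obox a b)"
proof (induction m arbitrary: a b)
  case (Suc m)
  obtain a' c b' d where ab: "a = a' @ [c]" "b = b' @ [d]" "length a' = m" "length b' = m"
    "list_all2 (<) a' b'" "c < d" using list_all2_snocE Suc.prems(2,1) by metis
  have "dge m m (obox a' b')" using Suc.IH ab by blast
  then have "dge m m (inf_last (obox a b))"
  proof (rule dge_mono)
    fix x assume "x \<in> obox a' b'"
    then have "{y. x @ [y] \<in> obox a b} = {c<..<d}" by (auto simp: ab)
    then show "x \<in> inf_last (obox a b)" using infinite_Ioo[OF ab(6)] by (simp add: inf_last_def)
  qed
  then show ?case by simp
qed auto

text \<open>All quantifiers over tuples are bounded by a length, in the shape that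
  \<open>dp_exl\<close> and \<open>dp_alll\<close> accept. \<open>lcontD\<close> and
  \<open>lcontI\<close> restore the usual form.\<close>

definition lcont :: "nat \<Rightarrow> ('a::linorder list \<Rightarrow> 'a) \<Rightarrow> 'a list \<Rightarrow> bool" where
  "lcont m f x \<longleftrightarrow> (\<forall>c d. c < f x \<and> f x < d \<longrightarrow>
     (\<exists>a. length a = m \<and> (\<exists>b. length b = m \<and> x \<in> obox a b \<and>
        (\<forall>y. length y = m \<longrightarrow> y \<in> obox a b \<longrightarrow> c < f y \<and> f y < d))))"

lemma lcontD:
  assumes "lcont m f x" "c < f x" "f x < d"
  obtains a b where "x \<in> obox a b" "\<And>y. y \<in> obox a b \<Longrightarrow> c < f y \<and> f y < d"
  using assms length_box unfolding lcont_def by metis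

lemma lcontI:
  assumes "length x = m"
    and "\<And>c d. c < f x \<Longrightarrow> f x < d \<Longrightarrow> \<exists>a b. x \<in> obox a b \<and> (\<forall>y. y \<in> obox a b \<longrightarrow> c < f y \<and> f y < d)"
  shows "lcont m f x"
  unfolding lcont_def
proof (intro allI impI)
  fix c d assume "c < f x \<and> f x < d"
  then obtain a b where ab: "x \<in> obox a b" "\<And>y. y \<in> obox a b \<Longrightarrow> c < f y \<and> f y < d"
    using assms(2) by metis
  moreover have "length a = m" "length b = m"
    using length_box[OF ab(1)] list_all2_lengthD[OF mem_box_less[OF ab(1)]] assms(1) by auto
  ultimately show "\<exists>a. length a = m \<and> (\<exists>b. length b = m \<and> x \<in> obox a b \<and>
        (\<forall>y. length y = m \<longrightarrow> y \<in> obox a b \<longrightarrow> c < f y \<and> f y < d))" by blast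
qed

context o_minimal_structure
begin

lemma dp_box:
  assumes "dl m A" "dl m B" "dl m L" shows "dp (\<lambda>e. L e \<in> obox (A e) (B e))"
proof -
  have "dp (\<lambda>e. \<forall>i<m. A e ! i < L e ! i \<and> L e ! i < B e ! i)"
    using assms by (intro dp_ball_less dintros dl_nth)
  moreover have "L e \<in> obox (A e) (B e) \<longleftrightarrow> (\<forall>i<m. A e ! i < L e ! i \<and> L e ! i < B e ! i)" for e
    using assms by (auto simp: obox_def list_all2_conv_all_nth dl_def)
  ultimately show ?thesis by simp
qed

lemma dset_box: "length a = m \<Longrightarrow> length b = m \<Longrightarrow> dset m (obox a b)"
  unfolding dset_def by (intro dp_box[where m = m] dl_const dintros)

lemma dp_lcont:
  assumes f: "\<And>L g. dl m L \<Longrightarrow> (\<And>i. df (\<lambda>e. g e i)) \<Longrightarrow> df (\<lambda>e. F (g e) (L e))"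
    and L: "dl m L"
  shows "dp (\<lambda>e. lcont m (F e) (L e))"
proof -
  have "dp (\<lambda>e. lcont m (F (\<lambda>i. e (m + i))) (map e [0..<m]))"
    unfolding lcont_def by (intro qintros f dp_box[where m = m])
  then have "dp (\<lambda>e. (\<lambda>x e. lcont m (F e) x) (L e) e)"
    by (rule dp_list_comp) (intro L df_var)+
  then show ?thesis .
qed

lemma locally_const_imp_const:
  assumes f: "df1 f"
    and lc: "\<And>x. a < x \<Longrightarrow> x < b \<Longrightarrow> loc_const f x"
    and xy: "a < x" "x < y" "y < b"
  shows "f x = f y"
proof -
  let ?S = "{z. x \<le> z \<and> z \<le> y \<and> (\<forall>w. x \<le> w \<and> w \<le> z \<longrightarrow> f w = f x)}"
  have S: "dp1 ?S" unfolding dp1_def mem_Collect_eq by (intro qintros df_app1[OF f])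
  define s where "s = lub ?S"
  have s: "is_lub ?S s" unfolding s_def by (rule is_lub_dp1[OF S, of x y]) (use xy in auto)
  have "x \<in> ?S" using xy by auto
  then have "x \<le> s" using s unfolding is_lub_def by blast
  have "s \<le> y" using s unfolding is_lub_def by auto
  have below: "f w = f x" if w: "x \<le> w" "w < s" for w
  proof -
    have "\<not> (\<forall>z. z \<in> ?S \<longrightarrow> z \<le> w)" using s w unfolding is_lub_def by (blast dest: leD)
    then obtain z where z: "z \<in> ?S" "w < z" by (auto simp only: not_all not_imp not_le)
    from z(1) have "\<forall>w. x \<le> w \<and> w \<le> z \<longrightarrow> f w = f x" by blast
    then show ?thesis using w z(2) less_imp_le by blast
  qed
  have "loc_const f s" using lc \<open>x \<le> s\<close> \<open>s \<le> y\<close> xy by auto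
  then obtain u v where uv: "u < s" "s < v" "\<And>w. u < w \<Longrightarrow> w < v \<Longrightarrow> f w = f s"
    unfolding loc_const_def by blast
  have fs: "f s = f x"
  proof (cases "x = s")
    case False
    then have "max u x < s" using uv \<open>x \<le> s\<close> by auto
    then obtain w where "max u x < w" "w < s" using dense by blast
    then have "x \<le> w" "u < w" "w < v" "w < s" using uv(2) by auto
    then show ?thesis using below uv(3) by metis
  qed simp
  show ?thesis
  proof (cases "s = y")
    case True
    then show ?thesis using fs by simp
  next
    case False
    then have "s < min v y" using uv \<open>s \<le> y\<close> by auto
    then obtain w where w: "s < w" "w < min v y" using dense by blast
    have "f z = f x" if "x \<le> z" "z \<le> w" for z
    proof (cases "z < s")
      case True
      with that(1) show ?thesis by (rule below)
    next
      case False
      then have "u < z" "z < v" using uv(1) w that by auto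
      then have "f z = f s" by (rule uv(3))
      then show ?thesis using fs by (rule trans)
    qed
    moreover have "x \<le> w" "w \<le> y" using w \<open>x \<le> s\<close> by auto
    ultimately have "w \<in> ?S" by blast
    then have "w \<le> s" using s unfolding is_lub_def by blast
    then show ?thesis using w by simp
  qed
qed

text \<open>The next two properties are proved by simultaneous induction on \<open>m\<close>.\<close>

definition box_property :: "nat \<Rightarrow> bool" where
  "box_property m \<longleftrightarrow> (\<forall>S. dset m S \<longrightarrow> dge m m S \<longrightarrow>
     (\<exists>a b. length a = m \<and> length b = m \<and> list_all2 (<) a b \<and> obox a b \<subseteq> S))"

definition continuity_property :: "nat \<Rightarrow> bool" where
  "continuity_property m \<longleftrightarrow> (\<forall>f a b. dfl m f \<longrightarrow> length a = m \<longrightarrow> list_all2 (<) a b \<longrightarrow>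
     (\<exists>x\<in>obox a b. lcont m f x))"

lemma dset_Int: "dset m A \<Longrightarrow> dset m B \<Longrightarrow> dset m (A \<inter> B)"
  by (simp add: dset_def dp_conj)

lemma dset_Diff: "dset m A \<Longrightarrow> dset m B \<Longrightarrow> dset m (A - B)"
  by (simp add: dset_def dp_conj dp_neg)

lemma dset_lcont:
  assumes f: "dfl m f" shows "dset m {x. lcont m f x}"
  unfolding dset_def mem_Collect_eq
  by (rule dp_lcont[where F = "\<lambda>e. f"], erule df_app[OF f], intro dintros)

text \<open>One of the continuity points and the discontinuity points has full dimension and so
  contains a box; for the latter this contradicts the existence of a continuity point in every
  box.\<close>

lemma continuity_on_box:
  assumes "box_property m" "continuity_property m" and f: "dfl m f"
    and ab: "length a = m" "list_all2 (<) a b"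
  obtains a' b' where "length a' = m" "length b' = m" "list_all2 (<) a' b'" "obox a' b' \<subseteq> obox a b"
    "\<And>x. x \<in> obox a' b' \<Longrightarrow> lcont m f x"
proof -
  let ?A = "obox a b \<inter> {x. lcont m f x}" and ?B = "obox a b - {x. lcont m f x}"
  have len: "length b = m" using ab list_all2_lengthD by metis
  have "dge m m (?A \<union> ?B)" using dge_box[OF ab] by (rule dge_mono) blast
  then consider "dge m m ?A" | "dge m m ?B" using dge_Un by blast
  then show ?thesis
  proof cases
    case 1
    moreover have "dset m ?A" by (intro dset_Int dset_box dset_lcont f ab len)
    ultimately obtain a' b' where "length a' = m" "length b' = m" "list_all2 (<) a' b'" "obox a' b'
      \<subseteq> ?A"
      using assms(1) unfolding box_property_def by blast
    then show ?thesis using that[of a' b'] by blast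
  next
    case 2
    moreover have "dset m ?B" by (intro dset_Diff dset_box dset_lcont f ab len)
    ultimately obtain a' b' where *: "length a' = m" "list_all2 (<) a' b'" "obox a' b' \<subseteq> ?B"
      using assms(1) unfolding box_property_def by blast
    then obtain x where "x \<in> obox a' b'" "lcont m f x"
      using assms(2) f unfolding continuity_property_def by blast
    then show ?thesis using * by blast
  qed
qed

lemma choose_interval:
  assumes S: "dset (Suc m) S"
  obtains l u where "dfl m l" "dfl m u"
    "\<And>x. length x = m \<Longrightarrow> x \<in> inf_last S \<Longrightarrow> l x < u x"
    "\<And>x y. length x = m \<Longrightarrow> x \<in> inf_last S \<Longrightarrow> l x < y \<Longrightarrow> y < u x \<Longrightarrow> x @ [y] \<in> S"
proof -
  define l where "l x = ch {c. \<exists>d. c < d \<and> (\<forall>y. c < y \<and> y < d \<longrightarrow> x @ [y] \<in> S)}" for x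
  \<comment> \<open>The left end point is chosen first, with the sole demand that some right end
    point fits; the right one is then chosen relative to it. So a pair is obtained from
    one-dimensional choices.\<close>
  define u where "u x = ch {d. l x < d \<and> (\<forall>y. l x < y \<and> y < d \<longrightarrow> x @ [y] \<in> S)}" for x
  have l: "dfl m l" unfolding dfl_def l_def by (intro df_ch qintros dp_mem[OF S])
  have u: "dfl m u" unfolding dfl_def u_def by (intro df_ch qintros dp_mem[OF S] df_app[OF l])
  have *: "l x < u x \<and> (\<forall>y. l x < y \<and> y < u x \<longrightarrow> x @ [y] \<in> S)"
    if x: "length x = m" "x \<in> inf_last S" for x
  proof -
    note xl = dl_const[OF x(1)]
    obtain c d where cd: "c < d" "\<And>y. c < y \<and> y < d \<Longrightarrow> x @ [y] \<in> S"
      using x inf_last_iff[OF S x(1)] by blast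
    have "dp1 {c. \<exists>d. c < d \<and> (\<forall>y. c < y \<and> y < d \<longrightarrow> x @ [y] \<in> S)}"
      unfolding dp1_def mem_Collect_eq by (intro qintros dp_mem[OF S] xl)
    then have "l x \<in> {c. \<exists>d. c < d \<and> (\<forall>y. c < y \<and> y < d \<longrightarrow> x @ [y] \<in> S)}"
      unfolding l_def by (rule ch_mem[of _ c]) (use cd in blast)
    then obtain d where d: "l x < d" "\<And>y. l x < y \<and> y < d \<Longrightarrow> x @ [y] \<in> S" by blast
    have "dp1 {d. l x < d \<and> (\<forall>y. l x < y \<and> y < d \<longrightarrow> x @ [y] \<in> S)}"
      unfolding dp1_def mem_Collect_eq by (intro qintros dp_mem[OF S] xl)
    then have "u x \<in> {d. l x < d \<and> (\<forall>y. l x < y \<and> y < d \<longrightarrow> x @ [y] \<in> S)}"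
      unfolding u_def by (rule ch_mem[of _ d]) (use d in blast)
    then show ?thesis by blast
  qed
  show ?thesis by (rule that[OF l u]) (use * in blast)+
qed

text \<open>Constants \<open>c < d\<close> strictly between the values of \<open>l\<close> and
  \<open>u\<close> at one common continuity point stay between them nearby. Curved walls are thereby
  replaced by constant ones. The outer bounds \<open>m1\<close> and \<open>m2\<close> only fill the
  two-sided form of \<open>lcont\<close>.\<close>

lemma separate_on_box:
  assumes "box_property m" "continuity_property m" and l: "dfl m l" and u: "dfl m u"
    and ab: "length a = m" "list_all2 (<) a b" and less: "\<And>x. x \<in> obox a b \<Longrightarrow> l x < u x"
  obtains a' b' c d where "length a' = m" "length b' = m" "list_all2 (<) a' b'" "obox a' b' \<subseteq> obox a
    b"
    "c < d" "\<And>x. x \<in> obox a' b' \<Longrightarrow> l x < c \<and> d < u x"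
proof -
  obtain a1 b1 where 1: "length a1 = m" "length b1 = m" "list_all2 (<) a1 b1" "obox a1 b1 \<subseteq> obox a
    b"
    "\<And>x. x \<in> obox a1 b1 \<Longrightarrow> lcont m l x" using continuity_on_box[OF assms(1,2) l ab] by metis
  obtain a2 b2 where 2: "length a2 = m" "length b2 = m" "list_all2 (<) a2 b2" "obox a2 b2 \<subseteq> obox a1
    b1"
    "\<And>x. x \<in> obox a2 b2 \<Longrightarrow> lcont m u x" using continuity_on_box[OF assms(1,2) u 1(1,3)] by metis
  obtain x where x: "x \<in> obox a2 b2" using box_nonempty[OF 2(3)] by blast
  have "l x < u x" using x 1 2 less by blast
  then obtain c where c: "l x < c" "c < u x" using dense by blast
  obtain d where d: "c < d" "d < u x" using dense[OF c(2)] by blast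
  obtain m1 where "m1 < l x" using lt_ex by blast
  then obtain a3 b3 where 3: "x \<in> obox a3 b3" "\<And>y. y \<in> obox a3 b3 \<Longrightarrow> m1 < l y \<and> l y < c"
    using lcontD[of m l x m1 c] 1 2 x c by blast
  obtain m2 where "u x < m2" using gt_ex by blast
  then obtain a4 b4 where 4: "x \<in> obox a4 b4" "\<And>y. y \<in> obox a4 b4 \<Longrightarrow> d < u y \<and> u y < m2"
    using lcontD[of m u x d m2] 2 x d by blast
  obtain a5 b5 where 5: "x \<in> obox a5 b5" "obox a5 b5 \<subseteq> obox a3 b3" "obox a5 b5 \<subseteq> obox a4 b4"
    using box_inter[OF 3(1) 4(1)] by blast
  obtain a6 b6 where 6: "x \<in> obox a6 b6" "obox a6 b6 \<subseteq> obox a5 b5" "obox a6 b6 \<subseteq> obox a2 b2"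
    using box_inter[OF 5(1) x] by blast
  have len: "length a6 = m" "length b6 = m"
    using length_box[OF 6(1)] length_box[OF x] 2(1) list_all2_lengthD[OF mem_box_less[OF 6(1)]]
      by auto
  show ?thesis
  proof (rule that[OF len mem_box_less[OF 6(1)] _ d(1)])
    show "obox a6 b6 \<subseteq> obox a b" using 1(4) 2(4) 6(3) by (meson subset_trans)
    fix y assume "y \<in> obox a6 b6"
    then have "y \<in> obox a3 b3" "y \<in> obox a4 b4" using 5 6 by (meson subsetD)+
    then show "l y < c \<and> d < u y" using 3(2) 4(2) by (meson)
  qed
qed

lemma box_property_Suc:
  assumes "box_property m" "continuity_property m"
  shows "box_property (Suc m)"
  unfolding box_property_def
proof (intro allI impI)
  fix S assume S: "dset (Suc m) S" and "dge (Suc m) (Suc m) S"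
  then have "dge m m (inf_last S)" using dge_le[of m "Suc m"] by auto
  then obtain a b where ab: "length a = m" "list_all2 (<) a b" "obox a b \<subseteq> inf_last S"
    using assms(1) dset_inf_last[OF S] unfolding box_property_def by blast
  obtain l u where lu: "dfl m l" "dfl m u" "\<And>x. length x = m \<Longrightarrow> x \<in> inf_last S \<Longrightarrow> l x < u x"
    "\<And>x y. length x = m \<Longrightarrow> x \<in> inf_last S \<Longrightarrow> l x < y \<Longrightarrow> y < u x \<Longrightarrow> x @ [y] \<in> S"
    using choose_interval[OF S] by metis
  have "l x < u x" if "x \<in> obox a b" for x using lu(3) that ab length_box by blast
  then obtain a' b' c d where *: "length a' = m" "length b' = m" "list_all2 (<) a' b'" "obox a' b' \<subseteq>
    obox a b"
    "c < d" "\<And>x. x \<in> obox a' b' \<Longrightarrow> l x < c \<and> d < u x"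
    using separate_on_box[OF assms lu(1,2) ab(1,2)] by metis
  have "obox (a' @ [c]) (b' @ [d]) \<subseteq> S"
  proof
    fix z assume "z \<in> obox (a' @ [c]) (b' @ [d])"
    then obtain x y where z: "z = x @ [y]" "x \<in> obox a' b'" "c < y" "y < d" by (rule box_snocE)
    then show "z \<in> S" using lu(4)[of x y] *(6)[OF z(2)] *(4) ab length_box[OF z(2)] *(1)
      by (auto intro: less_trans)
  qed
  then show "\<exists>a b. length a = Suc m \<and> length b = Suc m \<and> list_all2 (<) a b \<and> obox a b \<subseteq> S"
    using * by (intro exI[of _ "a' @ [c]"] exI[of _ "b' @ [d]"]) simp
qed

text \<open>Separate continuity does not suffice for joint continuity; what closes the gap is
  \<open>between\<close>. Control of \<open>f\<close> on the two faces at heights \<open>r1\<close>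
  and \<open>r2\<close> bounds it on everything in between.\<close>

lemma lcont_snoc:
  fixes f :: "'m list \<Rightarrow> 'm"
  assumes x: "x \<in> obox a b" and r: "\<alpha> < r" "r < \<beta>" and m: "length x = m"
    and c1: "cont1 (\<lambda>s. f (x @ [s])) r"
    and lc: "\<And>s. \<alpha> < s \<Longrightarrow> s < \<beta> \<Longrightarrow> lcont m (\<lambda>x. f (x @ [s])) x"
    and between: "\<And>y s t u c d. y \<in> obox a b \<Longrightarrow> \<alpha> < s \<Longrightarrow> s < t \<Longrightarrow> t < u \<Longrightarrow> u < \<beta> \<Longrightarrow>
       c < f (y @ [s]) \<Longrightarrow> c < f (y @ [u]) \<Longrightarrow> f (y @ [s]) < d \<Longrightarrow> f (y @ [u]) < d \<Longrightarrow>
       c < f (y @ [t]) \<and> f (y @ [t]) < d"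
  shows "lcont (Suc m) f (x @ [r])"
proof (rule lcontI)
  fix c d assume cd: "c < f (x @ [r])" "f (x @ [r]) < d"
  then obtain u v where uv: "u < r" "r < v" "\<And>s. u < s \<Longrightarrow> s < v \<Longrightarrow> c < f (x @ [s]) \<and> f (x @ [s]) < d"
    using c1 unfolding cont1_def by blast
  obtain r1 where r1: "max u \<alpha> < r1" "r1 < r" using dense[of "max u \<alpha>" r] uv r by auto
  obtain r2 where r2: "r < r2" "r2 < min v \<beta>" using dense[of r "min v \<beta>"] uv r by auto
  have 1: "c < f (x @ [r1])" "f (x @ [r1]) < d" using uv(3)[of r1] uv(2) r1 by auto
  have 2: "c < f (x @ [r2])" "f (x @ [r2]) < d" using uv(3)[of r2] uv(1) r2 by auto
  have "lcont m (\<lambda>x. f (x @ [r1])) x" "lcont m (\<lambda>x. f (x @ [r2])) x" using lc r1 r2 r by auto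
  then obtain a1 b1 a2 b2 where
    b1: "x \<in> obox a1 b1" "\<And>y. y \<in> obox a1 b1 \<Longrightarrow> c < f (y @ [r1]) \<and> f (y @ [r1]) < d" and
    b2: "x \<in> obox a2 b2" "\<And>y. y \<in> obox a2 b2 \<Longrightarrow> c < f (y @ [r2]) \<and> f (y @ [r2]) < d"
    using lcontD[of m "\<lambda>x. f (x @ [r1])" x c d] lcontD[of m "\<lambda>x. f (x @ [r2])" x c d] 1 2 by metis
  obtain a3 b3 where b3: "x \<in> obox a3 b3" "obox a3 b3 \<subseteq> obox a1 b1" "obox a3 b3 \<subseteq> obox a2 b2"
    using box_inter[OF b1(1) b2(1)] by blast
  obtain a4 b4 where b4: "x \<in> obox a4 b4" "obox a4 b4 \<subseteq> obox a3 b3" "obox a4 b4 \<subseteq> obox a b"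
    using box_inter[OF b3(1) x] by blast
  have "c < f z \<and> f z < d" if "z \<in> obox (a4 @ [r1]) (b4 @ [r2])" for z
  proof -
    obtain y t where z: "z = y @ [t]" "y \<in> obox a4 b4" "r1 < t" "t < r2"
      using box_snocE[OF \<open>z \<in> obox (a4 @ [r1]) (b4 @ [r2])\<close>] by metis
    show ?thesis unfolding z(1)
      by (rule between[of y r1 t r2]) (use z b1(2)[of y] b2(2)[of y] b3 b4 r1 r2 in auto)
  qed
  then show "\<exists>a b. x @ [r] \<in> obox a b \<and> (\<forall>y. y \<in> obox a b \<longrightarrow> c < f y \<and> f y < d)"
    using b4 r1 r2 by (intro exI[of _ "a4 @ [r1]"] exI[of _ "b4 @ [r2]"]) auto
qed (use m in simp)

text \<open>Points where \<open>f\<close> is not nice in the last variable, or not continuous in the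
  first \<open>m\<close>, do not have full dimension. So one of the three kinds of nice behaviour
  holds, together with continuity in the first \<open>m\<close> variables, on a whole box, and
  \<open>lcont_snoc\<close> applies there.\<close>

lemma continuity_property_Suc:
  assumes B: "box_property (Suc m)" and C: "continuity_property m"
  shows "continuity_property (Suc m)"
  unfolding continuity_property_def
proof (intro allI impI)
  fix f and a b :: "'m list"
  assume f: "dfl (Suc m) f" and len: "length a = Suc m" and ab: "list_all2 (<) a b"
  have lenb: "length b = Suc m" using list_all2_lengthD[OF ab] len by simp
  have fr: "dfl m (\<lambda>x. f (x @ [r]))" for r
    unfolding dfl_def by (intro df_app[OF f] dintros)
  have fx: "df1 (\<lambda>s. f (x @ [s]))" if "length x = m" for x
    unfolding df1_def by (intro df_app[OF f] dintros dl_const that)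
  define W where "W P = {z. \<exists>x. length x = m \<and> (\<exists>r. z = x @ [r] \<and> P (\<lambda>s. f (x @ [s])) r)}"
    for P :: "('m \<Rightarrow> 'm) \<Rightarrow> 'm \<Rightarrow> bool"
  define L where "L = {z. \<exists>x. length x = m \<and> (\<exists>r. z = x @ [r] \<and> lcont m (\<lambda>x. f (x @ [r])) x)}"
  have W: "x @ [r] \<in> W P \<longleftrightarrow> length x = m \<and> P (\<lambda>s. f (x @ [s])) r" for x r P
    by (auto simp: W_def)
  have L: "x @ [r] \<in> L \<longleftrightarrow> length x = m \<and> lcont m (\<lambda>x. f (x @ [r])) x" for x r
    by (auto simp: L_def)
  have dL: "dset (Suc m) L"
  proof -
    have "dp (\<lambda>e. lcont m (\<lambda>x. f (x @ [e 0])) (map (\<lambda>i. e (Suc i)) [0..<m]))"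
    proof (rule dp_lcont[where F = "\<lambda>e x. f (x @ [e 0])"])
      show "df (\<lambda>e. f (L e @ [g e 0]))" if "dl m L" "\<And>i. df (\<lambda>e. g e i)" for L g
        by (intro df_app[OF f] dl_snoc that)
    qed (intro dintros)
    then have *: "df t \<Longrightarrow> dl m K \<Longrightarrow> dp (\<lambda>e. lcont m (\<lambda>x. f (x @ [t e])) (K e))" for t K
      using dp_fam[of m "\<lambda>t. {x. lcont m (\<lambda>x. f (x @ [t])) x}"] by (simp add: dfam_def)
    show ?thesis unfolding dset_def L_def mem_Collect_eq
      by (intro qintros * dp_eql[where n = "Suc m"])
  qed
  have dW: "dset (Suc m) (W P)" if "P \<in> {nice, loc_const, \<lambda>f r. less_left f r \<and> greater_right f r,
      \<lambda>f r. greater_left f r \<and> less_right f r}" for P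
    using that unfolding dset_def W_def mem_Collect_eq
    by (elim insertE emptyE; hypsubst; unfold nice_def cont1_def loc_const_def less_left_def
      greater_left_def
      less_right_def greater_right_def; intro qintros df_app[OF f] dp_eql[where n = "Suc m"])
  have split: "z \<in> obox a b \<Longrightarrow> \<exists>x r. z = x @ [r] \<and> length x = m" for z
    using length_box[of z a b] len by (auto simp: length_Suc_conv_rev)
  \<comment> \<open>Over each \<open>x\<close> only finitely many \<open>r\<close> are bad, so no
    fibre of the bad set is infinite.\<close>
  have nice: "\<not> dge (Suc m) (Suc m) (obox a b - W nice)"
  proof
    assume "dge (Suc m) (Suc m) (obox a b - W nice)"
    then have "dge m m (inf_last (obox a b - W nice))" using dge_le[of m "Suc m"] by auto
    then have "dge m m ({} :: 'm list set)"
    proof (rule dge_mono)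
      fix x :: "'m list" assume x: "length x = m" "x \<in> inf_last (obox a b - W nice)"
      have "{y. x @ [y] \<in> obox a b - W nice} \<subseteq> {r. \<not> nice (\<lambda>s. f (x @ [s])) r}"
        using x by (auto simp: W)
      then show "x \<in> {}"
        using x finite_not_nice[OF fx[OF x(1)]] finite_subset by (auto simp: inf_last_def)
    qed
    then show False by simp
  qed
  \<comment> \<open>A box avoiding \<open>L\<close> would have a horizontal slice on which the
    restriction of \<open>f\<close> has no continuity point, against the induction hypothesis
    \<open>C\<close>.\<close>
  have "\<not> dge (Suc m) (Suc m) (obox a b - L)"
  proof
    assume "dge (Suc m) (Suc m) (obox a b - L)"
    moreover have "dset (Suc m) (obox a b - L)" by (intro dset_Diff dset_box len lenb dL)
    ultimately obtain a' b' where "length a' = Suc m" "list_all2 (<) a' b'" and sub: "obox a' b' \<subseteq>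
      obox a b - L"
      using B unfolding box_property_def by blast
    then obtain a1 \<alpha> b1 \<beta> where ab': "a' = a1 @ [\<alpha>]" "b' = b1 @ [\<beta>]" "length a1 = m" "length b1 = m"
      "list_all2 (<) a1 b1" "\<alpha> < \<beta>" using list_all2_snocE by metis
    obtain r where r: "\<alpha> < r" "r < \<beta>" using dense[OF ab'(6)] by blast
    obtain x where x: "x \<in> obox a1 b1" "lcont m (\<lambda>x. f (x @ [r])) x"
      using C fr ab' unfolding continuity_property_def by blast
    then have "x @ [r] \<in> L" using length_box[OF x(1)] ab' by (simp add: L)
    moreover have "x @ [r] \<in> obox a' b'" using x r by (simp add: ab')
    ultimately show False using sub by blast
  qed
  then have "\<not> dge (Suc m) (Suc m) ((obox a b - W nice) \<union> (obox a b - L))"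
    using nice dge_Un by blast
  moreover have "dge (Suc m) (Suc m) (((obox a b - W nice) \<union> (obox a b - L)) \<union> (obox a b \<inter> W nice \<inter>
    L))"
    using dge_box[OF len ab] by (rule dge_mono) blast
  ultimately have "dge (Suc m) (Suc m) (obox a b \<inter> W nice \<inter> L)" using dge_Un by blast
  moreover have "obox a b \<inter> W nice \<inter> L \<subseteq> obox a b \<inter> W nice \<inter> L \<inter> W loc_const \<union>
     (obox a b \<inter> W nice \<inter> L \<inter> W (\<lambda>f r. less_left f r \<and> greater_right f r) \<union>
     obox a b \<inter> W nice \<inter> L \<inter> W (\<lambda>f r. greater_left f r \<and> less_right f r))"
  proof
    fix z assume z: "z \<in> obox a b \<inter> W nice \<inter> L"
    then obtain x r where "z = x @ [r]" "length x = m" using split by blast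
    then show "z \<in> obox a b \<inter> W nice \<inter> L \<inter> W loc_const \<union>
     (obox a b \<inter> W nice \<inter> L \<inter> W (\<lambda>f r. less_left f r \<and> greater_right f r) \<union>
     obox a b \<inter> W nice \<inter> L \<inter> W (\<lambda>f r. greater_left f r \<and> less_right f r))"
      using z by (auto simp: W nice_def)
  qed
  ultimately have "dge (Suc m) (Suc m) (obox a b \<inter> W nice \<inter> L \<inter> W loc_const \<union>
     (obox a b \<inter> W nice \<inter> L \<inter> W (\<lambda>f r. less_left f r \<and> greater_right f r) \<union>
     obox a b \<inter> W nice \<inter> L \<inter> W (\<lambda>f r. greater_left f r \<and> less_right f r)))"
    by - (erule dge_mono, blast)
  then obtain P where P: "P \<in> {loc_const, \<lambda>f r. less_left f r \<and> greater_right f r,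
      \<lambda>f r. greater_left f r \<and> less_right f r}" and "dge (Suc m) (Suc m) (obox a b \<inter> W nice \<inter> L \<inter> W
        P)"
    unfolding dge_Un by blast
  moreover have "dset (Suc m) (obox a b \<inter> W nice \<inter> L \<inter> W P)"
    using P by (intro dset_Int dset_box len lenb dL dW) auto
  ultimately obtain a' b' where "length a' = Suc m" "list_all2 (<) a' b'"
     and sub: "obox a' b' \<subseteq> obox a b \<inter> W nice \<inter> L \<inter> W P"
    using B unfolding box_property_def by blast
  then obtain a1 \<alpha> b1 \<beta> where ab': "a' = a1 @ [\<alpha>]" "b' = b1 @ [\<beta>]" "length a1 = m" "length b1 = m"
      "list_all2 (<) a1 b1" "\<alpha> < \<beta>" using list_all2_snocE by metis
  have good: "nice (\<lambda>s. f (x @ [s])) r" "lcont m (\<lambda>x. f (x @ [r])) x" "P (\<lambda>s. f (x @ [s])) r"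
    if "x \<in> obox a1 b1" "\<alpha> < r" "r < \<beta>" for x r
  proof -
    have "x @ [r] \<in> obox a b \<inter> W nice \<inter> L \<inter> W P" using that sub by (auto simp: ab')
    then show "nice (\<lambda>s. f (x @ [s])) r" "lcont m (\<lambda>x. f (x @ [r])) x" "P (\<lambda>s. f (x @ [s])) r"
      by (auto simp: W L)
  qed
  obtain r where r: "\<alpha> < r" "r < \<beta>" using dense[OF ab'(6)] by blast
  obtain x where x: "x \<in> obox a1 b1" using box_nonempty[OF ab'(5)] by blast
  have "lcont (Suc m) f (x @ [r])"
  proof (rule lcont_snoc[OF x r])
    show "length x = m" using length_box[OF x] ab' by simp
    show "cont1 (\<lambda>s. f (x @ [s])) r" using good(1)[OF x r] by (simp add: nice_def)
    show "lcont m (\<lambda>x. f (x @ [s])) x" if "\<alpha> < s" "s < \<beta>" for s using good(2)[OF x that] .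
    fix y s t u c d assume y: "y \<in> obox a1 b1" and o: "\<alpha> < s" "s < t" "t < u" "u < \<beta>"
      and cd: "c < f (y @ [s])" "c < f (y @ [u])" "f (y @ [s]) < d" "f (y @ [u]) < d"
    have fy: "df1 (\<lambda>s. f (y @ [s]))" using fx length_box[OF y] ab' by simp
    have fy': "df1 (\<lambda>s. - f (y @ [s]))" using fy unfolding df1_def by (rule df_uminus)
    from P consider "P = loc_const" | "P = (\<lambda>f r. less_left f r \<and> greater_right f r)"
      | "P = (\<lambda>f r. greater_left f r \<and> less_right f r)" by blast
    then show "c < f (y @ [t]) \<and> f (y @ [t]) < d"
    proof cases
      case 1
      have "f (y @ [s]) = f (y @ [t])"
        by (rule locally_const_imp_const[OF fy, of \<alpha> \<beta>]) (use good(3)[OF y] 1 o in auto)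
      then show ?thesis using cd by simp
    next
      case 2
      have "f (y @ [s]) < f (y @ [t])"
        by (rule strict_mono_of_local[OF fy, of \<alpha> \<beta>]) (use good(3)[OF y] 2 o in auto)
      moreover have "f (y @ [t]) < f (y @ [u])"
        by (rule strict_mono_of_local[OF fy, of \<alpha> \<beta>]) (use good(3)[OF y] 2 o in auto)
      ultimately show ?thesis using cd by auto
    next
      case 3
      have "- f (y @ [s]) < - f (y @ [t])"
        by (rule strict_mono_of_local[OF fy', of \<alpha> \<beta>])
         (use good(3)[OF y] 3 o in \<open>auto simp: less_left_neg greater_right_neg\<close>)
      moreover have "- f (y @ [t]) < - f (y @ [u])"
        by (rule strict_mono_of_local[OF fy', of \<alpha> \<beta>])
         (use good(3)[OF y] 3 o in \<open>auto simp: less_left_neg greater_right_neg\<close>)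
      ultimately show ?thesis using cd by auto
    qed
  qed
  moreover have "x @ [r] \<in> obox a b" using sub x r by (auto simp: ab')
  ultimately show "\<exists>x\<in>obox a b. lcont (Suc m) f x" by blast
qed

lemma box_and_continuity: "box_property m \<and> continuity_property m"
proof (induction m)
  case 0
  have "lcont 0 f []" for f :: "'m list \<Rightarrow> 'm"
    by (rule lcontI) (auto intro!: exI[of _ "[]"])
  then show ?case by (auto simp: box_property_def continuity_property_def)
next
  case (Suc m)
  then show ?case using box_property_Suc continuity_property_Suc by blast
qed

end

section \<open>Cells of prescribed dimension\<close>

definition sel_idx :: "nat list \<Rightarrow> nat list" where
  "sel_idx ks = filter (\<lambda>i. ks ! i = 1) [0..<length ks]"

definition sel :: "nat list \<Rightarrow> 'a list \<Rightarrow> 'a list" where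
  "sel ks x = map ((!) x) (sel_idx ks)"

lemma sel_idx_snoc: "sel_idx (ks @ [k]) = sel_idx ks @ (if k = 1 then [length ks] else [])"
proof -
  have "filter (\<lambda>i. (ks @ [k]) ! i = 1) [0..<length ks] = filter (\<lambda>i. ks ! i = 1) [0..<length ks]"
    by (rule filter_cong) (auto simp: nth_append)
  then show ?thesis by (simp add: sel_idx_def)
qed

lemma sel_idx_less: "i \<in> set (sel_idx ks) \<Longrightarrow> i < length ks"
  by (simp add: sel_idx_def)

lemma sel_snoc:
  assumes "length x = length ks"
  shows "sel (ks @ [k]) (x @ [y]) = sel ks x @ (if k = 1 then [y] else [])"
proof -
  have "map ((!) (x @ [y])) (sel_idx ks) = map ((!) x) (sel_idx ks)"
    using assms by (intro map_cong refl) (auto simp: nth_append dest!: sel_idx_less)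
  then show ?thesis using assms by (simp add: sel_def sel_idx_snoc nth_append)
qed

text \<open>Continuity measured by the free coordinates alone. On an \<open>scell\<close> these are
  coordinates of a box, so \<open>f\<close> becomes a continuous function on that box.\<close>

definition cont_sel :: "nat list \<Rightarrow> 'a::linorder list set \<Rightarrow> ('a list \<Rightarrow> 'a) \<Rightarrow> bool" where
  "cont_sel ks C f \<longleftrightarrow> (\<forall>x\<in>C. \<forall>c d. c < f x \<and> f x < d \<longrightarrow>
     (\<exists>a b. sel ks x \<in> obox a b \<and> (\<forall>y\<in>C. sel ks y \<in> obox a b \<longrightarrow> c < f y \<and> f y < d)))"

context o_minimal_structure
begin

text \<open>A cell whose bands have constant walls: the coordinates \<open>sel ks\<close> map it bijectively onto the
  box with corners \<open>a\<close> and \<open>b\<close>, so it can be restricted to smaller boxes.\<close>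

inductive scell :: "nat list \<Rightarrow> 'm list \<Rightarrow> 'm list \<Rightarrow> 'm list set \<Rightarrow> bool" where
  point: "scell [] [] [] {[]}"
| graph: "scell ks a b C \<Longrightarrow> dfl (length ks) f \<Longrightarrow> cont_sel ks C f \<Longrightarrow>
    scell (ks @ [0]) a b {x @ [f x] | x. x \<in> C}"
| band: "scell ks a b C \<Longrightarrow> c < d \<Longrightarrow>
    scell (ks @ [1]) (a @ [c]) (b @ [d]) {x @ [y] | x y. x \<in> C \<and> c < y \<and> y < d}"

lemma scell_basic:
  assumes "scell ks a b C"
  shows "C \<subseteq> {x. length x = length ks}" "length a = length (sel_idx ks)" "length a = sum_list ks"
    "list_all2 (<) a b"
  using assms by (induction rule: scell.induct) (auto simp: sel_idx_snoc sel_idx_def[of "[]"])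

lemma scell_dset: "scell ks a b C \<Longrightarrow> dset (length ks) C"
proof (induction rule: scell.induct)
  case point
  then show ?case by (simp add: dset_def dp_const)
next
  case (graph ks a b C f)
  have "dp (\<lambda>e. \<exists>x. length x = length ks \<and> (x \<in> C \<and> map e [0..<Suc (length ks)] = x @ [f x]))"
    by (intro qintros dp_mem[OF graph.IH] df_app[OF graph.hyps(2)] dp_eql[where n = "Suc (length
      ks)"])
  moreover have "z \<in> {x @ [f x] | x. x \<in> C} \<longleftrightarrow> (\<exists>x. length x = length ks \<and> (x \<in> C \<and> z = x @ [f x]))"
    for z
    using scell_basic(1)[OF graph.hyps(1)] by auto
  ultimately show ?case by (simp add: dset_def)
next
  case (band ks a b C c d)
  have "dp (\<lambda>e. \<exists>x. length x = length ks \<and> (\<exists>y. x \<in> C \<and> c < y \<and> y < d \<and> map e [0..<Suc (length ks)]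
    = x @ [y]))"
    by (intro qintros dp_mem[OF band.IH] dp_eql[where n = "Suc (length ks)"])
  moreover have "z \<in> {x @ [y] | x y. x \<in> C \<and> c < y \<and> y < d} \<longleftrightarrow>
      (\<exists>x. length x = length ks \<and> (\<exists>y. x \<in> C \<and> c < y \<and> y < d \<and> z = x @ [y]))" for z
    using scell_basic(1)[OF band.hyps(1)] by auto
  ultimately show ?case by (simp add: dset_def)
qed

lemma scell_bij: "scell ks a b C \<Longrightarrow> bij_betw (sel ks) C (obox a b)"
proof (induction rule: scell.induct)
  case point
  then show ?case by (simp add: bij_betw_def sel_def sel_idx_def)
next
  case (graph ks a b C f)
  have len: "\<And>x. x \<in> C \<Longrightarrow> length x = length ks" using scell_basic(1)[OF graph.hyps(1)] by auto
  have inj: "inj_on (sel ks) C" and im: "sel ks ` C = obox a b"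
    using graph.IH by (auto simp: bij_betw_def)
  have "inj_on (sel (ks @ [0])) {x @ [f x] | x. x \<in> C}"
    by (rule inj_onI) (auto simp: sel_snoc len dest: inj_onD[OF inj])
  moreover have "sel (ks @ [0]) ` {x @ [f x] | x. x \<in> C} = sel ks ` C"
    by (force simp: sel_snoc len image_iff)
  ultimately show ?case using im by (simp add: bij_betw_def)
next
  case (band ks a b C c d)
  have len: "\<And>x. x \<in> C \<Longrightarrow> length x = length ks" using scell_basic(1)[OF band.hyps(1)] by auto
  have inj: "inj_on (sel ks) C" and im: "sel ks ` C = obox a b"
    using band.IH by (auto simp: bij_betw_def)
  let ?B = "{x @ [y] | x y. x \<in> C \<and> c < y \<and> y < d}"
  have "inj_on (sel (ks @ [1])) ?B"
    by (rule inj_onI) (auto simp: sel_snoc len dest: inj_onD[OF inj])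
  moreover have "sel (ks @ [1]) ` ?B = obox (a @ [c]) (b @ [d])"
  proof (intro equalityI subsetI)
    fix z assume "z \<in> sel (ks @ [1]) ` ?B"
    then obtain x y where "z = sel ks x @ [y]" "x \<in> C" "c < y" "y < d" by (auto simp: sel_snoc len)
    then show "z \<in> obox (a @ [c]) (b @ [d])" using im by auto
  next
    fix z assume "z \<in> obox (a @ [c]) (b @ [d])"
    then obtain q y where z: "z = q @ [y]" "q \<in> obox a b" "c < y" "y < d" by (rule box_snocE)
    then obtain x where x: "x \<in> C" "q = sel ks x" using im by blast
    then have "z = sel (ks @ [1]) (x @ [y])" using z by (simp add: sel_snoc len)
    then show "z \<in> sel (ks @ [1]) ` ?B" using x z by blast
  qed
  ultimately show ?case by (simp add: bij_betw_def)
qed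

lemma scell_restrict:
  assumes "scell ks a b C" "length a' = length a" "list_all2 (<) a' b'" "obox a' b' \<subseteq> obox a b"
  shows "scell ks a' b' {x \<in> C. sel ks x \<in> obox a' b'}"
  using assms
proof (induction arbitrary: a' b' rule: scell.induct)
  case point
  then have "a' = []" "b' = []" by auto
  moreover have "{x \<in> {[]}. sel [] x \<in> obox [] []} = {[] :: 'm list}"
    by (auto simp: sel_def sel_idx_def)
  ultimately show ?case by (simp add: scell.point)
next
  case (graph ks a b C f)
  have len: "\<And>x. x \<in> C \<Longrightarrow> length x = length ks" using scell_basic(1)[OF graph.hyps(1)] by auto
  let ?C = "{x \<in> C. sel ks x \<in> obox a' b'}"
  have "cont_sel ks ?C f" using graph.hyps(3) unfolding cont_sel_def by blast
  then have "scell (ks @ [0]) a' b' {x @ [f x] | x. x \<in> ?C}"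
    using graph by (intro scell.graph) auto
  moreover have "{x @ [f x] | x. x \<in> ?C} = {x \<in> {x @ [f x] | x. x \<in> C}. sel (ks @ [0]) x \<in> obox a'
    b'}"
    by (auto simp: sel_snoc len)
  ultimately show ?case by simp
next
  case (band ks a b C c d)
  have len: "\<And>x. x \<in> C \<Longrightarrow> length x = length ks" using scell_basic(1)[OF band.hyps(1)] by auto
  obtain a1 c' b1 d' where ab': "a' = a1 @ [c']" "b' = b1 @ [d']" "length a1 = length a"
    "list_all2 (<) a1 b1" "c' < d'" 
  proof (rule list_all2_snocE[OF band.prems(2), of "length a"])
    show "length a' = Suc (length a)" using band.prems(1) by simp
  qed blast
  obtain q where q: "q \<in> obox a1 b1" using box_nonempty[OF ab'(4)] by blast
  obtain y where y: "c' < y" "y < d'" using dense[OF ab'(5)] by blast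
  have sub: "p @ [z] \<in> obox (a @ [c]) (b @ [d])" if "p \<in> obox a1 b1" "c' < z" "z < d'" for p z
    using band.prems(3) that unfolding ab' by (meson box_snoc subsetD)
  have "obox a1 b1 \<subseteq> obox a b" using sub[OF _ y] by auto
  then have "scell ks a1 b1 {x \<in> C. sel ks x \<in> obox a1 b1}" using band.IH ab' by blast
  then have "scell (ks @ [1]) (a1 @ [c']) (b1 @ [d'])
      {x @ [y] | x y. x \<in> {x \<in> C. sel ks x \<in> obox a1 b1} \<and> c' < y \<and> y < d'}"
    using ab'(5) by (rule scell.band)
  moreover have "{x @ [y] | x y. x \<in> {x \<in> C. sel ks x \<in> obox a1 b1} \<and> c' < y \<and> y < d'} =
    {x \<in> {x @ [y] | x y. x \<in> C \<and> c < y \<and> y < d}. sel (ks @ [1]) x \<in> obox a' b'}"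
    using sub[OF q] by (auto simp: sel_snoc len ab')
  ultimately show ?case by (simp add: ab')
qed

lemma dl_sel: "dl (length ks) L \<Longrightarrow> dl (length (sel_idx ks)) (\<lambda>e. sel ks (L e))"
  unfolding dl_def sel_def using sel_idx_less[OF nth_mem] by auto

text \<open>Generic continuity is proved on boxes; carrying \<open>g\<close> over to the box of free
  coordinates makes it available for functions on a cell.\<close>

lemma scell_transfer:
  assumes C: "scell ks a b C" and g: "dfl (length ks) g"
  obtains G where "dfl (length a) G" "\<And>x. x \<in> C \<Longrightarrow> G (sel ks x) = g x"
proof -
  define R where "R q v \<longleftrightarrow> (\<exists>x. length x = length ks \<and> (x \<in> C \<and> sel ks x = q \<and> v = g x))" for q v
  define G where "G q = the0 (R q)" for q
  note len = scell_basic(2)[OF C]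
  have "dfl (length a) G"
    unfolding dfl_def G_def
    by (rule df_the0) (unfold R_def len, intro qintros dp_mem[OF scell_dset[OF C]] df_app[OF g]
      dp_eql[where n = "length (sel_idx ks)"] dl_sel)
  moreover have "G (sel ks x) = g x" if "x \<in> C" for x
    unfolding G_def
  proof (rule the0_eq)
    show "R (sel ks x) (g x)" using that scell_basic(1)[OF C] by (auto simp: R_def)
    show "v = g x" if "R (sel ks x) v" for v
      using that \<open>x \<in> C\<close> scell_bij[OF C] by (auto simp: R_def bij_betw_def dest: inj_onD)
  qed
  ultimately show ?thesis using that by blast
qed

text \<open>The two clauses of \<open>dge\<close> match the two ways to extend a cell. A projection
  is lifted by the graph of a choice function, an infinite fibre by a band between constants. In
  either case the base is first shrunk to a smaller box of free coordinates, for continuity or for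
  separation of the walls.\<close>

lemma dge_imp_scell:
  assumes "dset n Z" "dge n k Z"
  shows "\<exists>ks a b C. scell ks a b C \<and> length ks = n \<and> length a = k \<and> C \<subseteq> Z"
  using assms
proof (induction n arbitrary: k Z)
  case 0
  then show ?case using scell.point by (intro exI[of _ "[]"] exI[of _ "{[]}"]) auto
next
  case (Suc n)
  note Z = Suc.prems(1)
  from Suc.prems(2) consider "dge n k (proj_last Z)" | k' where "k = Suc k'" "dge n k' (inf_last Z)"
    by auto
  then show ?case
  proof cases
    case 1
    then obtain ks a b C where C: "scell ks a b C" "length ks = n" "length a = k" "C \<subseteq> proj_last Z"
      using Suc.IH[OF dset_proj_last[OF Z]] by blast
    define s where "s x = ch {y. x @ [y] \<in> Z}" for x
    have s: "dfl n s" unfolding dfl_def s_def by (intro df_ch dp_mem[OF Z] dintros)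
    have sZ: "x @ [s x] \<in> Z" if x: "x \<in> C" for x
    proof -
      have "length x = n" using x scell_basic(1)[OF C(1)] C(2) by auto
      then have "dp1 {y. x @ [y] \<in> Z}"
        unfolding dp1_def mem_Collect_eq by (intro dp_mem[OF Z] dl_const dl_snoc df_var)
      moreover obtain y where "x @ [y] \<in> Z" using x C(4) by (auto simp: proj_last_def)
      ultimately have "s x \<in> {y. x @ [y] \<in> Z}" unfolding s_def by (intro ch_mem) auto
      then show ?thesis by simp
    qed
    obtain G where G: "dfl k G" "\<And>x. x \<in> C \<Longrightarrow> G (sel ks x) = s x"
      using scell_transfer[OF C(1), of s] s C(2,3) by metis
    obtain a' b' where ab': "length a' = k" "list_all2 (<) a' b'" "obox a' b' \<subseteq> obox a b"
      "\<And>x. x \<in> obox a' b' \<Longrightarrow> lcont k G x"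
      using continuity_on_box[of k G a b] box_and_continuity G(1) C(3) scell_basic(4)[OF C(1)]
        by metis
    define C' where "C' = {x \<in> C. sel ks x \<in> obox a' b'}"
    have C': "scell ks a' b' C'"
      unfolding C'_def by (rule scell_restrict[OF C(1)]) (use ab' C in auto)
    have "cont_sel ks C' s"
      unfolding cont_sel_def
    proof (intro ballI allI impI)
      fix x c d assume x: "x \<in> C'" and cd: "c < s x \<and> s x < d"
      have "lcont k G (sel ks x)" using x ab'(4) by (simp add: C'_def)
      then obtain p q where pq: "sel ks x \<in> obox p q" "\<And>y. y \<in> obox p q \<Longrightarrow> c < G y \<and> G y < d"
        using lcontD[of k G "sel ks x" c d] cd G(2) x by (auto simp: C'_def)
      show "\<exists>a b. sel ks x \<in> obox a b \<and> (\<forall>y\<in>C'. sel ks y \<in> obox a b \<longrightarrow> c < s y \<and> s y < d)"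
      proof (rule exI[of _ p], rule exI[of _ q], intro conjI ballI impI)
        fix y assume y: "y \<in> C'" "sel ks y \<in> obox p q"
        then have "G (sel ks y) = s y" using G(2) by (simp add: C'_def)
        then show "c < s y" "s y < d" using pq(2)[OF y(2)] by auto
      qed (rule pq(1))
    qed
    then have "scell (ks @ [0]) a' b' {x @ [s x] | x. x \<in> C'}"
      using C' s C(2) by (intro scell.graph) simp_all
    moreover have "{x @ [s x] | x. x \<in> C'} \<subseteq> Z" using sZ by (auto simp: C'_def)
    moreover have "length (ks @ [0]) = Suc n" using C(2) by simp
    ultimately show ?thesis using ab'(1) by blast
  next
    case 2
    then obtain ks a b C where C: "scell ks a b C" "length ks = n" "length a = k'" "C \<subseteq> inf_last Z"
      using Suc.IH[OF dset_inf_last[OF Z]] by blast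
    have len: "length x = n" if "x \<in> C" for x using that scell_basic(1)[OF C(1)] C(2) by auto
    obtain l u where lu: "dfl n l" "dfl n u" "\<And>x. length x = n \<Longrightarrow> x \<in> inf_last Z \<Longrightarrow> l x < u x"
      "\<And>x y. length x = n \<Longrightarrow> x \<in> inf_last Z \<Longrightarrow> l x < y \<Longrightarrow> y < u x \<Longrightarrow> x @ [y] \<in> Z"
      using choose_interval[OF Z] by metis
    obtain L where L: "dfl k' L" "\<And>x. x \<in> C \<Longrightarrow> L (sel ks x) = l x"
      using scell_transfer[OF C(1), of l] lu C(2,3) by metis
    obtain U where U: "dfl k' U" "\<And>x. x \<in> C \<Longrightarrow> U (sel ks x) = u x"
      using scell_transfer[OF C(1), of u] lu C(2,3) by metis
    have "L q < U q" if "q \<in> obox a b" for q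
    proof -
      obtain x where x: "x \<in> C" "q = sel ks x"
        using \<open>q \<in> obox a b\<close> bij_betw_imp_surj_on[OF scell_bij[OF C(1)]] by blast
      have "l x < u x" using lu(3)[OF len[OF x(1)]] C(4) x(1) by blast
      then show ?thesis using L(2)[OF x(1)] U(2)[OF x(1)] x(2) by simp
    qed
    then obtain a' b' c d where ab': "length a' = k'" "list_all2 (<) a' b'" "obox a' b' \<subseteq> obox a b"
      "c < d"
      "\<And>q. q \<in> obox a' b' \<Longrightarrow> L q < c \<and> d < U q"
      using separate_on_box[of k' L U a b] box_and_continuity L(1) U(1) C(3) scell_basic(4)[OF C(1)]
        by metis
    define C' where "C' = {x \<in> C. sel ks x \<in> obox a' b'}"
    have C': "scell ks a' b' C'"
      unfolding C'_def by (rule scell_restrict[OF C(1)]) (use ab' C in auto)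
    then have "scell (ks @ [1]) (a' @ [c]) (b' @ [d]) {x @ [y] | x y. x \<in> C' \<and> c < y \<and> y < d}"
      using ab'(4) by (rule scell.band)
    moreover have "{x @ [y] | x y. x \<in> C' \<and> c < y \<and> y < d} \<subseteq> Z"
    proof clarify
      fix x y assume x: "x \<in> C'" and y: "c < y" "y < d"
      have "l x < c" "d < u x" using ab'(5)[of "sel ks x"] x L U by (auto simp: C'_def)
      then show "x @ [y] \<in> Z" using lu(4)[of x y] x y C(4) len by (auto simp: C'_def)
    qed
    moreover have "length (ks @ [1]) = Suc n" "length (a' @ [c]) = k" using C(2) ab' 2 by auto
    ultimately show ?thesis by blast
  qed
qed

section \<open>Comparison with cells and with the order topology\<close>

lemma openin_order_box_coordinate:
  "i < n \<Longrightarrow> openin (order_box_topology n) {y. length y = n \<and> c < y ! i \<and> y ! i < d}"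
proof -
  assume i: "i < n"
  let ?a = "\<lambda>j. if j = i then Fin c else Minf" and ?b = "\<lambda>j. if j = i then Fin d else Pinf"
  have "{y. length y = n \<and> c < y ! i \<and> y ! i < d} =
      {xs. length xs = n \<and> (\<forall>j<n. xs ! j \<in> open_interval (?a j) (?b j))}"
    using i by (auto simp: open_interval_def)
  then have "{y. length y = n \<and> c < y ! i \<and> y ! i < d} \<in>
      {{xs. length xs = n \<and> (\<forall>i<n. xs ! i \<in> open_interval (a i) (b i))} | a b. True}"
    by (intro CollectI exI[of _ ?a] exI[of _ ?b] conjI TrueI)
  then show ?thesis unfolding order_box_topology_def by (rule topology_generated_by_Basis)
qed

lemma topspace_order_box: "topspace (order_box_topology n) = {x. length x = n}"
proof -
  have "{x. length x = n} = {xs. length xs = n \<and> (\<forall>i<n. xs ! i \<in> open_interval ((\<lambda>_. Minf) i) ((\<lambda>_.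
    Pinf) i))}"
    by (auto simp: open_interval_def)
  then have "{x. length x = n} \<in> {{xs. length xs = n \<and> (\<forall>i<n. xs ! i \<in> open_interval (a i) (b i))} |
    a b. True}"
    by (intro CollectI exI[of _ "\<lambda>_. Minf"] exI[of _ "\<lambda>_. Pinf"] conjI TrueI)
  then have "{x. length x = n} \<subseteq> topspace (order_box_topology n)"
    unfolding order_box_topology_def topology_generated_by_topspace by (rule Union_upper)
  moreover have "topspace (order_box_topology n) \<subseteq> {x. length x = n}"
    unfolding order_box_topology_def topology_generated_by_topspace by auto
  ultimately show ?thesis by (rule subset_antisym[rotated])
qed

lemma openin_sel:
  fixes p q :: "'m list"
  assumes "length p = length (sel_idx ks)" "length q = length (sel_idx ks)"
  shows "openin (order_box_topology (length ks)) {y. length y = length ks \<and> sel ks y \<in> obox p q}"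
proof -
  let ?n = "length ks"
  have "openin (order_box_topology ?n)
     {y. length y = ?n \<and> (\<forall>j<w. p ! j < y ! (sel_idx ks ! j) \<and> y ! (sel_idx ks ! j) < q ! j)}"
    if "w \<le> length (sel_idx ks)" for w
    using that
  proof (induction w)
    case 0
    then show ?case using openin_topspace[of "order_box_topology ?n"]
      by (simp add: topspace_order_box)
  next
    case (Suc w)
    have "sel_idx ks ! w < ?n" using Suc.prems sel_idx_less[OF nth_mem, of w ks] by simp
    then have "openin (order_box_topology ?n)
     ({y. length y = ?n \<and> (\<forall>j<w. p ! j < y ! (sel_idx ks ! j) \<and> y ! (sel_idx ks ! j) < q ! j)} \<inter>
      {y. length y = ?n \<and> p ! w < y ! (sel_idx ks ! w) \<and> y ! (sel_idx ks ! w) < q ! w})"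
      using Suc by (intro openin_Int openin_order_box_coordinate) auto
    then show ?case by (rule back_subst) (auto simp: less_Suc_eq)
  qed
  from this[OF order_refl] show ?thesis
    using assms by (auto simp: obox_def sel_def list_all2_conv_all_nth cong: conj_cong elim!:
      back_subst[of "openin _"])
qed

text \<open>A box in the free coordinates pulls back to an open set of the order topology, so the
  neighbourhoods in \<open>cont_sel\<close> are among those allowed for continuity on
  \<open>C\<close>.\<close>

lemma cont_sel_continuous:
  fixes f :: "'m list \<Rightarrow> 'm"
  assumes f: "cont_sel ks C f" and C: "C \<subseteq> {x. length x = length ks}"
  shows "continuous_map (subtopology (order_box_topology (length ks)) C) (order_box_topology 1) (\<lambda>x.
    [f x])"
  unfolding order_box_topology_def[of 1]
proof (rule continuous_on_generated_topo)
  let ?T = "subtopology (order_box_topology (length ks)) C"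
  have ts: "topspace ?T = C" using C by (auto simp: topspace_order_box)
  show "(\<lambda>x. [f x]) ` topspace ?T \<subseteq>
      \<Union>{{xs. length xs = 1 \<and> (\<forall>i<1. xs ! i \<in> open_interval (a i) (b i))} | a b. True}"
    using topspace_order_box[of 1, where 'a = 'm]
      unfolding order_box_topology_def topology_generated_by_topspace by auto
  fix U :: "'m list set"
  assume "U \<in> {{xs. length xs = 1 \<and> (\<forall>i<1. xs ! i \<in> open_interval (a i) (b i))} | a b. True}"
  then obtain a b where U: "U = {xs. length xs = 1 \<and> (\<forall>i<1. xs ! i \<in> open_interval (a i) (b i))}"
    by blast
  have pre: "(\<lambda>x. [f x]) -` U \<inter> topspace ?T = {x \<in> C. f x \<in> open_interval (a 0) (b 0)}"
    unfolding ts U by auto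
  show "openin ?T ((\<lambda>x. [f x]) -` U \<inter> topspace ?T)"
    unfolding pre
  proof (subst openin_subopen, intro ballI)
    fix x assume "x \<in> {x \<in> C. f x \<in> open_interval (a 0) (b 0)}"
    then have x: "x \<in> C" "f x \<in> open_interval (a 0) (b 0)" by auto
    obtain c d where cd: "c < f x" "f x < d" "\<And>y. c < y \<Longrightarrow> y < d \<Longrightarrow> y \<in> open_interval (a 0) (b 0)"
      using open_interval_contains[OF x(2)] by blast
    obtain p q where pq: "sel ks x \<in> obox p q" "\<And>y. y \<in> C \<Longrightarrow> sel ks y \<in> obox p q \<Longrightarrow> c < f y \<and> f y < d"
      using f x cd(1,2) unfolding cont_sel_def by blast
    have "length p = length (sel_idx ks)" "length q = length (sel_idx ks)"
      using length_box[OF pq(1)] list_all2_lengthD[OF mem_box_less[OF pq(1)]]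
        by (auto simp: sel_def)
    then have "openin ?T ({y. length y = length ks \<and> sel ks y \<in> obox p q} \<inter> C)"
      using openin_sel by (auto simp: openin_subtopology)
    moreover have "x \<in> {y. length y = length ks \<and> sel ks y \<in> obox p q} \<inter> C" using x pq C by auto
    moreover have "{y. length y = length ks \<and> sel ks y \<in> obox p q} \<inter> C \<subseteq> {x \<in> C. f x \<in> open_interval
      (a 0) (b 0)}"
      using pq(2) cd(3) by auto
    ultimately show "\<exists>T. openin ?T T \<and> x \<in> T \<and> T \<subseteq> {x \<in> C. f x \<in> open_interval (a 0) (b 0)}"
      by blast
  qed
qed

lemma def_cont_scell:
  assumes C: "scell ks a b C" and f: "dfl (length ks) f" and c: "cont_sel ks C f"
  shows "def_cont \<M> (length ks) C f"
proof -
  have "scell (ks @ [0]) a b {x @ [f x] | x. x \<in> C}" using assms by (rule scell.graph)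
  then have "definable \<M> (length ks + 1) {x @ [f x] | x. x \<in> C}"
    using scell_dset scell_basic(1) by (fastforce simp: definable_iff)
  then show ?thesis
    unfolding def_cont_def using cont_sel_continuous[OF c scell_basic(1)[OF C]] by blast
qed

lemma scell_cell: "scell ks a b C \<Longrightarrow> cell \<M> ks C"
proof (induction rule: scell.induct)
  case point
  then show ?case by (rule cell.point)
next
  case (graph ks a b C f)
  then show ?case by (intro cell.graph def_cont_scell)
next
  case (band ks a b C c d)
  have const: "def_cont_inf \<M> (length ks) C (\<lambda>_. Fin v)" for v :: 'm
  proof -
    have "cont_sel ks C (\<lambda>_. v)"
      unfolding cont_sel_def
    proof (intro ballI allI impI)
      fix x c d assume "x \<in> C" "c < v \<and> v < d"
      then have "sel ks x \<in> obox a b" using scell_bij[OF band.hyps(1)] by (auto simp: bij_betw_def)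
      then show "\<exists>a b. sel ks x \<in> obox a b \<and> (\<forall>y\<in>C. sel ks y \<in> obox a b \<longrightarrow> c < v \<and> v < d)"
        using \<open>c < v \<and> v < d\<close> by blast
    qed
    then have "def_cont \<M> (length ks) C (\<lambda>_. v)"
      using band.hyps(1) by (intro def_cont_scell) (auto simp: dfl_def df_const)
    then show ?thesis unfolding def_cont_inf_def comp_def by blast
  qed
  have "cell \<M> (ks @ [1]) {x @ [y] | x y. x \<in> C \<and> y \<in> open_interval ((\<lambda>_. Fin c) x) ((\<lambda>_. Fin d)
    x)}"
    using band by (intro cell.band const) auto
  then show ?case by (simp add: open_interval_def)
qed

text \<open>A graph projects onto its base and a band has an interval over every base point, so each
  1 in \<open>ks\<close> is counted by an \<open>inf_last\<close> step of
  \<open>dge\<close>.\<close>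

lemma cell_dge: "cell \<M> ks C \<Longrightarrow> C \<subseteq> {x. length x = length ks} \<and> dge (length ks) (sum_list ks) C"
proof (induction rule: cell.induct)
  case (graph ks C f)
  have "proj_last {x @ [f x] | x. x \<in> C} = C" by (auto simp: proj_last_def)
  then show ?case using graph by auto
next
  case (band ks C f g)
  let ?B = "{x @ [y] | x y. x \<in> C \<and> y \<in> open_interval (f x) (g x)}"
  have "dge (length ks) (sum_list ks) (inf_last ?B)"
  proof (rule dge_mono)
    show "dge (length ks) (sum_list ks) C" using band.IH by blast
    fix x assume x: "x \<in> C"
    then have fg: "f x < g x" using band.hyps by blast
    have "open_interval (f x) (g x) \<noteq> {}"
      using fg dense lt_ex gt_ex unfolding open_interval_def by (cases "f x"; cases "g x") auto
    then obtain y where "y \<in> open_interval (f x) (g x)" by blast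
    then obtain p q where pq: "p < y" "y < q" "\<And>y. p < y \<Longrightarrow> y < q \<Longrightarrow> y \<in> open_interval (f x) (g x)"
      by (rule open_interval_contains) blast
    then have "{p<..<q} \<subseteq> {y. x @ [y] \<in> ?B}" using x by auto
    moreover have "p < q" using pq by simp
    ultimately show "x \<in> inf_last ?B" unfolding inf_last_def
      using infinite_Ioo finite_subset by blast
  qed
  then show ?case using band.IH by auto
qed auto

lemma dge_iff_cell:
  assumes "definable \<M> n S"
  shows "dge n k S \<longleftrightarrow> (\<exists>ks C. cell \<M> ks C \<and> C \<subseteq> S \<and> k \<le> sum_list ks)"
proof
  assume "dge n k S"
  then obtain ks a b C where "scell ks a b C" "length a = k" "C \<subseteq> S"
    using dge_imp_scell[of n S k] assms by (auto simp: definable_iff)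
  then show "\<exists>ks C. cell \<M> ks C \<and> C \<subseteq> S \<and> k \<le> sum_list ks"
    using scell_cell scell_basic(3) by fastforce
next
  assume "\<exists>ks C. cell \<M> ks C \<and> C \<subseteq> S \<and> k \<le> sum_list ks"
  then obtain ks C where C: "cell \<M> ks C" "C \<subseteq> S" "k \<le> sum_list ks" by blast
  then have d: "dge (length ks) (sum_list ks) C" "C \<subseteq> {x. length x = length ks}"
    using cell_dge by blast+
  then obtain x where "x \<in> C" "length x = length ks" using dge_nonempty by blast
  then have "length ks = n" using C(2) assms by (auto simp: definable_iff)
  then show "dge n k S" using d(1) C dge_antimono dge_mono by (metis subsetD)
qed

lemma o_dim_eqI:
  assumes "definable \<M> n S" "definable \<M> n S'" "\<And>k. dge n k S \<longleftrightarrow> dge n k S'"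
  shows "o_dim \<M> S = o_dim \<M> S'"
proof -
  have *: "o_dim \<M> S \<le> o_dim \<M> S'"
    if S: "definable \<M> n S" "definable \<M> n S'" and "\<And>k. dge n k S \<Longrightarrow> dge n k S'" for S S'
    unfolding o_dim_def[of _ S]
  proof (rule Sup_least)
    fix v assume "v \<in> {ereal (real (sum_list ks)) | ks C. cell \<M> ks C \<and> C \<subseteq> S}"
    then obtain ks C where v: "v = ereal (real (sum_list ks))" and "cell \<M> ks C" "C \<subseteq> S" by blast
    then have "dge n (sum_list ks) S" using dge_iff_cell[OF S(1)] by blast
    then have "dge n (sum_list ks) S'" using that by blast
    then obtain ls D where D: "cell \<M> ls D" "D \<subseteq> S'" "sum_list ks \<le> sum_list ls"
      using dge_iff_cell[OF S(2)] by blast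
    then have "ereal (real (sum_list ls)) \<le> o_dim \<M> S'" unfolding o_dim_def
      by (intro Sup_upper) blast
    then show "v \<le> o_dim \<M> S'" using D(3) by (auto simp: v intro: order_trans[rotated])
  qed
  show ?thesis using *[of S S'] *[of S' S] assms by (intro antisym) auto
qed

lemma o_dim_eq_imp_dge:
  assumes S: "definable \<M> n S" and S': "definable \<M> n S'" and eq: "o_dim \<M> S = o_dim \<M> S'" and k:
    "dge n k S"
  shows "dge n k S'"
proof (rule ccontr)
  assume "\<not> dge n k S'"
  have "o_dim \<M> S' \<le> ereal (real k - 1)"
    \<comment> \<open>Subtraction takes place in the reals: for \<open>k = 0\<close> the bound is
      -1, and it holds because \<open>S'\<close> then contains no cell at all.\<close>
    unfolding o_dim_def
  proof (rule Sup_least)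
    fix v assume "v \<in> {ereal (real (sum_list ks)) | ks C. cell \<M> ks C \<and> C \<subseteq> S'}"
    then obtain ks C where v: "v = ereal (real (sum_list ks))" and "cell \<M> ks C" "C \<subseteq> S'" by blast
    then have "sum_list ks < k" using \<open>\<not> dge n k S'\<close> dge_iff_cell[OF S', of k] by (metis not_le)
    then show "v \<le> ereal (real k - 1)" by (simp add: v)
  qed
  moreover obtain ks C where C: "cell \<M> ks C" "C \<subseteq> S" "k \<le> sum_list ks"
    using k dge_iff_cell[OF S] by blast
  then have "ereal (real (sum_list ks)) \<le> o_dim \<M> S" unfolding o_dim_def by (intro Sup_upper) blast
  ultimately have "ereal (real (sum_list ks)) \<le> ereal (real k - 1)"
    unfolding eq by (meson order_trans)
  then show False using C(3) by simp
qed

end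

section \<open>Metrics on boxes\<close>

definition is_metric :: "'a set \<Rightarrow> ('a \<Rightarrow> 'a \<Rightarrow> 'm::linordered_group_add) \<Rightarrow> bool" where
  "is_metric Q \<rho> \<longleftrightarrow> (\<forall>x\<in>Q. \<forall>y\<in>Q. 0 \<le> \<rho> x y \<and> (\<rho> x y = 0 \<longleftrightarrow> x = y) \<and> \<rho> x y = \<rho> y x \<and>
     (\<forall>z\<in>Q. \<rho> x z \<le> \<rho> x y + \<rho> y z))"

definition metric_discrete :: "('a \<Rightarrow> 'a \<Rightarrow> 'm::linordered_group_add) \<Rightarrow> 'a set \<Rightarrow> bool" where
  "metric_discrete \<rho> Y \<longleftrightarrow> (\<forall>y\<in>Y. \<exists>\<epsilon>>0. \<forall>z\<in>Y. \<rho> y z < \<epsilon> \<longrightarrow> z = y)"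

lemma is_metric_triangle:
  assumes "is_metric Q \<rho>" "x \<in> Q" "y \<in> Q" "z \<in> Q" "\<rho> x y < \<delta>" "\<rho> y z < \<epsilon>"
  shows "\<rho> x z < \<delta> + \<epsilon>"
proof -
  have "\<rho> x z \<le> \<rho> x y + \<rho> y z" using assms(1-4) unfolding is_metric_def by blast
  also have "\<dots> < \<delta> + \<epsilon>" using assms(5,6) by (rule group_add_less_mono)
  finally show ?thesis .
qed

context o_minimal_structure
begin

definition no_discrete :: "nat \<Rightarrow> 'm list set \<Rightarrow> ('m list \<Rightarrow> 'm list \<Rightarrow> 'm) \<Rightarrow> bool" where
  "no_discrete n Q \<rho> \<longleftrightarrow> (\<forall>Y. Y \<subseteq> Q \<longrightarrow> dset n Y \<longrightarrow> metric_discrete \<rho> Y \<longrightarrow> finite Y)"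

definition dmetric :: "nat \<Rightarrow> ('m list \<Rightarrow> 'm list \<Rightarrow> 'm) \<Rightarrow> bool" where
  "dmetric n \<rho> \<longleftrightarrow> dfl (n + n) (\<lambda>z. \<rho> (take n z) (drop n z))"

lemma df_metric:
  assumes "dmetric n \<rho>" "dl n L" "dl n K" shows "df (\<lambda>e. \<rho> (L e) (K e))"
proof -
  have "df (\<lambda>e. \<rho> (take n (L e @ K e)) (drop n (L e @ K e)))"
    using assms(1) unfolding dmetric_def by (rule df_app) (intro dl_append assms)
  moreover have "length (L e) = n" for e using assms(2) by (simp add: dl_def)
  ultimately show ?thesis by simp
qed

lemma dmetricI:
  assumes "df (\<lambda>e. \<rho> (map e [0..<n]) (map (\<lambda>i. e (n + i)) [0..<n]))" shows "dmetric n \<rho>"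
proof -
  have "take n (map e [0..<n + n]) = map e [0..<n]" "drop n (map e [0..<n + n]) = map (\<lambda>i. e (n +
    i)) [0..<n]"
    for e :: "nat \<Rightarrow> 'm" by (auto intro: nth_equalityI)
  then show ?thesis using assms by (simp add: dmetric_def dfl_def)
qed

lemma full_balls_1:
  assumes ab: "a = [\<alpha>]" "b = [\<beta>]" "\<alpha> < \<beta>" and dm: "dmetric 1 \<rho>"
    and m: "is_metric (obox a b) \<rho>" and nd: "no_discrete 1 (obox a b) \<rho>"
  shows "\<exists>z\<in>obox a b. \<forall>\<epsilon>>0. dge 1 1 {w \<in> obox a b. \<rho> z w < \<epsilon>}"
proof (rule ccontr)
  let ?Q = "obox a b"
  have Q: "?Q = (\<lambda>y. [y]) ` {\<alpha><..<\<beta>}" by (auto simp: ab obox_def list_all2_Cons1 list_all2_Cons2)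
  assume neg: "\<not> ?thesis"
  have "metric_discrete \<rho> ?Q"
    unfolding metric_discrete_def
  proof
    fix z assume z: "z \<in> ?Q"
    then obtain \<epsilon> where \<epsilon>: "0 < \<epsilon>" "\<not> dge 1 1 {w \<in> ?Q. \<rho> z w < \<epsilon>}" using neg by blast
    define F where "F = {y. [y] \<in> ?Q \<and> \<rho> z [y] < \<epsilon>}"
    have "finite F" using \<epsilon>(2) by (simp add: F_def inf_last_def)
    \<comment> \<open>Distances to the finitely many other points of the ball, whose minimum
      isolates \<open>z\<close>. Including \<open>\<epsilon>\<close> keeps \<open>R\<close> nonempty
      and the minimum at most \<open>\<epsilon>\<close>, so that only points of the ball have to be
      considered.\<close>
    define R where "R = insert \<epsilon> ((\<lambda>y. \<rho> z [y]) ` {y \<in> F. [y] \<noteq> z})"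
    have fin: "finite R" "R \<noteq> {}" using \<open>finite F\<close> by (auto simp: R_def)
    have pos: "0 < v" if "v \<in> R" for v
      using that m z \<epsilon>(1) unfolding R_def F_def is_metric_def by (auto simp: less_le)
    have "w = z" if w: "w \<in> ?Q" "\<rho> z w < Min R" for w
    proof (rule ccontr)
      assume "w \<noteq> z"
      obtain y where y: "w = [y]" using w(1) Q by blast
      have "Min R \<le> \<epsilon>" using fin(1) by (intro Min_le) (simp_all add: R_def)
      then have "y \<in> F" using w y by (auto simp: F_def)
      then have "\<rho> z w \<in> R" using y \<open>w \<noteq> z\<close> by (auto simp: R_def)
      then show False using w(2) fin(1) by (meson Min_le leD)
    qed
    then show "\<exists>\<epsilon>>0. \<forall>w\<in>?Q. \<rho> z w < \<epsilon> \<longrightarrow> w = z" using pos[OF Min_in[OF fin]] by blast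
  qed
  moreover have "dset 1 ?Q" by (rule dset_box) (simp_all add: ab)
  ultimately have "finite ?Q" using nd unfolding no_discrete_def by blast
  then have "finite {\<alpha><..<\<beta>}" unfolding Q by (rule finite_imageD) (simp add: inj_on_def)
  then show False using infinite_Ioo[OF ab(3)] by blast
qed

text \<open>\<open>h\<close> will insert a fixed first or last coordinate. The metric is pulled back
  along \<open>h\<close>, and an infinite discrete subset of the box would have an infinite discrete
  image in \<open>Q\<close>.\<close>

lemma full_balls_slice:
  assumes IH: "\<And>a b \<rho>. length a = j \<Longrightarrow> list_all2 (<) a b \<Longrightarrow> dmetric j \<rho> \<Longrightarrow> is_metric (obox a b) \<rho> \<Longrightarrow>
      no_discrete j (obox a b) \<rho> \<Longrightarrow> \<exists>z\<in>obox a b. \<forall>\<epsilon>>0. dge j j {w \<in> obox a b. \<rho> z w < \<epsilon>}"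
    and dm: "dmetric N \<rho>" and m: "is_metric Q \<rho>" and nd: "no_discrete N Q \<rho>"
    and h: "\<And>L. dl j L \<Longrightarrow> dl N (\<lambda>e. h (L e))" and inj: "\<And>x y. h x = h y \<longleftrightarrow> x = y"
    and ab: "length a = j" "list_all2 (<) a b" and Q: "\<And>x. x \<in> obox a b \<Longrightarrow> h x \<in> Q"
  shows "\<exists>z\<in>obox a b. \<forall>\<epsilon>>0. dge j j {w \<in> obox a b. \<rho> (h z) (h w) < \<epsilon>}"
proof (rule IH[OF ab])
  show "dmetric j (\<lambda>x y. \<rho> (h x) (h y))" by (intro dmetricI df_metric[OF dm] h dintros)
  show "is_metric (obox a b) (\<lambda>x y. \<rho> (h x) (h y))"
    unfolding is_metric_def
  proof (intro ballI)
    fix x y assume xy: "x \<in> obox a b" "y \<in> obox a b"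
    have M: "0 \<le> \<rho> (h x) (h y)" "\<rho> (h x) (h y) = 0 \<longleftrightarrow> h x = h y" "\<rho> (h x) (h y) = \<rho> (h y) (h x)"
      "\<forall>z\<in>Q. \<rho> (h x) z \<le> \<rho> (h x) (h y) + \<rho> (h y) z"
      using m Q[OF xy(1)] Q[OF xy(2)] unfolding is_metric_def by blast+
    show "0 \<le> \<rho> (h x) (h y) \<and> (\<rho> (h x) (h y) = 0 \<longleftrightarrow> x = y) \<and> \<rho> (h x) (h y) = \<rho> (h y) (h x) \<and>
        (\<forall>z\<in>obox a b. \<rho> (h x) (h z) \<le> \<rho> (h x) (h y) + \<rho> (h y) (h z))"
      by (intro conjI ballI) (rule M(1) M(2)[unfolded inj] M(3) bspec[OF M(4) Q], assumption?)+
  qed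
  show "no_discrete j (obox a b) (\<lambda>x y. \<rho> (h x) (h y))"
    unfolding no_discrete_def
  proof (intro allI impI)
    fix Y assume Y: "Y \<subseteq> obox a b" "dset j Y" "metric_discrete (\<lambda>x y. \<rho> (h x) (h y)) Y"
    have "dp (\<lambda>e. \<exists>x. length x = j \<and> (x \<in> Y \<and> map e [0..<N] = h x))"
      by (intro qintros dp_mem[OF Y(2)] dp_eql[where n = N] h)
    moreover have "z \<in> h ` Y \<longleftrightarrow> (\<exists>x. length x = j \<and> (x \<in> Y \<and> z = h x))" for z
      using Y(1) length_box[of _ a b] ab by blast
    ultimately have "dset N (h ` Y)" by (simp add: dset_def)
    moreover have "h ` Y \<subseteq> Q" using Y(1) Q by auto
    moreover have "metric_discrete \<rho> (h ` Y)" using Y(3) by (simp add: metric_discrete_def inj)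
    ultimately have "finite (h ` Y)" using nd unfolding no_discrete_def by blast
    then show "finite Y" by (rule finite_imageD) (simp add: inj_on_def inj)
  qed
qed

text \<open>If every ball of the slices in the first and in the last coordinate has full dimension,
  then moving first inside a last-coordinate slice and then inside first-coordinate slices sweeps
  out a set of dimension one more.\<close>

lemma full_balls_Suc:
  assumes IH: "\<And>a b \<rho>. length a = j \<Longrightarrow> list_all2 (<) a b \<Longrightarrow> dmetric j \<rho> \<Longrightarrow> is_metric (obox a b) \<rho> \<Longrightarrow>
      no_discrete j (obox a b) \<rho> \<Longrightarrow> \<exists>z\<in>obox a b. \<forall>\<epsilon>>0. dge j j {w \<in> obox a b. \<rho> z w < \<epsilon>}"
    and j: "j = Suc i" and len: "length a = Suc j" and ab: "list_all2 (<) a b" and dm: "dmetric (Suc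
      j) \<rho>"
    and m: "is_metric (obox a b) \<rho>" and nd: "no_discrete (Suc j) (obox a b) \<rho>"
  shows "\<exists>z\<in>obox a b. \<forall>\<epsilon>>0. dge (Suc j) (Suc j) {w \<in> obox a b. \<rho> z w < \<epsilon>}"
proof -
  let ?Q = "obox a b"
  note \<rho> = df_metric[OF dm]
  have lenb: "length b = Suc j" using list_all2_lengthD[OF ab] len by simp
  have dQ: "dset (Suc j) ?Q" by (rule dset_box[OF len lenb])
  obtain a1 \<alpha> b1 \<beta> where ab1: "a = a1 @ [\<alpha>]" "b = b1 @ [\<beta>]" "length a1 = j" "length b1 = j"
    "list_all2 (<) a1 b1" "\<alpha> < \<beta>" using list_all2_snocE[OF ab len] by metis
  have last_slice: "\<exists>z\<in>obox a1 b1. \<forall>\<epsilon>>0. dge j j {w \<in> obox a1 b1. \<rho> (z @ [r]) (w @ [r]) < \<epsilon>}"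
    if r: "\<alpha> < r" "r < \<beta>" for r
  proof (rule full_balls_slice[OF IH dm m nd _ _ ab1(3,5), where h = "\<lambda>x. x @ [r]"])
    show "dl (Suc j) (\<lambda>e. L e @ [r])" if "dl j L" for L by (intro dl_snoc df_const that)
  qed (use r in \<open>simp_all add: ab1(1,2)\<close>)
  have first_slice: "\<exists>z\<in>obox a2 b2. \<forall>\<epsilon>>0. dge j j {w \<in> obox a2 b2. \<rho> (s # z) (s # w) < \<epsilon>}"
    if s: "length a2 = j" "list_all2 (<) a2 b2" and Q: "\<And>x. x \<in> obox a2 b2 \<Longrightarrow> s # x \<in> ?Q" for s a2 b2
  proof (rule full_balls_slice[OF IH dm m nd _ _ s, where h = "(#) s"])
    show "dl (Suc j) (\<lambda>e. s # L e)" if "dl j L" for L by (intro dl_Cons df_const that)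
  qed (use Q in simp_all)
  \<comment> \<open>Points with full-dimensional balls inside their first-coordinate slice. By
    \<open>first_slice\<close> every box in \<open>?Q\<close> contains such a point, so the
    complement of \<open>F\<close> does not have full dimension.\<close>
  define F where "F = {z. \<exists>x. length x = j \<and> (\<exists>s. z = s # x \<and>
     (\<forall>\<epsilon>. 0 < \<epsilon> \<longrightarrow> dge j j {y. s # y \<in> ?Q \<and> \<rho> (s # x) (s # y) < \<epsilon>}))}"
  have dF: "dset (Suc j) F"
    unfolding dset_def F_def mem_Collect_eq
    by (intro qintros dp_eql[where n = "Suc j"] dp_dge; (unfold mem_Collect_eq)?)
      (intro qintros dp_mem[OF dQ] \<rho>)
  have F: "s # x \<in> F \<longleftrightarrow> length x = j \<and> (\<forall>\<epsilon>. 0 < \<epsilon> \<longrightarrow> dge j j {y. s # y \<in> ?Q \<and> \<rho> (s # x) (s # y) < \<epsilon>})"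
    for s x by (auto simp: F_def)
  have B: "\<not> dge (Suc j) (Suc j) (?Q - F)"
  proof
    assume "dge (Suc j) (Suc j) (?Q - F)"
    moreover have "dset (Suc j) (?Q - F)" by (rule dset_Diff[OF dQ dF])
    ultimately obtain a' b' where a': "length a' = Suc j" "list_all2 (<) a' b'" "obox a' b' \<subseteq> ?Q -
      F"
      using box_and_continuity[of "Suc j"] unfolding box_property_def by blast
    then obtain c a2 d b2 where ab': "a' = c # a2" "b' = d # b2" "c < d" "length a2 = j" "list_all2
      (<) a2 b2"
      by (auto simp: length_Suc_conv list_all2_Cons1)
    obtain s where s: "c < s" "s < d" using dense[OF ab'(3)] by blast
    have sub: "s # x \<in> ?Q - F" if "x \<in> obox a2 b2" for x
      using subsetD[OF a'(3)[unfolded ab'(1,2)], of "s # x"] that s by simp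
    then have "\<exists>z\<in>obox a2 b2. \<forall>\<epsilon>>0. dge j j {w \<in> obox a2 b2. \<rho> (s # z) (s # w) < \<epsilon>}"
      using ab' by (intro first_slice) auto
    then obtain x where x: "x \<in> obox a2 b2" "\<And>\<epsilon>. 0 < \<epsilon> \<Longrightarrow> dge j j {w \<in> obox a2 b2. \<rho> (s # x) (s # w)
      < \<epsilon>}" by blast
    have "dge j j {y. s # y \<in> ?Q \<and> \<rho> (s # x) (s # y) < \<epsilon>}" if "0 < \<epsilon>" for \<epsilon>
      using x(2)[OF that] by (rule dge_mono) (use sub in blast)
    then have "s # x \<in> F" using length_box[OF x(1)] ab' by (simp add: F)
    then show False using sub[OF x(1)] by blast
  qed
  define C where "C r = {z. \<exists>x. length x = j \<and> (z = x @ [r] \<and> z \<in> ?Q - F)}" for r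
  have dC: "dfam (Suc j) C"
    unfolding dfam_def C_def mem_Collect_eq
    by (intro qintros dp_mem[OF dset_Diff[OF dQ dF]] dp_eql[where n = "Suc j"])
  \<comment> \<open>Infinitely many heights \<open>r\<close> with a \<open>j\<close>-dimensional
    exceptional set would, by \<open>dge_finite_to_one\<close>, give the complement of
    \<open>F\<close> full dimension. The height used below is one of the others.\<close>
  have "finite {r. dge (Suc j) j (C r)}"
  proof (rule ccontr)
    assume "infinite {r. dge (Suc j) j (C r)}"
    then have "dge (Suc j) (Suc j) (\<Union>r. C r)"
    proof (rule dge_finite_to_one[OF dC, rotated])
      fix z :: "'m list"
      have "{r. z \<in> C r} \<subseteq> {last z}" by (auto simp: C_def)
      then show "finite {r. z \<in> C r}" by (rule finite_subset) simp
    qed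
    then have "dge (Suc j) (Suc j) (?Q - F)" by (rule dge_mono) (auto simp: C_def)
    then show False using B by blast
  qed
  then have "infinite ({\<alpha><..<\<beta>} - {r. dge (Suc j) j (C r)})" using infinite_Ioo[OF ab1(6)] by simp
  then have "{\<alpha><..<\<beta>} - {r. dge (Suc j) j (C r)} \<noteq> {}" by (rule infinite_imp_nonempty)
  then obtain r where "r \<in> {\<alpha><..<\<beta>} - {r. dge (Suc j) j (C r)}" unfolding ex_in_conv[symmetric] ..
  then have r: "\<alpha> < r" "r < \<beta>" "\<not> dge (Suc j) j (C r)"
    unfolding Diff_iff mem_Collect_eq greaterThanLessThan_iff by blast+
  have r': "\<not> dge j j {x. x @ [r] \<in> ?Q - F}"
  proof
    assume "dge j j {x. x @ [r] \<in> ?Q - F}"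
    then have "dge j j (proj_last (C r))" by (rule dge_mono) (auto simp: proj_last_def C_def)
    then show False using r(3) by simp
  qed
  obtain z0 where z0: "z0 \<in> obox a1 b1"
    "\<And>\<epsilon>. 0 < \<epsilon> \<Longrightarrow> dge j j {w \<in> obox a1 b1. \<rho> (z0 @ [r]) (w @ [r]) < \<epsilon>}"
    using last_slice[OF r(1,2)] by blast
  define z where "z = z0 @ [r]"
  have lz: "length z = Suc j" using length_box[OF z0(1)] ab1 by (simp add: z_def)
  have zQ: "z \<in> ?Q" using z0(1) r(1,2) by (simp add: z_def ab1)
  have "dge (Suc j) (Suc j) {w \<in> ?Q. \<rho> z w < \<eta>}" if \<eta>: "0 < \<eta>" for \<eta>
  proof -
    obtain \<epsilon> where \<epsilon>: "0 < \<epsilon>" "\<epsilon> + \<epsilon> < \<eta>" using ex_double_less[OF \<eta>] by blast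
    \<comment> \<open>The ball around \<open>z\<close> within the slice at height \<open>r\<close>,
      without exceptional points. By the choice of \<open>r\<close> it still has dimension
      \<open>j\<close>, hence contains a box and meets the first-coordinate slices for an interval
      of \<open>s\<close>.\<close>
    define A where "A = {x. x @ [r] \<in> ?Q \<and> \<rho> z (x @ [r]) < \<epsilon> \<and> x @ [r] \<in> F}"
    have dA: "dset j A"
      unfolding dset_def A_def mem_Collect_eq
      by (intro qintros dp_mem[OF dQ] dp_mem[OF dF] \<rho> dl_const lz)
    have "dge j j (A \<union> {x. x @ [r] \<in> ?Q - F})"
      using z0(2)[OF \<epsilon>(1)] by (rule dge_mono) (use r(1,2) in \<open>auto simp: A_def z_def ab1\<close>)
    then have A: "dge j j A" using r' dge_Un by blast
    \<comment> \<open>Starting from the points of \<open>A\<close> with first coordinate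
      \<open>s\<close>, one moves by less than \<open>\<epsilon>\<close> inside the slice of first
      coordinate \<open>s\<close>. \<open>E s\<close> puts \<open>s\<close> back in front, so
      different \<open>E s\<close> are disjoint, and all its points are at distance less than
      \<open>\<epsilon> + \<epsilon>\<close> from \<open>z\<close>.\<close>
    define V where "V s = {y. s # y \<in> ?Q \<and> (\<exists>x. length x = i \<and> (s # x \<in> A \<and> \<rho> (s # x @ [r]) (s # y)
      < \<epsilon>))}" for s
    define E where "E s = {w. \<exists>y. length y = j \<and> (w = s # y \<and> y \<in> V s)}" for s
    have dE: "dfam (Suc j) E"
    proof -
      have A': "dl (Suc i) L \<Longrightarrow> dp (\<lambda>e. L e \<in> A)" for L using dp_mem[OF dA] j by simp
      have R': "dl (Suc (Suc i)) L \<Longrightarrow> dl (Suc j) K \<Longrightarrow> df (\<lambda>e. \<rho> (L e) (K e))" for L K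
        using \<rho> j by simp
      show ?thesis
        unfolding dfam_def E_def V_def mem_Collect_eq
        by (intro qintros dp_mem[OF dQ] R' A' dp_eql[where n = "Suc j"])
    qed
    have "dge (Suc j) (Suc j) (\<Union>s. E s)"
    proof (rule dge_finite_to_one[OF dE])
      fix w :: "'m list"
      have "{s. w \<in> E s} \<subseteq> {hd w}" by (auto simp: E_def)
      then show "finite {s. w \<in> E s}" by (rule finite_subset) simp
    next
      obtain a' b' where a': "length a' = j" "list_all2 (<) a' b'" "obox a' b' \<subseteq> A"
        using box_and_continuity[of j] dA A unfolding box_property_def by blast
      then obtain c a2 d b2 where ab': "a' = c # a2" "b' = d # b2" "c < d" "length a2 = i"
        "list_all2 (<) a2 b2"
        by (auto simp: length_Suc_conv list_all2_Cons1 j)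
      obtain x where x: "x \<in> obox a2 b2" using box_nonempty[OF ab'(5)] by blast
      have "dge (Suc j) j (E s)" if s: "c < s" "s < d" for s
      proof -
        have sx: "s # x \<in> A" using subsetD[OF a'(3)[unfolded ab'(1,2)], of "s # x"] x s by simp
        then have "s # x @ [r] \<in> F" by (simp add: A_def)
        then have "dge j j {y. s # y \<in> ?Q \<and> \<rho> (s # x @ [r]) (s # y) < \<epsilon>}"
          using \<epsilon>(1) by (simp add: F)
        then have "dge j j (V s)"
          by (rule dge_mono) (use sx length_box[OF x] ab' in \<open>auto simp: V_def\<close>)
        from dge_Cons_image[OF this, of s] show ?thesis by (rule dge_mono) (auto simp: E_def)
      qed
      then have "{c<..<d} \<subseteq> {s. dge (Suc j) j (E s)}"
        unfolding subset_iff greaterThanLessThan_iff mem_Collect_eq by blast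
      then show "infinite {s. dge (Suc j) j (E s)}"
        using infinite_Ioo[OF ab'(3)] finite_subset by blast
    qed
    then show ?thesis
    proof (rule dge_mono)
      fix w assume "w \<in> (\<Union>s. E s)"
      then obtain s x where w: "w \<in> ?Q" "s # x \<in> A" "\<rho> (s # x @ [r]) w < \<epsilon>"
        by (auto simp: E_def V_def)
      then have "s # x @ [r] \<in> ?Q" "\<rho> z (s # x @ [r]) < \<epsilon>" by (auto simp: A_def)
      then have "\<rho> z w < \<epsilon> + \<epsilon>" using is_metric_triangle[OF m zQ _ w(1)] w(3) by blast
      then show "w \<in> {w \<in> ?Q. \<rho> z w < \<eta>}" using \<epsilon>(2) w(1) by auto
    qed
  qed
  then show ?thesis using zQ by blast
qed

lemma full_balls:
  "length a = j \<Longrightarrow> list_all2 (<) a b \<Longrightarrow> dmetric j \<rho> \<Longrightarrow> is_metric (obox a b) \<rho> \<Longrightarrow>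
     no_discrete j (obox a b) \<rho> \<Longrightarrow> \<exists>z\<in>obox a b. \<forall>\<epsilon>>0. dge j j {w \<in> obox a b. \<rho> z w < \<epsilon>}"
proof (induction j arbitrary: a b \<rho>)
  case 0
  then have "a = []" "b = []" by auto
  moreover have "\<rho> [] [] = 0" using 0(4) by (simp add: is_metric_def \<open>a = []\<close> \<open>b = []\<close>)
  ultimately show ?case by simp
next
  case (Suc j)
  show ?case
  proof (cases j)
    case 0
    obtain \<alpha> \<beta> where "a = [\<alpha>]" "b = [\<beta>]" "\<alpha> < \<beta>"
      using Suc.prems(1,2) 0 by (auto simp: length_Suc_conv list_all2_Cons1)
    then show ?thesis using full_balls_1[of a \<alpha> b \<beta> \<rho>] Suc.prems 0 by simp
  next
    case (Suc i)
    then show ?thesis using full_balls_Suc[OF Suc.IH _ Suc.prems] by blast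
  qed
qed

lemma ex_full_ball_point:
  assumes dm: "dmetric n \<rho>" and m: "is_metric X \<rho>" and nd: "no_discrete n X \<rho>"
    and Z: "Z \<subseteq> X" "dset n Z" "dge n k Z"
  shows "\<exists>z\<in>Z. \<forall>\<epsilon>>0. dge n k {w \<in> Z. \<rho> z w < \<epsilon>}"
proof -
  obtain ks a b C where C: "scell ks a b C" "length ks = n" "length a = k" "C \<subseteq> Z"
    using dge_imp_scell[OF Z(2,3)] by blast
  note len = scell_basic(2)[OF C(1)]
  have kk: "k = length (sel_idx ks)" using len C(3) by simp
  have dC: "dset n C" using scell_dset[OF C(1)] C(2) by simp
  have lenC: "length x = n" if "x \<in> C" for x using that scell_basic(1)[OF C(1)] C(2) by auto
  have inj: "inj_on (sel ks) C" and im: "sel ks ` C = obox a b"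
    using scell_bij[OF C(1)] by (auto simp: bij_betw_def)
  have dsel: "dl n L \<Longrightarrow> dl k (\<lambda>e. sel ks (L e))" for L using dl_sel[of ks L] C(2) kk by simp
  define R where "R q q' v \<longleftrightarrow> (\<exists>x. length x = n \<and> (\<exists>y. length y = n \<and>
      (x \<in> C \<and> y \<in> C \<and> sel ks x = q \<and> sel ks y = q' \<and> v = \<rho> x y)))" for q q' v
  \<comment> \<open>The metric on the cell, expressed in its free coordinates. It need not be
    continuous for the order topology; all that matters is that \<open>sel ks\<close> is a definable
    bijection from the cell to the box.\<close>
  define \<sigma> where "\<sigma> q q' = the0 (R q q')" for q q'
  have \<sigma>: "\<sigma> (sel ks x) (sel ks y) = \<rho> x y" if "x \<in> C" "y \<in> C" for x y
    unfolding \<sigma>_def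
  proof (rule the0_eq)
    show "R (sel ks x) (sel ks y) (\<rho> x y)" using that lenC unfolding R_def by blast
    show "v = \<rho> x y" if "R (sel ks x) (sel ks y) v" for v
    proof -
      obtain x' y' where "x' \<in> C" "y' \<in> C" "sel ks x' = sel ks x" "sel ks y' = sel ks y" "v = \<rho> x'
        y'"
        using \<open>R (sel ks x) (sel ks y) v\<close> unfolding R_def by blast
      then show ?thesis using inj_onD[OF inj] \<open>x \<in> C\<close> \<open>y \<in> C\<close> by metis
    qed
  qed
  have d\<sigma>: "dmetric k \<sigma>"
  proof (rule dmetricI, unfold \<sigma>_def, rule df_the0)
    show "dp (\<lambda>e. R (map (\<lambda>i. e (Suc i)) [0..<k]) (map (\<lambda>i. e (Suc (k + i))) [0..<k]) (e 0))"
      unfolding R_def by (intro qintros dp_mem[OF dC] df_metric[OF dm] dp_eql[where n = k] dsel)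
  qed
  have "is_metric (obox a b) \<sigma>"
    unfolding is_metric_def im[symmetric]
    using m C(4) Z(1) by (auto simp: \<sigma> is_metric_def subset_iff inj_on_eq_iff[OF inj])
  moreover have "no_discrete k (obox a b) \<sigma>"
    unfolding no_discrete_def
  proof (intro allI impI)
    fix Y assume Y: "Y \<subseteq> obox a b" "dset k Y" "metric_discrete \<sigma> Y"
    let ?Y = "{x \<in> C. sel ks x \<in> Y}"
    have "dset n ?Y"
      unfolding dset_def mem_Collect_eq by (intro qintros dp_mem[OF dC] dp_mem[OF Y(2)] dsel)
    moreover have "metric_discrete \<rho> ?Y"
      unfolding metric_discrete_def
    proof
      fix x assume x: "x \<in> ?Y"
      then obtain \<epsilon> where \<epsilon>: "0 < \<epsilon>" "\<And>q. q \<in> Y \<Longrightarrow> \<sigma> (sel ks x) q < \<epsilon> \<Longrightarrow> q = sel ks x"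
        using Y(3) unfolding metric_discrete_def by blast
      have "y = x" if "y \<in> ?Y" "\<rho> x y < \<epsilon>" for y
        using \<epsilon>(2)[of "sel ks y"] that x \<sigma> inj_onD[OF inj] by auto
      then show "\<exists>\<epsilon>>0. \<forall>y\<in>?Y. \<rho> x y < \<epsilon> \<longrightarrow> y = x" using \<epsilon>(1) by blast
    qed
    moreover have "?Y \<subseteq> X" using C(4) Z(1) by blast
    ultimately have "finite ?Y" using nd unfolding no_discrete_def by blast
    moreover have "Y \<subseteq> sel ks ` ?Y" using Y(1) im by auto
    ultimately show "finite Y" by (meson finite_imageI finite_subset)
  qed
  ultimately obtain q where q: "q \<in> obox a b" "\<And>\<epsilon>. 0 < \<epsilon> \<Longrightarrow> dge k k {w \<in> obox a b. \<sigma> q w < \<epsilon>}"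
    using full_balls[OF C(3) scell_basic(4)[OF C(1)] d\<sigma>] by blast
  obtain z where z: "z \<in> C" "q = sel ks z" using q(1) im by blast
  have "dge n k {w \<in> Z. \<rho> z w < \<epsilon>}" if \<epsilon>: "0 < \<epsilon>" for \<epsilon>
  proof -
    have lab: "length a = k" "length b = k"
      using C(3) list_all2_lengthD[OF scell_basic(4)[OF C(1)]] by auto
    have "dset k {w \<in> obox a b. \<sigma> q w < \<epsilon>}"
      unfolding dset_def mem_Collect_eq
      by (intro qintros dp_mem[OF dset_box[OF lab]] df_metric[OF d\<sigma>] dl_const) (use length_box[OF
        q(1)] lab in simp)
    \<comment> \<open>A full-dimensional part of the box contains a smaller box, whose preimage is
      again a cell of dimension \<open>k\<close>. In this way dimension passes from the box back to
      \<open>Z\<close>.\<close>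
    then obtain a' b' where ab': "length a' = k" "list_all2 (<) a' b'" "obox a' b' \<subseteq> {w \<in> obox a b.
      \<sigma> q w < \<epsilon>}"
      using box_and_continuity[of k] q(2)[OF \<epsilon>] unfolding box_property_def by blast
    have C': "scell ks a' b' {x \<in> C. sel ks x \<in> obox a' b'}"
      by (rule scell_restrict[OF C(1)]) (use ab' C in auto)
    have "dge n k {x \<in> C. sel ks x \<in> obox a' b'}"
      using cell_dge[OF scell_cell[OF C']] scell_basic(3)[OF C'] ab'(1) C(2) by simp
    then show ?thesis
    proof (rule dge_mono)
      fix x assume x: "x \<in> {x \<in> C. sel ks x \<in> obox a' b'}"
      then have "\<sigma> q (sel ks x) < \<epsilon>" using ab'(3) by blast
      then show "x \<in> {w \<in> Z. \<rho> z w < \<epsilon>}" using x z \<sigma> C(4) by auto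
    qed
  qed
  then show ?thesis using z(1) C(4) by blast
qed

end

section \<open>Definable metric spaces\<close>

context o_minimal_structure
begin

text \<open>Choice of tuples from choice on the line: a point of the projection is chosen first,
  then its last coordinate. Like \<open>ch\<close> it depends on the set only.\<close>

primrec list_choice :: "nat \<Rightarrow> 'm list set \<Rightarrow> 'm list" where
  "list_choice 0 S = []"
| "list_choice (Suc n) S = list_choice n (proj_last S) @ [ch {y. list_choice n (proj_last S) @ [y] \<in>
  S}]"

lemma length_list_choice [simp]: "length (list_choice n S) = n"
  by (induction n arbitrary: S) auto

lemma list_choice_mem: "dset n S \<Longrightarrow> x \<in> S \<Longrightarrow> length x = n \<Longrightarrow> list_choice n S \<in> S"
proof (induction n arbitrary: S x)
  case (Suc n)
  obtain x' y where x: "x = x' @ [y]" "length x' = n"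
    using Suc.prems(3) by (auto simp: length_Suc_conv_rev)
  then have "x' \<in> proj_last S" using Suc.prems(2) by (auto simp: proj_last_def)
  then have "list_choice n (proj_last S) \<in> proj_last S"
    using Suc.IH dset_proj_last[OF Suc.prems(1)] x(2) by blast
  then obtain v where v: "list_choice n (proj_last S) @ [v] \<in> S" by (auto simp: proj_last_def)
  have "dp1 {y. list_choice n (proj_last S) @ [y] \<in> S}"
    unfolding dp1_def mem_Collect_eq
    by (intro dp_mem[OF Suc.prems(1)] dl_snoc dl_const length_list_choice df_var)
  then have "ch {y. list_choice n (proj_last S) @ [y] \<in> S} \<in> {y. list_choice n (proj_last S) @ [y] \<in>
    S}"
    by (rule ch_mem) (use v in simp)
  then show ?case by simp
qed auto

lemma dl_list_choice:
  "dp (\<lambda>e. map e [0..<n] \<in> S (\<lambda>i. e (n + i))) \<Longrightarrow> dl n (\<lambda>e. list_choice n (S e))"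
proof (induction n arbitrary: S)
  case 0
  then show ?case by (simp add: dl_def)
next
  case (Suc n)
  have S: "dl (Suc n) L \<Longrightarrow> (\<And>i. df (\<lambda>e. g e i)) \<Longrightarrow> dp (\<lambda>e. L e \<in> S (g e))" for L g
    using Suc.prems by (rule dp_list_comp[where P = "\<lambda>x e. x \<in> S e"])
  have IH: "dl n (\<lambda>e. list_choice n (proj_last (S e)))"
    by (rule Suc.IH) (unfold proj_last_def mem_Collect_eq, intro S qintros)
  have IH': "dl n (\<lambda>e. list_choice n (proj_last (S (\<lambda>i. e (Suc i)))))"
    unfolding dl_def using IH
      by (auto simp: dl_def intro: df_shift[where f = Suc and t = "\<lambda>e. list_choice n (proj_last (S
        e)) ! i" for i])
  show ?case
    unfolding list_choice.simps by (intro dl_snoc IH df_ch S IH' df_var)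
qed

lemma dl_take: "dl N L \<Longrightarrow> n \<le> N \<Longrightarrow> dl n (\<lambda>e. take n (L e))"
  by (auto simp: dl_def)

lemma o_dim_eq_maximal:
  assumes "definable \<M> n A" "definable \<M> n B" "A \<subseteq> B" "dge n k A" "\<not> dge n (Suc k) B"
  shows "o_dim \<M> A = o_dim \<M> B"
proof (rule o_dim_eqI[OF assms(1,2)])
  fix i
  have "dge n i A" if "dge n i B"
  proof -
    have "i \<le> k" using assms(5) dge_antimono[OF that, of "Suc k"] by (meson not_less_eq_eq)
    then show ?thesis by (rule dge_antimono[OF assms(4)])
  qed
  moreover have "dge n i B" if "dge n i A" using that by (rule dge_mono) (use assms(3) in blast)
  ultimately show "dge n i A \<longleftrightarrow> dge n i B" by blast
qed

end

declare dge.simps(2) [simp del]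

section \<open>Dimension of products with free or fixed coordinates\<close>

lemma dge_prod_infinite:
  assumes "\<And>x y. length x = l \<Longrightarrow> x @ [y] \<in> S' \<longleftrightarrow> x \<in> S \<and> y \<in> F" and "infinite F"
  shows "dge (Suc l) (Suc k) S' \<longleftrightarrow> dge l k S"
proof -
  obtain y where y: "y \<in> F" using infinite_imp_nonempty[OF assms(2)] by blast
  have "dge l k' (proj_last S') \<longleftrightarrow> dge l k' S" for k'
    by (rule iffI; erule dge_mono) (use y assms(1) in \<open>auto simp: proj_last_def\<close>)
  moreover have "dge l k' (inf_last S') \<longleftrightarrow> dge l k' S" for k'
    by (rule iffI; erule dge_mono) (use assms in \<open>auto simp: inf_last_def dest:
      infinite_imp_nonempty\<close>)
  ultimately show ?thesis using dge_Suc_imp by (auto simp: dge.simps(2))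
qed

lemma dge_prod_single:
  assumes "\<And>x y. length x = l \<Longrightarrow> x @ [y] \<in> S' \<longleftrightarrow> x \<in> S \<and> y = v"
  shows "dge (Suc l) k S' \<longleftrightarrow> dge l k S"
proof -
  have "dge l k' (proj_last S') \<longleftrightarrow> dge l k' S" for k'
    by (rule iffI; erule dge_mono) (use assms in \<open>auto simp: proj_last_def\<close>)
  moreover have "\<not> dge l k' (inf_last S')" for k'
  proof
    assume "dge l k' (inf_last S')"
    then have "dge l k' ({} :: 'a list set)"
      by (rule dge_mono) (use assms in \<open>auto simp: inf_last_def\<close>)
    then show False by simp
  qed
  ultimately show ?thesis by (simp add: dge.simps(2))
qed

lemma arbitrary_union_of_mem:
  assumes "(arbitrary union_of P) S" "x \<in> S" shows "\<exists>V. P V \<and> x \<in> V \<and> V \<subseteq> S"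
proof -
  obtain F where "F \<subseteq> Collect P" "\<Union>F = S" using assms(1) unfolding union_of_def by blast
  then show ?thesis using assms(2) by blast
qed

text \<open>\<open>E \<times> J\<close> followed by free coordinates up to position \<open>s\<close> and by zeros after it.\<close>

definition padded :: "nat \<Rightarrow> nat \<Rightarrow> 'a::zero list set \<Rightarrow> 'a set \<Rightarrow> nat \<Rightarrow> 'a list set" where
  "padded n s E J l = {b. length b = l \<and> take n b \<in> E \<and> (n < l \<longrightarrow> b ! n \<in> J) \<and> (\<forall>i<l. s \<le> i \<longrightarrow> b ! i =
    0)}"

text \<open>Each coordinate from position \<open>n\<close> up to \<open>s\<close> has an infinite
  fibre and adds one to the dimension, each later one is fixed at 0 and adds nothing. The condition
  \<open>n < s\<close> ensures that the coordinate ranging over \<open>J\<close> is among the free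
  ones.\<close>

lemma dge_padded:
  fixes J :: "'a::zero set"
  assumes J: "infinite J" and "n < s" and "n \<le> l"
  shows "dge l (j + (min l s - n)) (padded n s E J l) \<longleftrightarrow> dge n j E"
  using assms(3)
proof (induction l rule: dec_induct)
  case base
  have "dge n j (padded n s E J n) \<longleftrightarrow> dge n j E"
    by (rule iffI; erule dge_mono) (use assms(2) in \<open>auto simp: padded_def\<close>)
  then show ?case by simp
next
  case (step l)
  have UN: "infinite (UNIV :: 'a set)" using J by (meson finite_subset subset_UNIV)
  have snoc: "x @ [y] \<in> padded n s E J (Suc l) \<longleftrightarrow>
      x \<in> padded n s E J l \<and> (n = l \<longrightarrow> y \<in> J) \<and> (s \<le> l \<longrightarrow> y = 0)" if "length x = l" for x y
    using that step.hyps by (auto simp: padded_def nth_append less_Suc_eq all_conj_distrib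
      imp_conjL)
  show ?case
  proof (cases "l < s")
    case True
    have *: "dge (Suc l) (Suc k) (padded n s E J (Suc l)) \<longleftrightarrow> dge l k (padded n s E J l)" for k
      by (rule dge_prod_infinite[where F = "if n = l then J else UNIV"])
        (use True J UN in \<open>auto simp: snoc\<close>)
    have "j + (min (Suc l) s - n) = Suc (j + (min l s - n))" using True step.hyps by simp
    then show ?thesis using * step.IH by (simp only:)
  next
    case False
    have *: "dge (Suc l) k (padded n s E J (Suc l)) \<longleftrightarrow> dge l k (padded n s E J l)" for k
      by (rule dge_prod_single[where v = 0]) (use False assms(2) step.hyps in \<open>auto simp: snoc\<close>)
    have "j + (min (Suc l) s - n) = j + (min l s - n)" using False by simp
    then show ?thesis using * step.IH by (simp only:)
  qed
qed

locale definable_metric = o_minimal_structure \<M>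
  for \<M> :: "('f, 'r, 'm::{linordered_group_add, unbounded_dense_linorder}) expansion" +
  fixes n :: nat and X :: "'m list set" and d :: "'m list \<Rightarrow> 'm list \<Rightarrow> 'm"
  assumes metric_space: "definable_metric_space \<M> n X d"
begin

text \<open>Nothing is known about \<open>d\<close> outside \<open>X\<close>, so it cannot be used
  in formulas that range over all tuples. Reading the value off the definable graph gives a total
  definable function that agrees with \<open>d\<close> on \<open>X\<close>.\<close>

definition dist_on :: "'m list \<Rightarrow> 'm list \<Rightarrow> 'm" where
  "dist_on x y = the0 (\<lambda>v. x @ y @ [v] \<in> {x @ y @ [d x y] | x y. x \<in> X \<and> y \<in> X})"

lemma len_X: "x \<in> X \<Longrightarrow> length x = n"
  using metric_space by (auto simp: definable_metric_space_def definable_iff)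

lemma dset_X: "dset n X"
  using metric_space by (auto simp: definable_metric_space_def definable_iff)

lemma dist_on_eq:
  assumes "x \<in> X" "y \<in> X" shows "dist_on x y = d x y"
  unfolding dist_on_def
proof (rule the0_eq)
  show "x @ y @ [d x y] \<in> {x @ y @ [d x y] | x y. x \<in> X \<and> y \<in> X}" using assms by blast
  fix v assume "x @ y @ [v] \<in> {x @ y @ [d x y] | x y. x \<in> X \<and> y \<in> X}"
  then obtain x' y' where "x @ y @ [v] = x' @ y' @ [d x' y']" "x' \<in> X" "y' \<in> X" by blast
  then show "v = d x y" using len_X assms by (simp add: append_eq_append_conv)
qed

lemma dmetric_dist_on: "dmetric n dist_on"
proof (rule dmetricI, unfold dist_on_def, rule df_the0)
  have G: "dset (Suc (n + n)) {x @ y @ [d x y] | x y. x \<in> X \<and> y \<in> X}"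
    using metric_space by (simp add: definable_metric_space_def definable_iff mult_2)
  have "dl (Suc (n + n)) (\<lambda>e. map (\<lambda>i. e (Suc i)) [0..<n] @ map (\<lambda>i. e (Suc (n + i))) [0..<n] @ [e
    0])"
    unfolding append_assoc[symmetric] by (intro dl_snoc dl_append dl_map df_var)
  then show "dp (\<lambda>e. map (\<lambda>i. e (Suc i)) [0..<n] @ map (\<lambda>i. e (Suc (n + i))) [0..<n] @ [e 0]
      \<in> {x @ y @ [d x y] | x y. x \<in> X \<and> y \<in> X})"
    by (rule dp_mem[OF G])
qed

lemmas df_dist = df_metric[OF dmetric_dist_on]

lemma is_metric_dist: "is_metric X dist_on"
  using metric_space by (simp add: is_metric_def dist_on_eq definable_metric_space_def)

lemma dist_self [simp]: "x \<in> X \<Longrightarrow> dist_on x x = 0"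
  using is_metric_dist by (simp add: is_metric_def)

lemma dist_sym: "x \<in> X \<Longrightarrow> y \<in> X \<Longrightarrow> dist_on x y = dist_on y x"
  using is_metric_dist by (simp add: is_metric_def)

lemmas dist_triangle_less = is_metric_triangle[OF is_metric_dist]

section \<open>Balls and the metric topology\<close>

definition ball :: "'m list \<Rightarrow> 'm \<Rightarrow> 'm list set" where
  "ball x t = {y \<in> X. dist_on x y < t}"

lemma ball_eq: "x \<in> X \<Longrightarrow> metric_ball X d x t = ball x t"
  by (auto simp: metric_ball_def ball_def dist_on_eq)

lemma ball_center: "x \<in> X \<Longrightarrow> 0 < t \<Longrightarrow> x \<in> ball x t"
  by (simp add: ball_def)

lemma ball_open:
  assumes "x \<in> X" "y \<in> ball x t" obtains s where "0 < s" "ball y s \<subseteq> ball x t"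
proof -
  have y: "y \<in> X" "dist_on x y < t" using assms(2) by (auto simp: ball_def)
  show ?thesis
  \<comment> \<open>The order of the summands is chosen such that adding \<open>dist_on x y\<close>
    on the left cancels without commutativity.\<close>
  proof (rule that[of "- dist_on x y + t"])
    show "0 < - dist_on x y + t" using y by simp
    show "ball y (- dist_on x y + t) \<subseteq> ball x t"
    proof
      fix z assume z: "z \<in> ball y (- dist_on x y + t)"
      then have "dist_on x z \<le> dist_on x y + dist_on y z"
        using is_metric_dist assms y unfolding is_metric_def ball_def by blast
      also have "\<dots> < dist_on x y + (- dist_on x y + t)"
        using z by (simp only: group_add_less_left) (simp add: ball_def)
      finally show "z \<in> ball x t" using z by (simp add: ball_def flip: add.assoc)
    qed
  qed
qed

lemma ball_nbhd: "x \<in> X \<Longrightarrow> y \<in> ball x t \<Longrightarrow> \<exists>s>0. ball y s \<subseteq> ball x t"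
  using ball_open[of x y t] by metis

lemma ball_subset: "ball x t \<subseteq> X"
  by (auto simp: ball_def)

lemma ball_mono: "s \<le> t \<Longrightarrow> ball x s \<subseteq> ball x t"
  by (auto simp: ball_def)

lemma topspace_metric_top [simp]: "topspace (metric_top X d) = X"
proof -
  obtain t :: 'm where t: "0 < t" using gt_ex by blast
  have "x \<in> \<Union>{metric_ball X d x t | x t. x \<in> X \<and> 0 < t}" if "x \<in> X" for x
    using that t ball_center[OF that t] ball_eq[OF that, of t] by blast
  then show ?thesis
    unfolding metric_top_def topology_generated_by_topspace by (auto simp: metric_ball_def)
qed

lemma openin_metric_top:
  "openin (metric_top X d) S \<longleftrightarrow> S \<subseteq> X \<and> (\<forall>x\<in>S. \<exists>t>0. ball x t \<subseteq> S)"
proof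
  assume "openin (metric_top X d) S"
  then have "generate_topology_on {metric_ball X d x t | x t. x \<in> X \<and> 0 < t} S"
    by (simp add: metric_top_def openin_topology_generated_by_iff)
  then show "S \<subseteq> X \<and> (\<forall>x\<in>S. \<exists>t>0. ball x t \<subseteq> S)"
  proof induction
    case Empty
    then show ?case by simp
  next
    case (Int a b)
    show ?case
    proof (intro conjI ballI)
      fix x assume "x \<in> a \<inter> b"
      then obtain s t where st: "0 < s" "ball x s \<subseteq> a" "0 < t" "ball x t \<subseteq> b" using Int by blast
      then have "ball x (min s t) \<subseteq> a \<inter> b"
        using ball_mono[of "min s t" s x] ball_mono[of "min s t" t x] by auto
      then show "\<exists>t>0. ball x t \<subseteq> a \<inter> b" using st by (intro exI[of _ "min s t"]) simp
    qed (use Int in blast)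
  next
    case (UN K)
    then show ?case by blast
  next
    case (Basis s)
    then obtain x t where s: "s = ball x t" "x \<in> X" using ball_eq by blast
    then show ?case using ball_nbhd[OF s(2)] ball_subset by simp
  qed
next
  assume S: "S \<subseteq> X \<and> (\<forall>x\<in>S. \<exists>t>0. ball x t \<subseteq> S)"
  show "openin (metric_top X d) S"
  proof (subst openin_subopen, intro ballI)
    fix x assume x: "x \<in> S"
    then obtain t where t: "0 < t" "ball x t \<subseteq> S" using S by blast
    have "x \<in> X" using x S by blast
    then have "openin (metric_top X d) (ball x t)"
      unfolding metric_top_def using t by (intro topology_generated_by_Basis) (use ball_eq in blast)
    then show "\<exists>T. openin (metric_top X d) T \<and> x \<in> T \<and> T \<subseteq> S"
      using t ball_center[OF \<open>x \<in> X\<close> t(1)] by blast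
  qed
qed

lemma openin_ball: "x \<in> X \<Longrightarrow> openin (metric_top X d) (ball x t)"
  unfolding openin_metric_top using ball_nbhd ball_subset by blast

lemma discrete_iff:
  assumes Y: "Y \<subseteq> X"
  shows "subtopology (metric_top X d) Y = discrete_topology Y \<longleftrightarrow> metric_discrete dist_on Y"
proof -
  have "subtopology (metric_top X d) Y = discrete_topology Y \<longleftrightarrow> (\<forall>y\<in>Y. openin (subtopology
    (metric_top X d) Y) {y})"
    using discrete_topology_unique[of Y "subtopology (metric_top X d) Y"] Y
      by (auto simp: inf_absorb2)
  also have "\<dots> \<longleftrightarrow> metric_discrete dist_on Y"
    unfolding metric_discrete_def
  proof (intro ball_cong refl iffI)
    fix y assume y: "y \<in> Y" and "openin (subtopology (metric_top X d) Y) {y}"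
    then obtain T where T: "openin (metric_top X d) T" "{y} = T \<inter> Y"
      by (auto simp: openin_subtopology)
    then obtain t where t: "0 < t" "ball y t \<subseteq> T" unfolding openin_metric_top by blast
    have "z = y" if "z \<in> Y" "dist_on y z < t" for z
      using that t T(2) Y by (auto simp: ball_def)
    then show "\<exists>\<epsilon>>0. \<forall>z\<in>Y. dist_on y z < \<epsilon> \<longrightarrow> z = y" using t(1) by blast
  next
    fix y assume y: "y \<in> Y" and "\<exists>\<epsilon>>0. \<forall>z\<in>Y. dist_on y z < \<epsilon> \<longrightarrow> z = y"
    then obtain \<epsilon> where \<epsilon>: "0 < \<epsilon>" "\<And>z. z \<in> Y \<Longrightarrow> dist_on y z < \<epsilon> \<Longrightarrow> z = y" by blast
    have yX: "y \<in> X" using y Y by blast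
    have "{y} = ball y \<epsilon> \<inter> Y" using \<epsilon> y yX ball_center[OF yX \<epsilon>(1)] by (auto simp: ball_def)
    then show "openin (subtopology (metric_top X d) Y) {y}"
      unfolding openin_subtopology using openin_ball[OF yX] by blast
  qed
  finally show ?thesis .
qed

lemma no_discrete_iff:
  "no_discrete n X dist_on \<longleftrightarrow>
     \<not> (\<exists>Y. infinite Y \<and> definable_discrete_subspace \<M> n (metric_top X d) Y)"
proof -
  have "definable_discrete_subspace \<M> n (metric_top X d) Y \<longleftrightarrow> Y \<subseteq> X \<and> dset n Y \<and> metric_discrete
    dist_on Y" for Y
    unfolding definable_discrete_subspace_def topspace_metric_top definable_iff
    using discrete_iff len_X by blast
  then show ?thesis unfolding no_discrete_def by blast
qed

section \<open>Separability and discrete subspaces\<close>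

lemma separable_imp_no_discrete:
  assumes sep: "definably_separable \<M> n (metric_top X d)"
  shows "no_discrete n X dist_on"
  unfolding no_discrete_def
proof (intro allI impI, rule ccontr)
  fix Y assume Y: "Y \<subseteq> X" "dset n Y" "metric_discrete dist_on Y" "infinite Y"
  \<comment> \<open>Instead of naming half the distance from \<open>y\<close> to the rest of
    \<open>Y\<close>, some \<open>\<epsilon>\<close> is asked for whose double isolates
    \<open>y\<close>. As a union of balls around \<open>y\<close> the set is open.\<close>
  define U where "U y = {z. \<exists>\<epsilon>. 0 < \<epsilon> \<and> z \<in> X \<and> dist_on y z < \<epsilon> \<and>
    (\<forall>w. length w = n \<longrightarrow> w \<in> Y \<longrightarrow> dist_on y w < \<epsilon> + \<epsilon> \<longrightarrow> w = y)}" for y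
  have inU: "y \<in> U y" if y: "y \<in> Y" for y
  proof -
    have yX: "y \<in> X" using y Y(1) by blast
    obtain \<delta> where \<delta>: "0 < \<delta>" "\<And>z. z \<in> Y \<Longrightarrow> dist_on y z < \<delta> \<Longrightarrow> z = y"
      using Y(3) y unfolding metric_discrete_def by blast
    obtain \<epsilon> where \<epsilon>: "0 < \<epsilon>" "\<epsilon> + \<epsilon> < \<delta>" using ex_double_less[OF \<delta>(1)] by blast
    have "w = y" if "w \<in> Y" "dist_on y w < \<epsilon> + \<epsilon>" for w
      using \<delta>(2)[OF that(1)] that(2) \<epsilon>(2) by (meson less_trans)
    then show ?thesis unfolding U_def using \<epsilon>(1) yX by auto
  qed
  have eq: "y = y'" if y: "y \<in> Y" "y' \<in> Y" "z \<in> U y" "z \<in> U y'" for y y' z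
  proof -
    have yX: "y \<in> X" "y' \<in> X" using y Y(1) by auto
    obtain \<epsilon> where \<epsilon>: "0 < \<epsilon>" "z \<in> X" "dist_on y z < \<epsilon>" "\<And>w. w \<in> Y \<Longrightarrow> dist_on y w < \<epsilon> + \<epsilon> \<Longrightarrow> w = y"
      using y(3) Y(1) len_X unfolding U_def by blast
    obtain \<epsilon>' where \<epsilon>': "0 < \<epsilon>'" "dist_on y' z < \<epsilon>'" "\<And>w. w \<in> Y \<Longrightarrow> dist_on y' w < \<epsilon>' + \<epsilon>' \<Longrightarrow> w = y'"
      using y(4) Y(1) len_X unfolding U_def by blast
    \<comment> \<open>The triangle inequality is recorded in both orders of summation. In either
      case the smaller radius then stands on the right and can be raised to the larger one without
      commutativity.\<close>
    have 1: "dist_on y y' < \<epsilon> + \<epsilon>'"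
      by (rule dist_triangle_less[OF yX(1) \<epsilon>(2) yX(2) \<epsilon>(3)]) (use \<epsilon>' dist_sym yX \<epsilon> in simp)
    have 2: "dist_on y' y < \<epsilon>' + \<epsilon>"
      by (rule dist_triangle_less[OF yX(2) \<epsilon>(2) yX(1) \<epsilon>'(2)]) (use \<epsilon> dist_sym yX in simp)
    show ?thesis
    proof (cases "\<epsilon> \<le> \<epsilon>'")
      case True
      then have "\<epsilon>' + \<epsilon> \<le> \<epsilon>' + \<epsilon>'" by (rule add_left_mono_group)
      then show ?thesis using \<epsilon>'(3)[OF y(1)] 2 by (meson less_le_trans)
    next
      case False
      then have "\<epsilon> + \<epsilon>' \<le> \<epsilon> + \<epsilon>" by (intro add_left_mono_group) simp
      then show ?thesis using \<epsilon>(4)[OF y(2)] 1 by (metis less_le_trans)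
    qed
  qed
  have "definable_family \<M> n n Y U"
  proof (rule definable_familyI)
    show "dfaml n n U"
      unfolding dfaml_def U_def mem_Collect_eq
      by (intro qintros dp_mem[OF dset_X] dp_mem[OF Y(2)] df_dist dp_eql[where n = n])
    show "definable \<M> n Y" using Y len_X by (auto simp: definable_iff)
    show "U y \<subseteq> {a. length a = n}" for y using len_X by (auto simp: U_def)
  qed
  moreover have "inj_on U Y" by (rule inj_onI) (use eq inU in blast)
  then have "infinite (U ` Y)" using Y(4) by (simp add: finite_image_iff)
  moreover have "pairwise disjnt (U ` Y)"
    unfolding pairwise_def disjnt_def using eq by blast
  moreover have "openin (metric_top X d) (U y)" if y: "y \<in> Y" for y
    unfolding openin_metric_top
  proof (intro conjI ballI)
    have yX: "y \<in> X" using y Y(1) by blast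
    fix z assume "z \<in> U y"
    then obtain \<epsilon> where \<epsilon>: "0 < \<epsilon>" "z \<in> ball y \<epsilon>"
      "\<And>w. length w = n \<longrightarrow> w \<in> Y \<longrightarrow> dist_on y w < \<epsilon> + \<epsilon> \<longrightarrow> w = y"
      unfolding U_def ball_def by blast
    obtain s where "0 < s" "ball z s \<subseteq> ball y \<epsilon>" using ball_open[OF yX \<epsilon>(2)] by blast
    moreover have "ball y \<epsilon> \<subseteq> U y" using \<epsilon>(1,3) unfolding U_def ball_def by blast
    ultimately show "\<exists>t>0. ball z t \<subseteq> U y" by blast
  qed (auto simp: U_def)
  ultimately show False using sep unfolding definably_separable_def by blast
qed

text \<open>Working inside an arbitrary definable \<open>Z\<close> settles the hereditary version at
  once, since discreteness of the set of chosen points refers to the metric only and not to the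
  ambient space.\<close>

lemma no_discrete_imp_separable:
  assumes nd: "no_discrete n X dist_on"
  shows "hereditarily_definably_separable \<M> n (metric_top X d)"
  unfolding hereditarily_definably_separable_def definably_separable_def topspace_metric_top
proof (intro allI impI notI, elim conjE exE)
  fix Z m B U
  assume Z: "definable \<M> n Z" "Z \<subseteq> X" and fam: "definable_family \<M> n m B U"
    and inf: "infinite (U ` B)" and disj: "pairwise disjnt (U ` B)"
    and op: "\<forall>b\<in>B. openin (subtopology (metric_top X d) Z) (U b)"
  define V where "V b = (if b \<in> B then U b else {})" for b
  note fam' = definable_family_dfaml[OF fam, folded V_def]
  have same: "U b = U b'" if "b \<in> B" "b' \<in> B" "y \<in> U b" "y \<in> U b'" for b b' y
    using disj that unfolding pairwise_def disjnt_def by blast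
  have UZ: "U b \<subseteq> Z" if "b \<in> B" for b using op that openin_subset by fastforce
  have dU: "dset n (U b)" if b: "b \<in> B" for b
  proof -
    have "length b = m" using fam'(3) b by blast
    then have "dp (\<lambda>e. map e [0..<n] \<in> V b)" by (intro dp_faml[OF fam'(1)] dl_const dintros)
    then show ?thesis using b by (simp add: dset_def V_def)
  qed
  define c where "c b = list_choice n (V b)" for b
  have c: "c b \<in> U b" if b: "b \<in> B" "U b \<noteq> {}" for b
  proof -
    obtain x where x: "x \<in> U b" using b by blast
    then have "length x = n" using fam'(4)[OF b(1)] by blast
    then have "list_choice n (U b) \<in> U b" by (rule list_choice_mem[OF dU[OF b(1)] x])
    then show ?thesis using b(1) by (simp add: c_def V_def)
  qed
  define Y where "Y = {y. \<exists>b. length b = m \<and> (b \<in> B \<and> y \<in> V b \<and> y = c b)}"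
  have Y: "y \<in> Y \<longleftrightarrow> (\<exists>b\<in>B. y \<in> U b \<and> y = c b)" for y
    using fam'(3) by (auto simp: Y_def V_def)
  have dc: "dl m L \<Longrightarrow> dl n (\<lambda>e. c (L e))" for L
    unfolding c_def by (intro dl_list_choice dp_faml[OF fam'(1)] dintros) (auto simp: dl_def
      df_shift[where t = "\<lambda>e. L e ! i" for i])
  have "dset n Y"
    unfolding dset_def Y_def mem_Collect_eq
    by (intro qintros dp_mem[OF fam'(2)] dp_faml[OF fam'(1)] dp_eql[where n = n] dc)
  moreover have "Y \<subseteq> X" using Y UZ Z(2) by blast
  moreover have "metric_discrete dist_on Y"
    unfolding metric_discrete_def
  proof
    fix y assume "y \<in> Y"
    then obtain b where b: "b \<in> B" "y \<in> U b" "y = c b" using Y by blast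
    obtain T where T: "openin (metric_top X d) T" "U b = T \<inter> Z"
      using op b(1) by (auto simp: openin_subtopology)
    then obtain t where t: "0 < t" "ball y t \<subseteq> T" using b(2) unfolding openin_metric_top by blast
    have "z = y" if z: "z \<in> Y" "dist_on y z < t" for z
    proof -
      obtain b' where b': "b' \<in> B" "z \<in> U b'" "z = c b'" using z(1) Y by blast
      have "z \<in> Z" using UZ b' by blast
      then have "z \<in> U b" using t(2) z(2) Z(2) T(2) by (auto simp: ball_def)
      \<comment> \<open>\<open>b\<close> and \<open>b'\<close> may be different indices of one
        member; their chosen points agree because \<open>list_choice\<close> depends on the set
        only.\<close>
      then have "U b = U b'" using same b b' by blast
      then show ?thesis using b b' by (simp add: c_def V_def)
    qed
    then show "\<exists>\<epsilon>>0. \<forall>z\<in>Y. dist_on y z < \<epsilon> \<longrightarrow> z = y" using t(1) by blast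
  qed
  ultimately have "finite Y" using nd unfolding no_discrete_def by blast
  \<comment> \<open>A nonempty member is the only one through its chosen point, so finitely many
    chosen points leave finitely many nonempty members. The empty set has no chosen point and is
    treated apart.\<close>
  moreover have "U ` B - {{}} \<subseteq> (\<lambda>y. THE W. W \<in> U ` B \<and> y \<in> W) ` Y"
  proof
    fix W assume "W \<in> U ` B - {{}}"
    then obtain b where b: "b \<in> B" "W = U b" "U b \<noteq> {}" by blast
    have "(THE W. W \<in> U ` B \<and> c b \<in> W) = U b"
      by (rule the_equality) (use b c same in blast)+
    then have "W = (THE W. W \<in> U ` B \<and> c b \<in> W)" using b(2) by simp
    moreover have "c b \<in> Y" using Y b(1) c[OF b(1,3)] by blast
    ultimately show "W \<in> (\<lambda>y. THE W. W \<in> U ` B \<and> y \<in> W) ` Y" by (rule image_eqI)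
  qed
  ultimately have "finite (U ` B - {{}})" by (meson finite_imageI finite_subset)
  then show False using inf by simp
qed

section \<open>Second-countability excludes infinite discrete subspaces\<close>

lemma second_countable_imp_no_discrete:
  assumes "definably_second_countable \<M> n (metric_top X d)"
  shows "no_discrete n X dist_on"
  unfolding no_discrete_def
proof (intro allI impI, rule ccontr)
  fix Y assume Y: "Y \<subseteq> X" "dset n Y" "metric_discrete dist_on Y" "infinite Y"
  obtain m B U where basis: "definable_basis \<M> n (metric_top X d) m B U"
    and dims: "\<And>x b. x \<in> X \<Longrightarrow> b \<in> B \<Longrightarrow> x \<in> U b \<Longrightarrow> o_dim \<M> {c \<in> B. x \<in> U c \<and> U c \<subseteq> U b} = o_dim \<M> B"
    using assms unfolding definably_second_countable_def topspace_metric_top by blast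
  have fam: "definable_family \<M> n m B U"
    and op: "openin (metric_top X d) = arbitrary union_of (\<lambda>V. V \<in> U ` B)"
    using basis by (auto simp: definable_basis_def)
  define V where "V b = (if b \<in> B then U b else {})" for b
  note fam' = definable_family_dfaml[OF fam, folded V_def]
  have B: "definable \<M> m B" using fam'(2,3) by (simp add: definable_iff)
  \<comment> \<open>\<open>dge_finite_to_one\<close> takes its parameter from \<open>M\<close>, so
    the points of \<open>Y\<close> are grouped by a coordinate that has infinitely many values on
    \<open>Y\<close>.\<close>
  have "\<exists>i<n. infinite ((\<lambda>y. y ! i) ` Y)"
  proof (rule ccontr)
    assume "\<not> ?thesis"
    then have "finite (\<Union>i<n. (\<lambda>y. y ! i) ` Y)" by simp
    then have "finite {y. set y \<subseteq> (\<Union>i<n. (\<lambda>y. y ! i) ` Y) \<and> length y = n}"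
      by (rule finite_lists_length_eq)
    moreover have "Y \<subseteq> {y. set y \<subseteq> (\<Union>i<n. (\<lambda>y. y ! i) ` Y) \<and> length y = n}"
      using Y(1) len_X by (fastforce simp: in_set_conv_nth)
    ultimately show False using Y(4) finite_subset by blast
  qed
  then obtain i where i: "i < n" "infinite ((\<lambda>y. y ! i) ` Y)" by blast
  \<comment> \<open>Indices of basis elements that meet \<open>Y\<close> in a single point, this
    point having \<open>i\<close>-th coordinate \<open>t\<close>. An index determines the point and
    with it \<open>t\<close>, so the sets \<open>C t\<close> are disjoint.\<close>
  define C where "C t = {c. c \<in> B \<and> (\<exists>y. length y = n \<and> (y \<in> Y \<and> y ! i = t \<and> y \<in> V c \<and>
      (\<forall>w. length w = n \<longrightarrow> w \<in> Y \<longrightarrow> w \<in> V c \<longrightarrow> w = y)))}" for t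
  have nth: "dl n L \<Longrightarrow> df (\<lambda>e. L e ! i)" for L using i(1) by (simp add: dl_nth)
  have dC: "dfam m C"
    unfolding dfam_def C_def mem_Collect_eq
    by (intro qintros dp_mem[OF fam'(2)] dp_mem[OF Y(2)] dp_faml[OF fam'(1)] nth dp_eql[where n =
      n])
  have fin: "finite {t. c \<in> C t}" for c
  proof -
    have "t = t'" if "c \<in> C t" "c \<in> C t'" for t t' using that unfolding C_def by blast
    then show ?thesis by (metis (no_types, lifting) finite.simps finite_subset insertCI
      mem_Collect_eq subsetI)
  qed
  \<comment> \<open>Take a basis element inside a ball that isolates \<open>y\<close>. By
    second-countability the indices of the smaller basis elements around \<open>y\<close> have the
    dimension of \<open>B\<close>, and these elements meet \<open>Y\<close> in \<open>y\<close>
    only.\<close>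
  have large: "dge m k (C (y ! i))" if y: "y \<in> Y" and k: "dge m k B" for y k
  proof -
    have yX: "y \<in> X" using y Y(1) by blast
    obtain \<epsilon> where \<epsilon>: "0 < \<epsilon>" "\<And>z. z \<in> Y \<Longrightarrow> dist_on y z < \<epsilon> \<Longrightarrow> z = y"
      using Y(3) y unfolding metric_discrete_def by blast
    have "(arbitrary union_of (\<lambda>V. V \<in> U ` B)) (ball y \<epsilon>)" using openin_ball[OF yX] op by simp
    then obtain b where b: "b \<in> B" "y \<in> U b" "U b \<subseteq> ball y \<epsilon>"
      using arbitrary_union_of_mem[OF _ ball_center[OF yX \<epsilon>(1)]] by blast
    let ?E = "{c \<in> B. y \<in> U c \<and> U c \<subseteq> U b}"
    have Ub: "dset n (U b)"
    proof -
      have "dp (\<lambda>e. map e [0..<n] \<in> V b)"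
        by (intro dp_faml[OF fam'(1)] dl_const dintros) (use fam'(3) b in blast)
      then show ?thesis using b by (simp add: dset_def V_def)
    qed
    have "dset m {c. c \<in> B \<and> y \<in> V c \<and> (\<forall>w. length w = n \<longrightarrow> w \<in> V c \<longrightarrow> w \<in> U b)}"
      unfolding dset_def mem_Collect_eq
      by (intro qintros dp_mem[OF fam'(2)] dp_mem[OF Ub] dp_faml[OF fam'(1)] dl_const len_X yX)
    moreover have "{c. c \<in> B \<and> y \<in> V c \<and> (\<forall>w. length w = n \<longrightarrow> w \<in> V c \<longrightarrow> w \<in> U b)} = ?E"
      using fam'(4) by (auto simp: V_def)
    ultimately have "definable \<M> m ?E" using fam'(3) by (auto simp: definable_iff)
    then have "dge m k ?E"
      by (rule o_dim_eq_imp_dge[OF B _ dims[OF yX b(1,2), symmetric] k])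
    then show ?thesis
    proof (rule dge_mono)
      fix c assume c: "c \<in> ?E"
      have "w = y" if "w \<in> Y" "w \<in> U c" for w
      proof (rule \<epsilon>(2)[OF that(1)])
        have "w \<in> ball y \<epsilon>" using that(2) c b(3) by blast
        then show "dist_on y w < \<epsilon>" by (simp add: ball_def)
      qed
      moreover have "V c = U c" using c by (simp add: V_def)
      ultimately show "c \<in> C (y ! i)" using c y len_X[OF yX] unfolding C_def by blast
    qed
  qed
  obtain y where y: "y \<in> Y" using infinite_imp_nonempty[OF Y(4)] by blast
  have "\<exists>k. dge m k B \<and> \<not> dge m (Suc k) B"
  proof (rule ccontr)
    assume *: "\<not> ?thesis"
    have yX: "y \<in> X" using y Y(1) by blast
    obtain t :: 'm where "0 < t" using gt_ex by blast
    then obtain b where "b \<in> B"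
      using openin_ball[OF yX, of t] arbitrary_union_of_mem[OF _ ball_center[OF yX]] unfolding op
        by blast
    then have "dge m 0 B" using fam'(3) by (auto simp: dge_0)
    then have "dge m k B" for k using * by (induction k) auto
    then show False using dge_le[of m "Suc m" B] by simp
  qed
  then obtain k where k: "dge m k B" "\<not> dge m (Suc k) B" by blast
  have "(\<lambda>y. y ! i) ` Y \<subseteq> {t. dge m k (C t)}" using large k(1) by blast
  then have "infinite {t. dge m k (C t)}" using i(2) finite_subset by blast
  then have "dge m (Suc k) (\<Union>t. C t)" by (rule dge_finite_to_one[OF dC fin])
  then have "dge m (Suc k) B" by (rule dge_mono) (auto simp: C_def)
  then show False using k(2) by blast
qed

section \<open>Local dimension and the construction of a basis\<close>

definition local_dge :: "'m list \<Rightarrow> nat \<Rightarrow> bool" where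
  "local_dge x k \<longleftrightarrow> (\<forall>\<epsilon>. 0 < \<epsilon> \<longrightarrow> dge n k (ball x \<epsilon>))"

definition stratum :: "nat \<Rightarrow> 'm list set" where
  "stratum k = {x. x \<in> X \<and> local_dge x k \<and> \<not> local_dge x (Suc k)}"

lemma dp_ball: "dl n L \<Longrightarrow> dl n K \<Longrightarrow> df t \<Longrightarrow> dp (\<lambda>e. L e \<in> ball (K e) (t e))"
  unfolding ball_def mem_Collect_eq by (intro dp_conj dp_mem[OF dset_X] dp_less df_dist)

lemma dset_stratum: "dset n (stratum k)"
proof -
  have "dp (\<lambda>e. local_dge (map e [0..<n]) k)" for k
    unfolding local_dge_def by (intro qintros dp_dge dp_ball)
  then show ?thesis unfolding dset_def stratum_def mem_Collect_eq
    by (intro dp_conj dp_neg dp_mem[OF dset_X] dintros)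
qed

lemma stratum_cover:
  assumes x: "x \<in> X" obtains k where "k \<le> n" "x \<in> stratum k"
proof -
  have "\<exists>k. local_dge x k \<and> \<not> local_dge x (Suc k)"
  proof (rule ccontr)
    assume *: "\<not> ?thesis"
    have "local_dge x 0" using ball_center[OF x] len_X[OF x] by (auto simp: local_dge_def dge_0)
    then have "local_dge x k" for k using * by (induction k) auto
    then have "local_dge x (Suc n)" .
    then show False using dge_le[of n "Suc n"] gt_ex[of "0 :: 'm"] by (auto simp: local_dge_def)
  qed
  then obtain k where k: "local_dge x k" "\<not> local_dge x (Suc k)" by blast
  moreover have "k \<le> n" using k(1) dge_le gt_ex[of "0 :: 'm"] by (auto simp: local_dge_def)
  ultimately show ?thesis using that x by (auto simp: stratum_def)
qed

text \<open>Otherwise \<open>ex_full_ball_point\<close> gives a point of the stratum whose balls all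
  have dimension at least \<open>k + 1\<close>, contrary to its local dimension.\<close>

lemma not_dge_stratum:
  assumes nd: "no_discrete n X dist_on" shows "\<not> dge n (Suc k) (stratum k)"
proof
  assume large: "dge n (Suc k) (stratum k)"
  have "stratum k \<subseteq> X" by (auto simp: stratum_def)
  from ex_full_ball_point[OF dmetric_dist_on is_metric_dist nd this dset_stratum large]
  obtain z where z: "z \<in> stratum k" "\<And>\<epsilon>. 0 < \<epsilon> \<Longrightarrow> dge n (Suc k) {w \<in> stratum k. dist_on z w < \<epsilon>}"
    by blast
  have "dge n (Suc k) (ball z \<epsilon>)" if "0 < \<epsilon>" for \<epsilon>
    using z(2)[OF that] by (rule dge_mono) (auto simp: ball_def stratum_def)
  then show False using z(1) by (auto simp: stratum_def local_dge_def)
qed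

text \<open>Otherwise the points of a small ball outside the stratum have dimension
  \<open>k\<close>, and one of them has only balls of dimension at least \<open>k\<close>. The small
  ball excludes dimension \<open>k + 1\<close>, so that point belongs to the stratum after
  all.\<close>

lemma dge_ball_stratum:
  assumes nd: "no_discrete n X dist_on" and x: "x \<in> stratum k" and "0 < \<epsilon>"
  shows "dge n k (ball x \<epsilon> \<inter> stratum k)"
proof (rule ccontr)
  assume neg: "\<not> ?thesis"
  have xX: "x \<in> X" using x by (simp add: stratum_def)
  obtain \<epsilon>' where \<epsilon>': "0 < \<epsilon>'" "\<not> dge n (Suc k) (ball x \<epsilon>')"
    using x by (auto simp: stratum_def local_dge_def)
  define \<delta> where "\<delta> = min \<epsilon> \<epsilon>'"
  have \<delta>: "0 < \<delta>" "ball x \<delta> \<subseteq> ball x \<epsilon>" "ball x \<delta> \<subseteq> ball x \<epsilon>'"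
    using \<epsilon>' assms(3) ball_mono by (auto simp: \<delta>_def)
  let ?Z = "ball x \<delta> - stratum k"
  have dZ: "dset n ?Z"
  proof (rule dset_Diff[OF _ dset_stratum])
    show "dset n (ball x \<delta>)" unfolding dset_def by (intro dp_ball dl_const len_X xX dintros)
  qed
  have "dge n k (ball x \<delta>)" using x \<delta>(1) by (auto simp: stratum_def local_dge_def)
  moreover have "\<not> dge n k (ball x \<delta> \<inter> stratum k)"
    using neg dge_mono[of n k "ball x \<delta> \<inter> stratum k" "ball x \<epsilon> \<inter> stratum k"] \<delta>(2) by blast
  ultimately have "dge n k ?Z"
    using dge_Un[of n k ?Z "ball x \<delta> \<inter> stratum k"] by (simp add: Un_Diff_Int)
  moreover have "?Z \<subseteq> X" by (auto simp: ball_def)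
  ultimately obtain z where z: "z \<in> ?Z" "\<And>\<eta>. 0 < \<eta> \<Longrightarrow> dge n k {w \<in> ?Z. dist_on z w < \<eta>}"
    using ex_full_ball_point[OF dmetric_dist_on is_metric_dist nd _ dZ] by blast
  have "local_dge z k"
    unfolding local_dge_def
  proof (intro allI impI)
    fix \<eta> :: 'm assume "0 < \<eta>"
    from z(2)[OF this] show "dge n k (ball z \<eta>)" by (rule dge_mono) (auto simp: ball_def)
  qed
  moreover have "\<not> local_dge z (Suc k)"
  proof
    assume z': "local_dge z (Suc k)"
    obtain s where s: "0 < s" "ball z s \<subseteq> ball x \<delta>" using ball_open[OF xX, of z \<delta>] z(1) by blast
    have "dge n (Suc k) (ball z s)" using z' s(1) by (simp add: local_dge_def)
    then have "dge n (Suc k) (ball x \<epsilon>')" by (rule dge_mono) (use s(2) \<delta>(3) in blast)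
    then show False using \<epsilon>'(2) by blast
  qed
  ultimately show False using z(1) by (auto simp: stratum_def ball_def)
qed

text \<open>The basis consists of the balls with centre \<open>z\<close> and radius \<open>t\<close>. Centres of local dimension \<open>k\<close>
  are
  indexed with \<open>n - k\<close> further free coordinates, so that every stratum of the index set has
  dimension \<open>n + 1\<close>.\<close>

lemma no_discrete_imp_second_countable:
  assumes nd: "no_discrete n X dist_on"
  shows "definably_second_countable \<M> n (metric_top X d)"
proof -
  \<comment> \<open>Coordinates for the centre (\<open>n\<close>), the radius (1) and the padding
    (\<open>n\<close>). In \<open>P k\<close> the last \<open>k\<close> are zero; counting the
    radius, this leaves \<open>Suc n - k\<close> free coordinates beyond the centre.\<close>
  let ?N = "Suc (n + n)"
  define P where "P k E J = padded n (?N - k) E J ?N" for k and E :: "'m list set" and J :: "'m set"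
  define B where "B = (\<Union>k\<le>n. P k (stratum k) {0<..})"
  define U where "U b = ball (take n b) (b ! n)" for b
  have P: "b \<in> P k E J \<longleftrightarrow> length b = ?N \<and> take n b \<in> E \<and> b ! n \<in> J \<and> (\<forall>i<?N. ?N - k \<le> i \<longrightarrow> b ! i = 0)"
    for b k E J by (simp add: P_def padded_def)
  have dP: "definable \<M> ?N (P k E J)" if E: "dset n E" and J: "dp1 J" for k E J
  proof -
    have tk: "dl n (\<lambda>e. take n (map e [0..<?N]))" by (rule dl_take[of ?N]) (intro dintros, simp)
    have nt: "i < ?N \<Longrightarrow> df (\<lambda>e. map e [0..<?N] ! i)" for i by (rule dl_nth[of ?N]) (intro dintros)
    have "dp (\<lambda>e. take n (map e [0..<?N]) \<in> E \<and> map e [0..<?N] ! n \<in> J \<and>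
        (\<forall>i<?N. ?N - k \<le> i \<longrightarrow> map e [0..<?N] ! i = 0))"
      by (intro dp_conj dp_mem[OF E] tk dp_mem1[OF J] nt dp_ball_less dp_imp dp_const dp_eq
        df_const) simp_all
    then have "dset ?N (P k E J)" unfolding dset_def P by (simp del: upt_Suc)
    then show ?thesis by (auto simp: definable_iff P)
  qed
  have dimP: "dge ?N (j + (Suc n - k)) (P k E J) \<longleftrightarrow> dge n j E" if "k \<le> n" "infinite J" for j k E J
    using dge_padded[OF that(2), of n "?N - k" ?N j E] that(1) by (simp add: P_def Suc_diff_le)
  have pos: "dp1 {0<..}" unfolding dp1_def greaterThan_iff by (intro dintros)
  have inf_pos: "infinite {0::'m<..}"
  proof -
    obtain t :: 'm where t: "0 < t" using gt_ex by blast
    have "{0<..<t} \<subseteq> {0<..}" by auto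
    then show ?thesis using infinite_Ioo[OF t] finite_subset by blast
  qed
  have dB: "definable \<M> ?N B"
  proof -
    have "dp (\<lambda>e. \<not> (\<forall>k<Suc n. \<not> map e [0..<?N] \<in> P k (stratum k) {0<..}))"
      using dP[OF dset_stratum pos]
      by (intro dp_neg dp_ball_less) (simp add: definable_iff dset_def)
    then have "dset ?N B" by (simp add: dset_def B_def less_Suc_eq_le Bex_def del: upt_Suc)
    then show ?thesis by (auto simp: definable_iff B_def P)
  qed
  have Bdim: "\<not> dge ?N (Suc (Suc n)) B"
  proof
    assume "dge ?N (Suc (Suc n)) B"
    then have "\<exists>k\<in>{..n}. dge ?N (Suc (Suc n)) (P k (stratum k) {0<..})"
      unfolding B_def by (rule dge_UN[OF finite_atMost])
    then obtain k where k: "k \<le> n" "dge ?N (Suc (Suc n)) (P k (stratum k) {0<..})" by auto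
    have "Suc k + (Suc n - k) = Suc (Suc n)" using k(1) by simp
    from dimP[OF k(1) inf_pos, of "Suc k" "stratum k", unfolded this]
    have "dge n (Suc k) (stratum k)" using k(2) by blast
    then show False using not_dge_stratum[OF nd] by blast
  qed
  have center: "take n b \<in> X" if "b \<in> B" for b using that by (auto simp: B_def P stratum_def)
  have fam: "definable_family \<M> n ?N B U"
  proof (rule definable_familyI[OF _ dB])
    have L: "dl ?N (\<lambda>e. map e [0..<?N])" by (intro dintros)
    have "dl n (\<lambda>e. take n (map e [0..<?N]))" by (rule dl_take[OF L]) simp
    moreover have "df (\<lambda>e. map e [0..<?N] ! n)" by (rule dl_nth[OF L]) simp
    ultimately show "dfaml ?N n U" unfolding dfaml_def U_def by (intro dp_ball dl_map df_var)
    show "U b \<subseteq> {a. length a = n}" for b using len_X by (auto simp: U_def ball_def)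
  qed
  have index: "\<exists>b\<in>B. U b = ball x t" if x: "x \<in> X" and t: "0 < t" for x t
  proof -
    obtain k where k: "k \<le> n" "x \<in> stratum k" using stratum_cover[OF x] .
    let ?b = "x @ [t] @ replicate n 0"
    have "?b \<in> P k (stratum k) {0<..}"
      using k len_X[OF x] t by (auto simp: P nth_append nth_Cons')
    then have "?b \<in> B" using k(1) by (auto simp: B_def)
    moreover have "U ?b = ball x t" using len_X[OF x] by (simp add: U_def nth_append)
    ultimately show ?thesis by blast
  qed
  have open_eq: "openin (metric_top X d) S \<longleftrightarrow> (arbitrary union_of (\<lambda>V. V \<in> U ` B)) S" for S
  proof
    assume S: "openin (metric_top X d) S"
    let ?F = "{V \<in> U ` B. V \<subseteq> S}"
    have "x \<in> \<Union>?F" if x: "x \<in> S" for x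
    proof -
      obtain t where t: "0 < t" "ball x t \<subseteq> S" "x \<in> X"
        using S x unfolding openin_metric_top by blast
      then obtain b where "b \<in> B" "U b = ball x t" using index by blast
      then show ?thesis using t ball_center[OF t(3,1)] by blast
    qed
    then have "\<Union>?F = S" by blast
    then show "(arbitrary union_of (\<lambda>V. V \<in> U ` B)) S"
      unfolding union_of_def arbitrary_def by (intro exI[of _ ?F]) auto
  next
    assume "(arbitrary union_of (\<lambda>V. V \<in> U ` B)) S"
    then obtain F where F: "F \<subseteq> {V. V \<in> U ` B}" "\<Union>F = S" unfolding union_of_def by auto
    have "openin (metric_top X d) V" if "V \<in> F" for V
    proof -
      obtain b where "b \<in> B" "V = U b" using F(1) \<open>V \<in> F\<close> by blast
      then show ?thesis using openin_ball center by (simp add: U_def)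
    qed
    then show "openin (metric_top X d) S" using F(2) openin_Union by metis
  qed
  have "o_dim \<M> {c \<in> B. x \<in> U c \<and> U c \<subseteq> U b} = o_dim \<M> B"
    if x: "x \<in> X" and b: "b \<in> B" "x \<in> U b" for x b
  proof -
    let ?E = "{c \<in> B. x \<in> U c \<and> U c \<subseteq> U b}"
    obtain k where k: "k \<le> n" "x \<in> stratum k" using stratum_cover[OF x] .
    obtain r where r: "0 < r" "ball x r \<subseteq> U b"
      using ball_open[OF center[OF b(1)], of x "b ! n"] b(2) by (auto simp: U_def)
    obtain \<rho> where \<rho>: "0 < \<rho>" "\<rho> + \<rho> < r" using ex_double_less[OF r(1)] by blast
    have "- \<rho> + (\<rho> + \<rho>) < - \<rho> + r" using \<rho>(2) by (simp only: group_add_less_left)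
    then have \<rho>': "\<rho> < - \<rho> + r" by (simp flip: add.assoc)
    \<comment> \<open>For a centre within \<open>\<rho>\<close> of \<open>x\<close> and a radius
      between \<open>\<rho>\<close> and \<open>- \<rho> + r\<close>, the ball contains
      \<open>x\<close> and stays inside \<open>ball x r\<close>. Centre and radius vary
      independently, so these indices have the full dimension \<open>n + 1\<close>.\<close>
    let ?S = "P k (ball x \<rho> \<inter> stratum k) {\<rho><..<- \<rho> + r}"
    have "dge n k (ball x \<rho> \<inter> stratum k)" by (rule dge_ball_stratum[OF nd k(2) \<rho>(1)])
    then have "dge ?N (k + (Suc n - k)) ?S" using dimP[OF k(1) infinite_Ioo[OF \<rho>'], of k] by blast
    moreover have "k + (Suc n - k) = Suc n" using k(1) by simp
    ultimately have "dge ?N (Suc n) ?S" by (simp only:)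
    then have large: "dge ?N (Suc n) ?E"
    proof (rule dge_mono)
      fix c assume c: "c \<in> ?S"
      let ?z = "take n c" and ?t = "c ! n"
      have z: "?z \<in> X" "dist_on x ?z < \<rho>" "\<rho> < ?t" "?t < - \<rho> + r" using c by (auto simp: P ball_def)
      have "c \<in> P k (stratum k) {0<..}" using c \<rho>(1) by (auto simp: P)
      then have "c \<in> B" using k(1) by (auto simp: B_def)
      moreover have "x \<in> U c" using z x dist_sym[OF z(1) x] by (auto simp: U_def ball_def)
      moreover have "w \<in> U b" if "w \<in> U c" for w
      proof -
        have w: "w \<in> X" "dist_on ?z w < - \<rho> + r" using that z by (auto simp: U_def ball_def)
        have "dist_on x w < \<rho> + (- \<rho> + r)" by (rule dist_triangle_less[OF x z(1) w(1) z(2) w(2)])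
        then have "w \<in> ball x r" using w(1) by (simp add: ball_def flip: add.assoc)
        then show ?thesis using r(2) by blast
      qed
      ultimately show "c \<in> ?E" by blast
    qed
    have "definable \<M> ?N ?E"
    proof -
      note f = definable_family_dfaml[OF fam]
      have lb: "length b = ?N" using f(3) b(1) by blast
      have "dset ?N {c. c \<in> B \<and> x \<in> (if c \<in> B then U c else {}) \<and>
         (\<forall>w. length w = n \<longrightarrow> w \<in> (if c \<in> B then U c else {}) \<longrightarrow> w \<in> (if b \<in> B then U b else {}))}"
        unfolding dset_def mem_Collect_eq
        by (intro qintros dp_mem[OF f(2)] dp_faml[OF f(1)] dl_const len_X x lb)
      moreover have "{c. c \<in> B \<and> x \<in> (if c \<in> B then U c else {}) \<and>
         (\<forall>w. length w = n \<longrightarrow> w \<in> (if c \<in> B then U c else {}) \<longrightarrow> w \<in> (if b \<in> B then U b else {}))} =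
           ?E"
        using b(1) f(4) by auto
      ultimately show ?thesis using f(3) by (auto simp: definable_iff)
    qed
    then show ?thesis by (rule o_dim_eq_maximal[OF _ dB _ large Bdim]) blast
  qed
  moreover have "definable_basis \<M> n (metric_top X d) ?N B U"
    unfolding definable_basis_def using fam open_eq by blast
  ultimately show ?thesis unfolding definably_second_countable_def topspace_metric_top by blast
qed

end

theorem theorem5p5:
  fixes \<M> :: "('f, 'r, 'm::{linordered_group_add, unbounded_dense_linorder}) expansion"
    and n :: nat
    and X :: "'m list set"
    and d :: "'m list \<Rightarrow> 'm list \<Rightarrow> 'm"
  assumes "o_minimal \<M>"
    and "definable_metric_space \<M> n X d"
  shows "(definably_separable \<M> n (metric_top X d)
            \<longleftrightarrow> hereditarily_definably_separable \<M> n (metric_top X d)) \<and>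
         (hereditarily_definably_separable \<M> n (metric_top X d)
            \<longleftrightarrow> \<not> (\<exists>Y. infinite Y \<and> definable_discrete_subspace \<M> n (metric_top X d) Y)) \<and>
         (\<not> (\<exists>Y. infinite Y \<and> definable_discrete_subspace \<M> n (metric_top X d) Y)
            \<longleftrightarrow> definably_second_countable \<M> n (metric_top X d))"
proof -
  interpret definable_metric \<M> n X d by unfold_locales (rule assms)+
  have "definably_separable \<M> n (metric_top X d)"
    if "hereditarily_definably_separable \<M> n (metric_top X d)"
  proof -
    have "definable \<M> n X" using dset_X len_X by (auto simp: definable_iff)
    then have "definably_separable \<M> n (subtopology (metric_top X d) X)"
      using that unfolding hereditarily_definably_separable_def topspace_metric_top by blast
    then show ?thesis using subtopology_topspace[of "metric_top X d"] by simp
  qed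
  then show ?thesis
    using separable_imp_no_discrete no_discrete_imp_separable
      second_countable_imp_no_discrete no_discrete_imp_second_countable
    unfolding no_discrete_iff[symmetric] by blast
qed

end
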